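(* Let $\sigma$ be a partition of the set of all primes and let $G$ be a finite group. Then $m_{\sigma q}(G)=2$ if and only if $G$ is a supersoluble group with $m_\sigma(G)=2$.
   Context: All groups are finite. $\sigma=\{\sigma_i\mid i\in I\}$, $I\subseteq\mathbb{N}$, is a partition of the set $\mathbb{P}$ of all primes: $\mathbb{P}=\bigcup_{i\in I}\sigma_i$ and $\sigma_i\cap\sigma_j=\emptyset$ for $i\neq j$. $\pi(G)$ is the set of primes dividing $|G|$ and $\sigma(G)=\{\sigma_i\mid\sigma_i\cap\pi(G)\neq\emptyset\}$. A group $G$ is $\sigma$-primary if $|\sigma(G)|\leq 1$. A complete Hall $\sigma$-set of $G$ is a set $\mathcal{H}$ of subgroups of $G$ such that every member $\neq 1$ of $\mathcal{H}$ is a Hall $\sigma_i$-subgroup of $G$ for some $i\in I$ and $\mathcal{H}$ contains exactly one Hall $\sigma_i$-subgroup of $G$ for every $\sigma_i\in\sigma(G)$. A subgroup $H$ of $G$ is $\sigma$-quasinormal in $G$ if $G$ possesses a complete Hall $\sigma$-set $\mathcal{H}$ such that $HA^x=A^xH$ for all $A\in\mathcal{H}$ and all $x\in G$. A subgroup $A$ of $G$ is $\sigma$-subnormal in $G$ if there is a subgroup chain $A=A_0\leq A_1\leq\cdots\leq A_t=G$ such that for each $i=1,\ldots,t$ either $A_{i-1}\trianglelefteq A_i$ or $A_i/(A_{i-1})_{A_i}$ is $\sigma$-primary, where $(A_{i-1})_{A_i}$ is the largest normal subgroup of $A_i$ contained in $A_{i-1}$. If $M_n<M_{n-1}<\cdots<M_1<M_0=G$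 with $M_i$ a maximal subgroup of $M_{i-1}$ for all $i=1,\ldots,n$ ($n>0$), then $M_n$ is called an $n$-maximal subgroup of $G$. One writes $m_\sigma(G)=n$ (respectively $m_{\sigma q}(G)=n$) if each $n$-maximal subgroup of $G$ is $\sigma$-subnormal (respectively $\sigma$-quasinormal) in $G$ but, in the case $n>1$, some $(n-1)$-maximal subgroup is not $\sigma$-subnormal (respectively not $\sigma$-quasinormal) in $G$. *)

theory Defs
  imports
    "HOL-Algebra.Elementary_Groups"
    "HOL-Library.Disjoint_Sets"
    "HOL-Computational_Algebra.Primes"
begin

text \<open>
  Throughout, \<open>\<sigma> :: nat set set\<close> stands for the partition itself, i.e. the set of its parts;
  the parts are not indexed. The definitions are meant for finite groups and for \<open>\<sigma>\<close> a partition
  of the set of all primes.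
\<close>

definition primes_of_group :: "('a, 'b) monoid_scheme \<Rightarrow> nat set" where
  "primes_of_group G = {p. prime p \<and> p dvd order G}"

definition sigma_of_group :: "nat set set \<Rightarrow> ('a, 'b) monoid_scheme \<Rightarrow> nat set set" where
  "sigma_of_group \<sigma> G = {S \<in> \<sigma>. S \<inter> primes_of_group G \<noteq> {}}"

definition sigma_primary :: "nat set set \<Rightarrow> ('a, 'b) monoid_scheme \<Rightarrow> bool" where
  "sigma_primary \<sigma> G \<longleftrightarrow> card (sigma_of_group \<sigma> G) \<le> 1"

text \<open>Hall \<open>\<pi>\<close>-subgroup: the order is a \<open>\<pi>\<close>-number and the index is a \<open>\<pi>'\<close>-number.\<close>

definition hall_subgroup :: "('a, 'b) monoid_scheme \<Rightarrow> nat set \<Rightarrow> 'a set \<Rightarrow> bool" where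
  "hall_subgroup G \<pi> H \<longleftrightarrow> subgroup H G \<and>
     (\<forall>p. prime p \<longrightarrow> p dvd card H \<longrightarrow> p \<in> \<pi>) \<and>
     (\<forall>p. prime p \<longrightarrow> p dvd card (rcosets\<^bsub>G\<^esub> H) \<longrightarrow> p \<notin> \<pi>)"

definition complete_hall_sigma_set ::
    "nat set set \<Rightarrow> ('a, 'b) monoid_scheme \<Rightarrow> 'a set set \<Rightarrow> bool" where
  "complete_hall_sigma_set \<sigma> G \<H> \<longleftrightarrow>
     (\<forall>A \<in> \<H>. subgroup A G) \<and>
     (\<forall>A \<in> \<H>. A \<noteq> {\<one>\<^bsub>G\<^esub>} \<longrightarrow> (\<exists>S \<in> \<sigma>. hall_subgroup G S A)) \<and>
     (\<forall>S \<in> sigma_of_group \<sigma> G. \<exists>!A. A \<in> \<H> \<and> hall_subgroup G S A)"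

text \<open>\<open>A\<^sup>x = x\<^sup>-\<^sup>1 A x\<close>\<close>

definition conjugate :: "('a, 'b) monoid_scheme \<Rightarrow> 'a set \<Rightarrow> 'a \<Rightarrow> 'a set" where
  "conjugate G A x = (inv\<^bsub>G\<^esub> x <#\<^bsub>G\<^esub> A) #>\<^bsub>G\<^esub> x"

definition sigma_quasinormal :: "nat set set \<Rightarrow> ('a, 'b) monoid_scheme \<Rightarrow> 'a set \<Rightarrow> bool" where
  "sigma_quasinormal \<sigma> G H \<longleftrightarrow> subgroup H G \<and>
     (\<exists>\<H>. complete_hall_sigma_set \<sigma> G \<H> \<and>
        (\<forall>A \<in> \<H>. \<forall>x \<in> carrier G.
           H <#>\<^bsub>G\<^esub> conjugate G A x = conjugate G A x <#>\<^bsub>G\<^esub> H))"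

text \<open>\<open>H\<^sub>G\<close>, the largest normal subgroup of \<open>G\<close> contained in \<open>H\<close>\<close>

definition normal_core :: "('a, 'b) monoid_scheme \<Rightarrow> 'a set \<Rightarrow> 'a set" where
  "normal_core G H = (GREATEST N. N \<lhd> G \<and> N \<subseteq> H)"

lemma (in group) normal_core_properties:
  assumes "subgroup H G"
  shows "normal_core G H \<lhd> G" "normal_core G H \<subseteq> H"
    and "\<And>N. N \<lhd> G \<Longrightarrow> N \<subseteq> H \<Longrightarrow> N \<subseteq> normal_core G H"
proof -
  define U where "U = \<Union>{N. N \<lhd> G \<and> N \<subseteq> H}"
  define K where "K = generate G U"
  have U_carrier: "U \<subseteq> carrier G"
    using subgroup.subset[OF assms] by (auto simp: U_def)
  have conj: "g \<otimes> h \<otimes> inv g \<in> U" if h: "h \<in> U" and g: "g \<in> carrier G" for h g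
  proof -
    from h obtain N where N: "N \<lhd> G" "N \<subseteq> H" "h \<in> N" by (auto simp: U_def)
    have "g \<otimes> h \<otimes> inv g \<in> N" using normal.inv_op_closed2[OF N(1) g N(3)] .
    with N show ?thesis by (auto simp: U_def)
  qed
  have normal: "K \<lhd> G"
    unfolding K_def by (rule normal_generateI[OF U_carrier conj])
  have sub: "K \<subseteq> H"
    unfolding K_def by (rule generate_subgroup_incl[OF _ assms]) (auto simp: U_def)
  have largest: "N \<subseteq> K" if "N \<lhd> G" "N \<subseteq> H" for N
    using that generate.incl[of _ U G] by (auto simp: K_def U_def)
  have eq: "normal_core G H = K"
    unfolding normal_core_def by (rule Greatest_equality) (use normal sub largest in auto)
  show "normal_core G H \<lhd> G" "normal_core G H \<subseteq> H"
    using normal sub by (simp_all add: eq)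
  show "N \<subseteq> normal_core G H" if "N \<lhd> G" "N \<subseteq> H" for N
    using largest[OF that] by (simp add: eq)
qed

definition sigma_subnormal :: "nat set set \<Rightarrow> ('a, 'b) monoid_scheme \<Rightarrow> 'a set \<Rightarrow> bool" where
  "sigma_subnormal \<sigma> G A \<longleftrightarrow>
     (\<exists>(t::nat) C. C 0 = A \<and> C t = carrier G \<and>
        (\<forall>i \<le> t. subgroup (C i) G) \<and>
        (\<forall>i < t. C i \<subseteq> C (Suc i) \<and>
           (C i \<lhd> G\<lparr>carrier := C (Suc i)\<rparr> \<or>
            sigma_primary \<sigma>
              (G\<lparr>carrier := C (Suc i)\<rparr> Mod normal_core (G\<lparr>carrier := C (Suc i)\<rparr>) (C i)))))"

definition maximal_subgroup :: "'a set \<Rightarrow> ('a, 'b) monoid_scheme \<Rightarrow> bool" where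
  "maximal_subgroup M G \<longleftrightarrow> subgroup M G \<and> M \<noteq> carrier G \<and>
     (\<forall>K. subgroup K G \<longrightarrow> M \<subseteq> K \<longrightarrow> K = M \<or> K = carrier G)"

definition n_maximal_subgroup :: "nat \<Rightarrow> 'a set \<Rightarrow> ('a, 'b) monoid_scheme \<Rightarrow> bool" where
  "n_maximal_subgroup n H G \<longleftrightarrow> n > 0 \<and>
     (\<exists>M. M 0 = carrier G \<and> M n = H \<and>
        (\<forall>i < n. maximal_subgroup (M (Suc i)) (G\<lparr>carrier := M i\<rparr>)))"

text \<open>
  \<open>has_m_sigma \<sigma> G n\<close> and \<open>has_m_sigma_q \<sigma> G n\<close> render \<open>m\<^sub>\<sigma>(G) = n\<close> and \<open>m\<^sub>\<sigma>\<^sub>q(G) = n\<close>.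
\<close>

definition has_m_sigma :: "nat set set \<Rightarrow> ('a, 'b) monoid_scheme \<Rightarrow> nat \<Rightarrow> bool" where
  "has_m_sigma \<sigma> G n \<longleftrightarrow> n > 0 \<and>
     (\<forall>H. n_maximal_subgroup n H G \<longrightarrow> sigma_subnormal \<sigma> G H) \<and>
     (n > 1 \<longrightarrow> (\<exists>H. n_maximal_subgroup (n - 1) H G \<and> \<not> sigma_subnormal \<sigma> G H))"

definition has_m_sigma_q :: "nat set set \<Rightarrow> ('a, 'b) monoid_scheme \<Rightarrow> nat \<Rightarrow> bool" where
  "has_m_sigma_q \<sigma> G n \<longleftrightarrow> n > 0 \<and>
     (\<forall>H. n_maximal_subgroup n H G \<longrightarrow> sigma_quasinormal \<sigma> G H) \<and>
     (n > 1 \<longrightarrow> (\<exists>H. n_maximal_subgroup (n - 1) H G \<and> \<not> sigma_quasinormal \<sigma> G H))"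

text \<open>Supersoluble: there is a finite series of normal subgroups of \<open>G\<close> with cyclic factors.\<close>

definition supersoluble :: "('a, 'b) monoid_scheme \<Rightarrow> bool" where
  "supersoluble G \<longleftrightarrow>
     (\<exists>(t::nat) N. N 0 = {\<one>\<^bsub>G\<^esub>} \<and> N t = carrier G \<and>
        (\<forall>i \<le> t. N i \<lhd> G) \<and>
        (\<forall>i < t. N i \<subseteq> N (Suc i) \<and> cyclic_group (G\<lparr>carrier := N (Suc i)\<rparr> Mod N i)))"

end

theory Submission
  imports Defs "HOL-Algebra.Sylow" "HOL-Algebra.Multiplicative_Group"
begin

text \<open>
  A \<open>\<sigma>\<close>-quasinormal subgroup is \<open>\<sigma>\<close>-subnormal, and for maximal subgroups the converse holds as soon
  as Hall subgroups exist. So the point is the structure of \<open>G\<close> around a maximal subgroup \<open>M\<close> that is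
  not \<open>\<sigma>\<close>-subnormal.

  Suppose that all 2-maximal subgroups are \<open>\<sigma>\<close>-quasinormal. Joins of subgroups permuting with the same
  Hall set permute with it again; this forces every maximal subgroup of \<open>M\<close> to be normal in \<open>G\<close>. Two of
  them would make \<open>M\<close> normal, so \<open>M\<close> is cyclic with a unique maximal subgroup \<open>T\<close>. Every 2-maximal
  subgroup above \<open>T\<close> is \<open>T\<close>, and counting conjugates yields a normal maximal subgroup \<open>L\<close> with \<open>L/T\<close>
  of prime order: \<open>1 \<le> T \<le> L \<le> G\<close> shows that \<open>G\<close> is supersoluble.

  Conversely, if \<open>G\<close> is supersoluble and all 2-maximal subgroups are \<open>\<sigma>\<close>-subnormal, then indices of
  maximal subgroups are prime, and \<open>M\<close> turns out to be cyclic of order \<open>q\<^sup>k\<close> with \<open>|G| = p q\<^sup>k\<close> and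
  normal maximal subgroup \<open>T\<close>. A 2-maximal subgroup is then \<open>T\<close> or has index \<open>q\<^sup>2\<close>, and in the latter
  case contains all elements of \<open>p\<close>-power order.
\<close>

section \<open>Finite groups\<close>

text \<open>\<open>sigma_quasinormal\<close> lets the Hall set vary with the subgroup, whereas the
  join argument needs a common one. Normality bridges the gap: a normal subgroup permutes with every
  Hall set, so proving maximal subgroups of M normal in G is what makes two of them comparable. Nor
  does a complete Hall set exist in every group: in one direction it comes from a 2-maximal subgroup
  below M, in the other from M and a Sylow subgroup.

  Arithmetic enters through O^S. A subgroup of S-index that is permutable or \<sigma>-subnormal
  contains O^S(G), and every subgroup containing O^S(G) is \<sigma>-subnormal and permutes with all
  Hall sets. As M fails this, no 2-maximal T below M can have S-index in G for a single part S, so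
  two different parts must occur in |G:T|. Contradictions then arise from an index that belongs to
  two parts and hence is 1.

  Factor groups are replaced by indices, normalizers and elements of prime power order; inclusions
  are tested on such elements.\<close>

abbreviation nat_prime :: "nat \<Rightarrow> bool" where "nat_prime \<equiv> Factorial_Ring.prime"

definition pi_number :: "nat set \<Rightarrow> nat \<Rightarrow> bool" where
  "pi_number \<pi> n \<longleftrightarrow> (\<forall>p. nat_prime p \<longrightarrow> p dvd n \<longrightarrow> p \<in> \<pi>)"

text \<open>A quotient of cardinalities instead of a number of cosets, so that no group structure on
  \<open>K\<close> has to be fixed. Division on \<open>nat\<close> truncates; the value is the true
  index once \<open>H\<close> is a subgroup contained in the subgroup \<open>K\<close>.\<close>

definition index :: "'a set \<Rightarrow> 'a set \<Rightarrow> nat" where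
  "index K H = card K div card H"

lemma pi_number_dvd: "pi_number \<pi> n \<Longrightarrow> m dvd n \<Longrightarrow> pi_number \<pi> m"
  unfolding pi_number_def using dvd_trans by blast

lemma pi_number_mult: "pi_number \<pi> (m * n) \<longleftrightarrow> pi_number \<pi> m \<and> pi_number \<pi> n"
  unfolding pi_number_def by (auto simp: prime_dvd_mult_iff)

lemma pi_number_prime: "nat_prime p \<Longrightarrow> pi_number \<pi> p \<longleftrightarrow> p \<in> \<pi>"
  unfolding pi_number_def using primes_dvd_imp_eq by auto

lemma pi_number_disjoint: "pi_number \<pi> n \<Longrightarrow> pi_number \<rho> n \<Longrightarrow> \<pi> \<inter> \<rho> = {} \<Longrightarrow> n = 1"
  unfolding pi_number_def using prime_factor_nat[of n] by blast

lemma pi_number_coprime: "pi_number \<pi> m \<Longrightarrow> pi_number \<rho> n \<Longrightarrow> \<pi> \<inter> \<rho> = {} \<Longrightarrow> coprime m n"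
  unfolding coprime_iff_gcd_eq_1
  by (rule pi_number_disjoint[OF pi_number_dvd[OF _ gcd_dvd1] pi_number_dvd[OF _ gcd_dvd2]])

lemma nat_least:
  fixes P :: "nat \<Rightarrow> bool"
  assumes "P n" shows "\<exists>d. P d \<and> (\<forall>e. P e \<longrightarrow> d \<le> e)"
  using LeastI[of P, OF assms] Least_le[of P] by blast

locale fin_group = group G for G :: "('a, 'b) monoid_scheme" (structure) +
  assumes fin: "finite (carrier G)"
begin

text \<open>The opposite convention to \<open>conjugate\<close>: as an action from the left it
  composes as in \<open>conj_set_comp\<close>. Permutability quantifies over all conjugating
  elements, so both conventions agree there (\<open>sigma_quasinormal_iff\<close>).\<close>

definition conj_set :: "'a \<Rightarrow> 'a set \<Rightarrow> 'a set" where
  "conj_set g H = (\<lambda>h. g \<otimes> h \<otimes> inv g) ` H"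

definition normalizer :: "'a set \<Rightarrow> 'a set" where
  "normalizer H = {g \<in> carrier G. conj_set g H = H}"

text \<open>Maximality is expressed between two subgroups of the one group \<open>G\<close>;
  \<open>maximal_in_iff\<close> matches it with \<open>maximal_subgroup\<close> over a restricted
  carrier.\<close>

definition maximal_in :: "'a set \<Rightarrow> 'a set \<Rightarrow> bool" where
  "maximal_in T M \<longleftrightarrow> subgroup T G \<and> subgroup M G \<and> T \<subset> M \<and>
     (\<forall>K. subgroup K G \<longrightarrow> T \<subseteq> K \<longrightarrow> K \<subseteq> M \<longrightarrow> K = T \<or> K = M)"

lemma sub_carrier: "subgroup H G \<Longrightarrow> x \<in> H \<Longrightarrow> x \<in> carrier G"
  by (rule subgroup.mem_carrier)

lemma sub_finite: "subgroup H G \<Longrightarrow> finite H"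
  using fin finite_subset subgroup.subset by blast

lemma sub_card_pos: "subgroup H G \<Longrightarrow> card H > 0"
  by (rule subgroup.finite_imp_card_positive[OF _ fin])

lemma card_sub_dvd:
  assumes "subgroup H G" "subgroup K G" "H \<subseteq> K"
  shows "card H dvd card K"
proof -
  interpret K: group "G\<lparr>carrier := K\<rparr>" using assms(2) by (rule subgroup_imp_group)
  have "card (rcosets\<^bsub>G\<lparr>carrier := K\<rparr>\<^esub> H) * card H = order (G\<lparr>carrier := K\<rparr>)"
    by (rule K.lagrange[OF subgroup_incl[OF assms(1,2,3)]])
  hence "card K = card (rcosets\<^bsub>G\<lparr>carrier := K\<rparr>\<^esub> H) * card H" by (simp add: order_def)
  thus ?thesis by (rule ssubst) (rule dvd_triv_right)
qed

lemma index_mult: "subgroup H G \<Longrightarrow> subgroup K G \<Longrightarrow> H \<subseteq> K \<Longrightarrow> index K H * card H = card K"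
  unfolding index_def using card_sub_dvd by simp

lemma index_eqI:
  assumes "subgroup H G" "n * card H = card K"
  shows "index K H = n"
  unfolding index_def assms(2)[symmetric] using sub_card_pos[OF assms(1)] by simp

lemma index_tower:
  assumes "subgroup H G" "subgroup K G" "subgroup L G" "H \<subseteq> K" "K \<subseteq> L"
  shows "index L H = index L K * index K H"
  by (rule index_eqI) (use assms index_mult[of H K] index_mult[of K L] in \<open>simp_all add: mult.assoc\<close>)

lemma index_pos: "subgroup H G \<Longrightarrow> subgroup K G \<Longrightarrow> H \<subseteq> K \<Longrightarrow> index K H > 0"
  using index_mult sub_card_pos by (metis mult_is_0 not_gr_zero)

lemma index_1D:
  assumes "subgroup H G" "subgroup K G" "H \<subseteq> K" "index K H = 1"
  shows "H = K"
  using index_mult[OF assms(1-3)] assms sub_finite card_subset_eq by (metis mult_1)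

lemma index_self: "subgroup H G \<Longrightarrow> index H H = 1"
  by (rule index_eqI) auto

lemma index_rcosets: "subgroup H G \<Longrightarrow> card (rcosets H) = index (carrier G) H"
  using lagrange[of H] unfolding order_def by (metis index_eqI)

lemma sub_Int: "subgroup H G \<Longrightarrow> subgroup K G \<Longrightarrow> subgroup (H \<inter> K) G"
  by (rule subgroups_Inter_pair)

lemma set_multI: "h \<in> H \<Longrightarrow> k \<in> K \<Longrightarrow> h \<otimes> k \<in> H <#> K"
  unfolding set_mult_def by auto

lemma set_multE: "x \<in> H <#> K \<Longrightarrow> (\<And>h k. h \<in> H \<Longrightarrow> k \<in> K \<Longrightarrow> x = h \<otimes> k \<Longrightarrow> thesis) \<Longrightarrow> thesis"
  unfolding set_mult_def by auto

text \<open>Multiplication maps \<open>H \<times> K\<close> onto \<open>H <#> K\<close>, and the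
  fibre over \<open>h \<otimes> k\<close> is a copy of \<open>H \<inter> K\<close>: the element
  \<open>d\<close> corresponds to the pair
  \<open>(h \<otimes> d, inv d \<otimes> k)\<close>.\<close>

lemma prod_card:
  assumes H: "subgroup H G" and K: "subgroup K G"
  shows "card (H <#> K) * card (H \<inter> K) = card H * card K"
proof -
  let ?f = "\<lambda>(h,k). h \<otimes> k"
  have HK: "H <#> K = ?f ` (H \<times> K)" unfolding set_mult_def by auto
  have fib: "card {p \<in> H \<times> K. ?f p = y} = card (H \<inter> K)" if "y \<in> H <#> K" for y
  proof -
    from that obtain h k where hk: "h \<in> H" "k \<in> K" "y = h \<otimes> k" by (rule set_multE)
    have c: "h \<in> carrier G" "k \<in> carrier G" using hk H K sub_carrier by auto
    have "bij_betw (\<lambda>d. (h \<otimes> d, inv d \<otimes> k)) (H \<inter> K) {p \<in> H \<times> K. ?f p = y}"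
    proof (rule bij_betwI[where g = "\<lambda>p. inv h \<otimes> fst p"])
      show "(\<lambda>d. (h \<otimes> d, inv d \<otimes> k)) \<in> H \<inter> K \<rightarrow> {p \<in> H \<times> K. ?f p = y}"
      proof
        fix d assume d: "d \<in> H \<inter> K"
        hence dc: "d \<in> carrier G" using H sub_carrier by auto
        have "h \<otimes> d \<otimes> (inv d \<otimes> k) = h \<otimes> k"
          using c dc by (metis inv_closed m_assoc m_closed r_inv l_inv l_one)
        thus "(h \<otimes> d, inv d \<otimes> k) \<in> {p \<in> H \<times> K. ?f p = y}"
          using d hk H K by (auto simp: subgroup.m_closed subgroup.m_inv_closed)
      qed
      show "(\<lambda>p. inv h \<otimes> fst p) \<in> {p \<in> H \<times> K. ?f p = y} \<rightarrow> H \<inter> K"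
      proof
        fix p assume "p \<in> {p \<in> H \<times> K. ?f p = y}"
        then obtain h' k' where p: "p = (h', k')" "h' \<in> H" "k' \<in> K" "h' \<otimes> k' = h \<otimes> k"
          using hk by auto
        have c': "h' \<in> carrier G" "k' \<in> carrier G" using p H K sub_carrier by auto
        have "inv h \<otimes> h' = k \<otimes> inv k'"
          using p(4) c c' by (metis inv_closed inv_solve_left inv_solve_right m_assoc m_closed)
        thus "inv h \<otimes> fst p \<in> H \<inter> K"
          using p hk H K by (metis IntI fst_conv subgroup.m_closed subgroup.m_inv_closed)
      qed
      show "inv h \<otimes> fst (h \<otimes> d, inv d \<otimes> k) = d" if "d \<in> H \<inter> K" for d
        using that c H sub_carrier by (simp add: m_assoc[symmetric])
      show "(h \<otimes> (inv h \<otimes> fst p), inv (inv h \<otimes> fst p) \<otimes> k) = p" if pp: "p \<in> {p \<in> H \<times> K. ?f p = y}" for p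
      proof -
        obtain h' k' where p: "p = (h', k')" "h' \<in> H" "k' \<in> K" "h' \<otimes> k' = h \<otimes> k"
          using pp hk by auto
        have c': "h' \<in> carrier G" "k' \<in> carrier G" using p H K sub_carrier by auto
        have "inv (inv h \<otimes> h') \<otimes> k = inv h' \<otimes> (h \<otimes> k)"
          using c c' by (simp add: inv_mult_group m_assoc)
        also have "\<dots> = k'" unfolding p(4)[symmetric] using c' by (simp add: m_assoc[symmetric])
        finally show ?thesis using p c c' by (simp add: m_assoc[symmetric])
      qed
    qed
    thus ?thesis by (rule bij_betw_same_card[symmetric])
  qed
  have "card H * card K = (\<Sum>p\<in>H \<times> K. 1)" by (simp add: card_cartesian_product)
  also have "\<dots> = (\<Sum>y\<in>?f ` (H \<times> K). \<Sum>p\<in>{p \<in> H \<times> K. ?f p = y}. 1)"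
    by (rule sum.image_gen) (simp add: sub_finite H K)
  also have "\<dots> = (\<Sum>y\<in>H <#> K. card (H \<inter> K))"
    unfolding HK[symmetric] by (rule sum.cong[OF refl]) (simp only: card_eq_sum[symmetric] fib)
  finally show ?thesis by simp
qed

lemma set_mult_sub:
  assumes H: "subgroup H G" and K: "subgroup K G" and e: "H <#> K = K <#> H"
  shows "subgroup (H <#> K) G"
proof (rule subgroupI)
  show "H <#> K \<subseteq> carrier G" using H K by (simp add: set_mult_closed subgroup.subset)
  show "H <#> K \<noteq> {}" using H K by (metis empty_iff set_multI subgroup.one_closed)
next
  fix a assume "a \<in> H <#> K"
  then obtain h k where hk: "h \<in> H" "k \<in> K" "a = h \<otimes> k" by (rule set_multE)
  hence "inv a = inv k \<otimes> inv h" using H K by (simp add: inv_mult_group sub_carrier)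
  thus "inv a \<in> H <#> K" unfolding e using hk H K by (auto intro!: set_multI subgroup.m_inv_closed)
next
  fix a b assume "a \<in> H <#> K" "b \<in> H <#> K"
  then obtain h k h' k' where hk: "h \<in> H" "k \<in> K" "a = h \<otimes> k" "h' \<in> H" "k' \<in> K" "b = h' \<otimes> k'"
    by (auto elim!: set_multE)
  have "k \<otimes> h' \<in> H <#> K" unfolding e using hk by (auto intro: set_multI)
  then obtain h2 k2 where h2: "h2 \<in> H" "k2 \<in> K" "k \<otimes> h' = h2 \<otimes> k2" by (rule set_multE)
  have c: "h \<in> carrier G" "k \<in> carrier G" "h' \<in> carrier G" "k' \<in> carrier G" "h2 \<in> carrier G" "k2 \<in> carrier G"
    using hk h2 H K sub_carrier by auto
  have "a \<otimes> b = h \<otimes> (k \<otimes> h') \<otimes> k'" using hk c by (simp add: m_assoc)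
  also have "\<dots> = (h \<otimes> h2) \<otimes> (k2 \<otimes> k')" using h2 c by (simp add: m_assoc)
  finally show "a \<otimes> b \<in> H <#> K"
    using hk h2 H K by (auto intro!: set_multI subgroup.m_closed)
qed

lemma sub_set_mult1: "subgroup H G \<Longrightarrow> subgroup K G \<Longrightarrow> H \<subseteq> H <#> K"
  by (metis r_one set_multI sub_carrier subgroup.one_closed subsetI)

lemma sub_set_mult2: "subgroup H G \<Longrightarrow> subgroup K G \<Longrightarrow> K \<subseteq> H <#> K"
  by (metis l_one set_multI sub_carrier subgroup.one_closed subsetI)

lemma set_mult_least: "subgroup L G \<Longrightarrow> H \<subseteq> L \<Longrightarrow> K \<subseteq> L \<Longrightarrow> H <#> K \<subseteq> L"
  by (auto elim!: set_multE intro: subgroup.m_closed)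

lemma conj_set_comp: "H \<subseteq> carrier G \<Longrightarrow> a \<in> carrier G \<Longrightarrow> b \<in> carrier G \<Longrightarrow> conj_set a (conj_set b H) = conj_set (a \<otimes> b) H"
  unfolding conj_set_def image_image
  by (rule image_cong) (auto simp: inv_mult_group m_assoc subset_iff)

lemma conj_set_one: "H \<subseteq> carrier G \<Longrightarrow> conj_set \<one> H = H"
  unfolding conj_set_def by (force simp: subset_iff image_iff)

lemma conj_set_sub_carrier: "H \<subseteq> carrier G \<Longrightarrow> g \<in> carrier G \<Longrightarrow> conj_set g H \<subseteq> carrier G"
  unfolding conj_set_def by auto

lemma conj_set_inv: "H \<subseteq> carrier G \<Longrightarrow> g \<in> carrier G \<Longrightarrow> conj_set g (conj_set (inv g) H) = H"
  by (simp add: conj_set_comp conj_set_one)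

lemma conj_set_inv2: "H \<subseteq> carrier G \<Longrightarrow> g \<in> carrier G \<Longrightarrow> conj_set (inv g) (conj_set g H) = H"
  by (simp add: conj_set_comp conj_set_one)

lemma conj_set_mono: "H \<subseteq> K \<Longrightarrow> conj_set g H \<subseteq> conj_set g K"
  unfolding conj_set_def by auto

lemma conj_setI: "h \<in> H \<Longrightarrow> g \<otimes> h \<otimes> inv g \<in> conj_set g H"
  unfolding conj_set_def by auto

lemma conj_set_mult1:
  assumes "g \<in> carrier G" "x \<in> carrier G" "y \<in> carrier G"
  shows "g \<otimes> (x \<otimes> y) \<otimes> inv g = (g \<otimes> x \<otimes> inv g) \<otimes> (g \<otimes> y \<otimes> inv g)"
  using assms by (simp add: m_assoc) (simp add: m_assoc[symmetric])

lemma conj_set_sub: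
  assumes H: "subgroup H G" and g: "g \<in> carrier G"
  shows "subgroup (conj_set g H) G"
proof (rule subgroupI)
  show "conj_set g H \<subseteq> carrier G" using H g by (simp add: conj_set_sub_carrier subgroup.subset)
  show "conj_set g H \<noteq> {}" unfolding conj_set_def using H subgroup.one_closed by blast
next
  fix a assume "a \<in> conj_set g H"
  then obtain h where h: "h \<in> H" "a = g \<otimes> h \<otimes> inv g" unfolding conj_set_def by auto
  hence "inv a = g \<otimes> inv h \<otimes> inv g" using g H sub_carrier by (simp add: inv_mult_group m_assoc)
  thus "inv a \<in> conj_set g H" using h H by (metis conj_setI subgroup.m_inv_closed)
next
  fix a b assume "a \<in> conj_set g H" "b \<in> conj_set g H"
  then obtain h k where h: "h \<in> H" "a = g \<otimes> h \<otimes> inv g" "k \<in> H" "b = g \<otimes> k \<otimes> inv g" unfolding conj_set_def by auto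
  hence "a \<otimes> b = g \<otimes> (h \<otimes> k) \<otimes> inv g" using conj_set_mult1 g H sub_carrier by metis
  thus "a \<otimes> b \<in> conj_set g H" using h H by (metis conj_setI subgroup.m_closed)
qed

lemma conj_set_inj: "g \<in> carrier G \<Longrightarrow> inj_on (\<lambda>h. g \<otimes> h \<otimes> inv g) (carrier G)"
  by (rule inj_on_inverseI[where g = "\<lambda>x. inv g \<otimes> x \<otimes> g"])
    (simp add: m_assoc, simp add: m_assoc[symmetric])

lemma conj_set_card: "H \<subseteq> carrier G \<Longrightarrow> g \<in> carrier G \<Longrightarrow> card (conj_set g H) = card H"
  unfolding conj_set_def by (intro card_image inj_on_subset[OF conj_set_inj])

lemma conj_set_Int: "H \<subseteq> carrier G \<Longrightarrow> K \<subseteq> carrier G \<Longrightarrow> g \<in> carrier G \<Longrightarrow> conj_set g (H \<inter> K) = conj_set g H \<inter> conj_set g K"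
  unfolding conj_set_def by (rule inj_on_image_Int[OF conj_set_inj])

lemma conj_set_set_mult:
  assumes "H \<subseteq> carrier G" "K \<subseteq> carrier G" "g \<in> carrier G"
  shows "conj_set g (H <#> K) = conj_set g H <#> conj_set g K"
proof -
  have "g \<otimes> (h \<otimes> k) \<otimes> inv g = (g \<otimes> h \<otimes> inv g) \<otimes> (g \<otimes> k \<otimes> inv g)" if "h \<in> H" "k \<in> K" for h k
    using assms conj_set_mult1 that by blast
  thus ?thesis unfolding conj_set_def set_mult_def by (fastforce simp: image_iff)
qed

lemma conj_set_self: "subgroup H G \<Longrightarrow> h \<in> H \<Longrightarrow> conj_set h H = H"
proof -
  assume H: "subgroup H G" and h: "h \<in> H"
  have "conj_set h H \<subseteq> H" unfolding conj_set_def using H h by (auto intro!: subgroup.m_closed subgroup.m_inv_closed)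
  thus ?thesis using conj_set_card[of H h] H h by (metis card_subset_eq sub_carrier sub_finite subgroup.subset)
qed

text \<open>Conjugation preserves cardinality, so for a finite set one inclusion is enough.\<close>

lemma normalizer_subI: "H \<subseteq> carrier G \<Longrightarrow> finite H \<Longrightarrow> g \<in> carrier G \<Longrightarrow> conj_set g H \<subseteq> H \<Longrightarrow> g \<in> normalizer H"
  unfolding normalizer_def by (simp add: card_subset_eq[OF _ _ conj_set_card])

lemma normalizer_sub: "H \<subseteq> carrier G \<Longrightarrow> subgroup (normalizer H) G"
proof (rule subgroupI)
  assume H: "H \<subseteq> carrier G"
  show "normalizer H \<subseteq> carrier G" unfolding normalizer_def by auto
  show "normalizer H \<noteq> {}" unfolding normalizer_def using conj_set_one[OF H] by auto
  show "inv a \<in> normalizer H" if "a \<in> normalizer H" for a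
    using that H conj_set_inv2[of H a] unfolding normalizer_def by auto
  show "a \<otimes> b \<in> normalizer H" if "a \<in> normalizer H" "b \<in> normalizer H" for a b
    using that H conj_set_comp[of H a b] unfolding normalizer_def by auto
qed

lemma sub_normalizer: "subgroup H G \<Longrightarrow> H \<subseteq> normalizer H"
  unfolding normalizer_def using conj_set_self sub_carrier by auto

lemma normalizerD: "g \<in> normalizer H \<Longrightarrow> h \<in> H \<Longrightarrow> g \<otimes> h \<otimes> inv g \<in> H"
  unfolding normalizer_def using conj_setI by auto

lemma normalizer_carrier: "g \<in> normalizer H \<Longrightarrow> g \<in> carrier G"
  unfolding normalizer_def by auto

lemma normal_normalizer: "N \<lhd> G \<longleftrightarrow> subgroup N G \<and> carrier G \<subseteq> normalizer N"
proof
  assume N: "N \<lhd> G"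
  hence s: "subgroup N G" by (rule normal_imp_subgroup)
  have "g \<in> normalizer N" if "g \<in> carrier G" for g
    using that s N by (intro normalizer_subI) (auto simp: conj_set_def subgroup.subset sub_finite normal.inv_op_closed2)
  thus "subgroup N G \<and> carrier G \<subseteq> normalizer N" using s by auto
next
  assume "subgroup N G \<and> carrier G \<subseteq> normalizer N"
  thus "N \<lhd> G" unfolding normal_inv_iff using normalizerD by blast
qed

text \<open>Translates normality in a subgroup into a condition on normalizers taken in
  \<open>G\<close>, so that later arguments stay in one ambient group.\<close>

lemma normal_rel:
  assumes K: "subgroup K G"
  shows "H \<lhd> G\<lparr>carrier := K\<rparr> \<longleftrightarrow> subgroup H G \<and> H \<subseteq> K \<and> K \<subseteq> normalizer H"
proof -
  interpret K: group "G\<lparr>carrier := K\<rparr>" using K by (rule subgroup_imp_group)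
  have i: "inv\<^bsub>G\<lparr>carrier := K\<rparr>\<^esub> x = inv x" if "x \<in> K" for x
    using that K m_inv_consistent by blast
  show ?thesis
  proof
    assume N: "H \<lhd> G\<lparr>carrier := K\<rparr>"
    hence s: "subgroup H (G\<lparr>carrier := K\<rparr>)" by (rule normal_imp_subgroup)
    have s1: "subgroup H G" using incl_subgroup[OF K s] .
    have s2: "H \<subseteq> K" using subgroup.subset[OF s] by simp
    have "g \<in> normalizer H" if g: "g \<in> K" for g
    proof (rule normalizer_subI)
      show "conj_set g H \<subseteq> H" unfolding conj_set_def
        using normal.inv_op_closed2[OF N, of g] g i[OF g] by auto
    qed (use s1 g K sub_carrier sub_finite in auto)
    thus "subgroup H G \<and> H \<subseteq> K \<and> K \<subseteq> normalizer H" using s1 s2 by auto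
  next
    assume a: "subgroup H G \<and> H \<subseteq> K \<and> K \<subseteq> normalizer H"
    show "H \<lhd> G\<lparr>carrier := K\<rparr>" unfolding K.normal_inv_iff
      using a normalizerD i subgroup_incl[of H K] K by auto
  qed
qed

lemma perm_normalizer:
  assumes T: "subgroup T G" and K: "subgroup K G" "K \<subseteq> normalizer T"
  shows "T <#> K = K <#> T"
proof
  show "T <#> K \<subseteq> K <#> T"
  proof
    fix x assume "x \<in> T <#> K"
    then obtain t k where tk: "t \<in> T" "k \<in> K" "x = t \<otimes> k" by (rule set_multE)
    have c: "t \<in> carrier G" "k \<in> carrier G" using tk T K sub_carrier by auto
    have "inv k \<in> normalizer T" using tk K by (meson subgroup.m_inv_closed subsetD)
    from normalizerD[OF this tk(1)] have "inv k \<otimes> t \<otimes> k \<in> T" using c by simp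
    moreover have "x = k \<otimes> (inv k \<otimes> t \<otimes> k)" using tk c by (simp add: m_assoc[symmetric])
    ultimately show "x \<in> K <#> T" using tk(2) set_multI by blast
  qed
  show "K <#> T \<subseteq> T <#> K"
  proof
    fix x assume "x \<in> K <#> T"
    then obtain k t where tk: "t \<in> T" "k \<in> K" "x = k \<otimes> t" by (rule set_multE)
    have c: "t \<in> carrier G" "k \<in> carrier G" using tk T K sub_carrier by auto
    have "k \<in> normalizer T" using tk K by blast
    from normalizerD[OF this tk(1)] have "k \<otimes> t \<otimes> inv k \<in> T" using c by simp
    moreover have "x = (k \<otimes> t \<otimes> inv k) \<otimes> k" using tk c by (simp add: m_assoc)
    ultimately show "x \<in> T <#> K" using tk(2) set_multI by blast
  qed
qed

text \<open>The product formula read as an index. It makes \<open>index (H <#> B) H\<close> a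
  divisor of \<open>card B\<close>, which is how the primes of a Hall subgroup control indices above
  \<open>H\<close>.\<close>

lemma prod_idx:
  assumes H: "subgroup H G" and B: "subgroup B G" and e: "H <#> B = B <#> H"
  shows "index (H <#> B) H = index B (H \<inter> B)"
proof -
  have i: "subgroup (H \<inter> B) G" using H B by (rule sub_Int)
  have "index B (H \<inter> B) * card (H \<inter> B) = card B" using i B by (intro index_mult) auto
  hence "index B (H \<inter> B) * card H * card (H \<inter> B) = card (H <#> B) * card (H \<inter> B)"
    using prod_card[OF H B] by (simp add: ac_simps)
  hence "index B (H \<inter> B) * card H = card (H <#> B)" using sub_card_pos[OF i] by simp
  thus ?thesis using H by (intro index_eqI)
qed


section \<open>Elements of prime power order and the residuals they generate\<close>

definition prime_power_elt :: "nat \<Rightarrow> 'a \<Rightarrow> bool" where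
  "prime_power_elt r x \<longleftrightarrow> x \<in> carrier G \<and> (\<exists>n::nat. x [^] (r ^ n) = \<one>)"

text \<open>The subgroup \<open>O\<^sup>\<pi>(X)\<close>, generated by the elements of prime power order for primes outside \<open>\<pi>\<close>.\<close>

definition residual :: "nat set \<Rightarrow> 'a set \<Rightarrow> 'a set" where
  "residual \<pi> X = generate G {x \<in> X. \<exists>r. nat_prime r \<and> r \<notin> \<pi> \<and> prime_power_elt r x}"

lemma pow_conj:
  assumes "g \<in> carrier G" "x \<in> carrier G"
  shows "(g \<otimes> x \<otimes> inv g) [^] (n::nat) = g \<otimes> (x [^] n) \<otimes> inv g"
proof (induction n)
  case 0 show ?case using assms by simp
next
  case (Suc n)
  have "(g \<otimes> x \<otimes> inv g) [^] Suc n = (g \<otimes> (x [^] n) \<otimes> inv g) \<otimes> (g \<otimes> x \<otimes> inv g)"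
    using Suc by simp
  also have "\<dots> = g \<otimes> (x [^] n \<otimes> x) \<otimes> inv g"
    using assms by (intro conj_set_mult1[symmetric]) auto
  finally show ?case by simp
qed

lemma sub_pow_closed:
  assumes "subgroup H G" "x \<in> H" shows "x [^] (n::nat) \<in> H"
  using subgroup_int_pow_closed[OF assms, of "int n"] by (simp add: int_pow_int)

lemma prime_power_elt_conj: "prime_power_elt r x \<Longrightarrow> g \<in> carrier G \<Longrightarrow> prime_power_elt r (g \<otimes> x \<otimes> inv g)"
  unfolding prime_power_elt_def by (metis m_closed inv_closed pow_conj r_inv r_one)

lemma prime_power_elt_carrier: "prime_power_elt r x \<Longrightarrow> x \<in> carrier G"
  unfolding prime_power_elt_def by auto

lemma pow_card_sub:
  assumes H: "subgroup H G" and x: "x \<in> H"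
  shows "x [^] card H = \<one>"
proof -
  interpret H: group "G\<lparr>carrier := H\<rparr>" using H by (rule subgroup_imp_group)
  have "x [^]\<^bsub>G\<lparr>carrier := H\<rparr>\<^esub> order (G\<lparr>carrier := H\<rparr>) = \<one>\<^bsub>G\<lparr>carrier := H\<rparr>\<^esub>"
    using x by (intro H.pow_order_eq_1) simp
  thus ?thesis by (simp add: order_def nat_pow_consistent[symmetric])
qed

lemma prime_power_elt_of_card: "subgroup H G \<Longrightarrow> card H = r ^ n \<Longrightarrow> x \<in> H \<Longrightarrow> prime_power_elt r x"
  unfolding prime_power_elt_def using pow_card_sub sub_carrier by metis

text \<open>A Sylow \<open>r\<close>-subgroup of \<open>X\<close> carries the full power of
  \<open>r\<close> in \<open>card X\<close>; it cannot lie in \<open>H\<close>, whose order has a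
  smaller \<open>r\<close>-part.\<close>

lemma prime_power_elt_outside:
  assumes H: "subgroup H G" and X: "subgroup X G" and HX: "H \<subseteq> X"
    and r: "nat_prime r" "r dvd index X H"
  shows "\<exists>x \<in> X - H. prime_power_elt r x"
proof -
  interpret X: group "G\<lparr>carrier := X\<rparr>" using X by (rule subgroup_imp_group)
  define a where "a = multiplicity r (card X)"
  have c0: "card X \<noteq> 0" using sub_card_pos[OF X] by simp
  have "r ^ a dvd card X" unfolding a_def by (rule multiplicity_dvd)
  then obtain m where m: "card X = r ^ a * m" by blast
  have "\<exists>P. subgroup P (G\<lparr>carrier := X\<rparr>) \<and> card P = r ^ a"
    by (rule sylow_thm[where m = m])
      (use r m X.group_axioms sub_finite[OF X] in \<open>auto simp: order_def\<close>)
  then obtain P where P: "subgroup P (G\<lparr>carrier := X\<rparr>)" "card P = r ^ a" by blast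
  have PG: "subgroup P G" using incl_subgroup[OF X P(1)] .
  have PX: "P \<subseteq> X" using subgroup.subset[OF P(1)] by simp
  have "\<not> P \<subseteq> H"
  proof
    assume "P \<subseteq> H"
    hence "r ^ a dvd card H" using card_sub_dvd[OF PG H] P(2) by simp
    hence "r * r ^ a dvd index X H * card H" using r(2) by (intro mult_dvd_mono)
    hence "r ^ Suc a dvd card X" using index_mult[OF H X HX] by simp
    hence "Suc a \<le> multiplicity r (card X)"
      using c0 r(1) by (intro multiplicity_geI) (auto simp: prime_gt_1_nat not_prime_unit)
    thus False by (simp add: a_def)
  qed
  then obtain x where "x \<in> P" "x \<notin> H" by blast
  thus ?thesis using prime_power_elt_of_card[OF PG P(2)] PX by blast
qed

lemma generate_single_card_dvd:
  assumes "prime_power_elt r x" shows "\<exists>n. card (generate G {x}) dvd r ^ n"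
  using assms pow_eq_id generate_pow_card unfolding prime_power_elt_def by metis

text \<open>Otherwise every double coset of \<open>H\<close> and \<open>\<langle>x\<rangle>\<close> would have order divisible by \<open>r * card H\<close>.\<close>

lemma prime_power_elt_in_conj:
  assumes H: "subgroup H G" and r: "nat_prime r" "\<not> r dvd index (carrier G) H" and x: "prime_power_elt r x"
  shows "\<exists>g \<in> carrier G. x \<in> conj_set g H"
proof (rule ccontr)
  assume "\<not> ?thesis"
  hence nx: "x \<notin> conj_set g H" if "g \<in> carrier G" for g using that by blast
  define P where "P = generate G {x}"
  have xc: "x \<in> carrier G" using x by (rule prime_power_elt_carrier)
  have P: "subgroup P G" unfolding P_def using xc by (intro generate_is_subgroup) auto
  have xP: "x \<in> P" unfolding P_def by (intro generate.incl) auto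
  obtain n where n: "card P dvd r ^ n" using generate_single_card_dvd[OF x] unfolding P_def by blast
  define B where "B y = (\<lambda>(h,p). h \<otimes> y \<otimes> p) ` (H \<times> P)" for y
  have Bsub: "B z \<subseteq> B y" if zB: "z \<in> B y" "y \<in> carrier G" for y z
  proof -
    obtain h p where hp: "h \<in> H" "p \<in> P" "z = h \<otimes> y \<otimes> p" using zB(1) unfolding B_def by auto
    show ?thesis
    proof
      fix w assume "w \<in> B z"
      then obtain h' p' where hp': "h' \<in> H" "p' \<in> P" "w = h' \<otimes> z \<otimes> p'" unfolding B_def by auto
      have c: "h \<in> carrier G" "h' \<in> carrier G" "p \<in> carrier G" "p' \<in> carrier G"
        using hp hp' H P sub_carrier by auto
      have w: "w = (h' \<otimes> h) \<otimes> y \<otimes> (p \<otimes> p')" using hp hp' c zB(2) by (simp add: m_assoc)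
      have "(h' \<otimes> h, p \<otimes> p') \<in> H \<times> P" using hp hp' H P by (auto intro: subgroup.m_closed)
      thus "w \<in> B y" unfolding B_def w by force
    qed
  qed
  have Bsym: "y \<in> B z" if zB: "z \<in> B y" "y \<in> carrier G" for y z
  proof -
    obtain h p where hp: "h \<in> H" "p \<in> P" "z = h \<otimes> y \<otimes> p" using zB(1) unfolding B_def by auto
    have c: "h \<in> carrier G" "p \<in> carrier G" using hp H P sub_carrier by auto
    have "y = inv h \<otimes> z \<otimes> inv p" using hp c zB(2) by (simp add: m_assoc) (simp add: m_assoc[symmetric])
    moreover have "(inv h, inv p) \<in> H \<times> P" using hp H P by (auto intro: subgroup.m_inv_closed)
    ultimately show ?thesis unfolding B_def by force
  qed
  have Bself: "y \<in> B y" if "y \<in> carrier G" for y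
    unfolding B_def using that H P subgroup.one_closed by (force intro!: image_eqI[where x = "(\<one>,\<one>)"])
  have Bcar: "B y \<subseteq> carrier G" if "y \<in> carrier G" for y
    unfolding B_def using that H P sub_carrier by auto
  have Bcard: "r * card H dvd card (B y)" if y: "y \<in> carrier G" for y
  proof -
    let ?K = "conj_set (inv y) H"
    have K: "subgroup ?K G" using H y by (intro conj_set_sub) auto
    \<comment> \<open>Left translation by \<open>y\<close> carries the product of
      \<open>conj_set (inv y) H\<close> and \<open>P\<close> onto the double coset, so the product
      formula yields its order.\<close>
    have "B y = (\<lambda>z. y \<otimes> z) ` (?K <#> P)"
    proof -
      have "h \<otimes> y \<otimes> p = y \<otimes> ((inv y \<otimes> h \<otimes> inv (inv y)) \<otimes> p)" if "h \<in> H" "p \<in> P" for h p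
        using that y H P sub_carrier by (simp add: m_assoc) (simp add: m_assoc[symmetric])
      thus ?thesis unfolding B_def conj_set_def set_mult_def by (fastforce simp: image_iff)
    qed
    moreover have "inj_on (\<lambda>z. y \<otimes> z) (?K <#> P)"
      by (rule inj_on_subset[of _ "carrier G"])
        (use y K P in \<open>auto intro!: inj_onI simp: set_mult_closed subgroup.subset\<close>)
    ultimately have cB: "card (B y) = card (?K <#> P)" by (simp add: card_image)
    have I: "subgroup (?K \<inter> P) G" using K P by (rule sub_Int)
    have e: "card (?K <#> P) * card (?K \<inter> P) = card H * card P"
      using prod_card[OF K P] conj_set_card[of H "inv y"] y H by (simp add: subgroup.subset)
    have iP: "index P (?K \<inter> P) * card (?K \<inter> P) = card P" using I P by (intro index_mult) auto
    have "card (B y) * card (?K \<inter> P) = (card H * index P (?K \<inter> P)) * card (?K \<inter> P)"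
      using e iP cB by (simp add: mult.assoc)
    hence cB2: "card (B y) = card H * index P (?K \<inter> P)" using sub_card_pos[OF I] by simp
    have "index P (?K \<inter> P) \<noteq> 1"
      using index_1D[OF I P] xP nx[of "inv y"] y by auto
    moreover have "index P (?K \<inter> P) dvd r ^ n" using iP n by (metis dvd_trans dvd_triv_left)
    ultimately have "r dvd index P (?K \<inter> P)"
      using r(1) by (metis divides_primepow_nat dvd_power gr0I power_0)
    thus ?thesis unfolding cB2 by (simp add: mult.commute)
  qed
  have "r * card H dvd card (\<Union>(B ` carrier G))"
  proof (rule dvd_partition)
    show "finite (\<Union>(B ` carrier G))" using Bcar fin by (meson UN_least finite_subset)
    show "\<forall>c\<in>B ` carrier G. r * card H dvd card c" using Bcard by auto
    show "\<forall>c1\<in>B ` carrier G. \<forall>c2\<in>B ` carrier G. c1 \<noteq> c2 \<longrightarrow> c1 \<inter> c2 = {}"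
    proof (intro ballI impI)
      fix c1 c2 assume "c1 \<in> B ` carrier G" "c2 \<in> B ` carrier G" and ne: "c1 \<noteq> c2"
      then obtain y1 y2 where y: "y1 \<in> carrier G" "c1 = B y1" "y2 \<in> carrier G" "c2 = B y2" by auto
      show "c1 \<inter> c2 = {}"
      proof (rule ccontr)
        assume "c1 \<inter> c2 \<noteq> {}"
        then obtain z where z: "z \<in> B y1" "z \<in> B y2" using y by auto
        have zc: "z \<in> carrier G" using z Bcar y by blast
        have "B z = B y1" using Bsub[OF z(1)] Bsub[OF Bsym[OF z(1)]] y zc by auto
        moreover have "B z = B y2" using Bsub[OF z(2)] Bsub[OF Bsym[OF z(2)]] y zc by auto
        ultimately show False using ne y by auto
      qed
    qed
  qed
  moreover have "\<Union>(B ` carrier G) = carrier G" using Bcar Bself by blast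
  ultimately have "r * card H dvd index (carrier G) H * card H"
    using index_mult[OF H subgroup_self] H by (simp add: subgroup.subset)
  hence "r dvd index (carrier G) H" using sub_card_pos[OF H] by simp
  thus False using r by blast
qed

text \<open>Induction on an exponent \<open>n\<close> that kills \<open>x\<close>. With
  \<open>n = r ^ k * m\<close> and \<open>r\<close> not dividing \<open>m\<close>, Bezout writes
  \<open>x\<close> as a product of powers of \<open>x [^] m\<close>, an \<open>r\<close>-element,
  and of \<open>x [^] (r ^ k)\<close>, which the smaller exponent \<open>m\<close> kills.\<close>

lemma primepower_generate_aux:
  assumes X: "subgroup X G"
  shows "n > 0 \<Longrightarrow> x \<in> X \<Longrightarrow> x [^] (n::nat) = \<one> \<Longrightarrow> x \<in> generate G {y \<in> X. \<exists>r. nat_prime r \<and> prime_power_elt r y}"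
proof (induction n arbitrary: x rule: less_induct)
  case (less n)
  let ?S = "{y \<in> X. \<exists>r. nat_prime r \<and> prime_power_elt r y}"
  have S: "subgroup (generate G ?S) G" using X subgroup.subset by (intro generate_is_subgroup) blast
  have xc: "x \<in> carrier G" using less X sub_carrier by auto
  show ?case
  proof (cases "n = 1")
    case True
    hence "x = \<one>" using less xc by simp
    thus ?thesis by (simp add: generate.one)
  next
    case False
    then obtain r where r: "nat_prime r" "r dvd n" using prime_factor_nat by blast
    define k where "k = multiplicity r n"
    have "r ^ k dvd n" unfolding k_def by (rule multiplicity_dvd)
    then obtain m where m: "n = r ^ k * m" by blast
    have k0: "k > 0" unfolding k_def using r less(2) by (simp add: prime_multiplicity_gt_zero_iff)
    have m0: "m > 0" using m less(2) by (cases m) auto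
    have "\<not> r dvd m"
    proof
      assume "r dvd m"
      hence "r ^ Suc k dvd n" unfolding m by (simp add: mult.commute mult_dvd_mono)
      hence "Suc k \<le> multiplicity r n"
        using less(2) r(1) by (intro multiplicity_geI) (auto simp: prime_gt_1_nat not_prime_unit)
      thus False by (simp add: k_def)
    qed
    hence cop: "coprime (r ^ k) m" using r(1) by (simp add: prime_imp_coprime coprime_power_left_iff)
    have "1 < r ^ k" using r(1) k0 by (intro one_less_power prime_gt_1_nat)
    hence mn: "m < n" using m m0 by simp
    obtain u v where uv: "u * int (r ^ k) + v * int m = gcd (int (r ^ k)) (int m)"
      using bezout_int by blast
    hence uv1: "int (r ^ k) * u + int m * v = 1" using cop by (simp add: gcd_int_int_eq coprime_imp_gcd_eq_1 mult.commute del: of_nat_power)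
    have "x [^] (r ^ k) \<in> X" "x [^] m \<in> X" using X less(3) by (auto intro: sub_pow_closed)
    have a: "x [^] (r ^ k) \<in> generate G ?S"
      by (rule less.IH[OF mn m0]) (use \<open>x [^] (r ^ k) \<in> X\<close> less(4) m xc in \<open>auto simp: nat_pow_pow\<close>)
    have "prime_power_elt r (x [^] m)" unfolding prime_power_elt_def
      using xc less(4) m by (auto simp: nat_pow_pow mult.commute)
    hence b: "x [^] m \<in> generate G ?S" using r(1) \<open>x [^] m \<in> X\<close> by (intro generate.incl) blast
    have "x = x [^] (int (r ^ k) * u + int m * v)" using uv1 xc by (simp add: int_pow_1)
    also have "\<dots> = (x [^] (r ^ k)) [^] u \<otimes> (x [^] m) [^] v"
      using xc by (simp add: int_pow_mult int_pow_pow[symmetric] int_pow_int del: of_nat_power)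
    also have "\<dots> \<in> generate G ?S"
      by (intro subgroup.m_closed[OF S] subgroup_int_pow_closed[OF S] a b)
    finally show ?thesis .
  qed
qed

text \<open>Elements of prime power order generate every subgroup, so inclusions, in particular
  inclusions in a normalizer, need only be tested on them.\<close>

lemma primepower_generate:
  assumes "subgroup X G" "subgroup H G" "\<And>r x. nat_prime r \<Longrightarrow> prime_power_elt r x \<Longrightarrow> x \<in> X \<Longrightarrow> x \<in> H"
  shows "X \<subseteq> H"
proof
  fix x assume x: "x \<in> X"
  have "x \<in> generate G {y \<in> X. \<exists>r. nat_prime r \<and> prime_power_elt r y}"
    by (rule primepower_generate_aux[OF assms(1) sub_card_pos[OF assms(1)] x pow_card_sub[OF assms(1) x]])
  moreover have "generate G {y \<in> X. \<exists>r. nat_prime r \<and> prime_power_elt r y} \<subseteq> H"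
    using assms by (intro generate_subgroup_incl) auto
  ultimately show "x \<in> H" by blast
qed

text \<open>The preimage of the generated subgroup under conjugation by \<open>g\<close> is a
  subgroup containing \<open>S\<close>, hence contains all of it; finiteness then turns the
  inclusion into equality.\<close>

lemma generate_normalizer:
  assumes S: "S \<subseteq> carrier G" and g: "g \<in> carrier G"
    and c: "\<And>s. s \<in> S \<Longrightarrow> g \<otimes> s \<otimes> inv g \<in> generate G S"
  shows "g \<in> normalizer (generate G S)"
proof (rule normalizer_subI)
  have sub: "subgroup (generate G S) G" using S by (rule generate_is_subgroup)
  have sub': "subgroup (conj_set (inv g) (generate G S)) G" using sub g by (intro conj_set_sub) auto
  have "S \<subseteq> conj_set (inv g) (generate G S)"
  proof
    fix s assume s: "s \<in> S"
    have "inv g \<otimes> (g \<otimes> s \<otimes> inv g) \<otimes> inv (inv g) \<in> conj_set (inv g) (generate G S)" using c[OF s] by (rule conj_setI)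
    moreover have "inv g \<otimes> (g \<otimes> s \<otimes> inv g) \<otimes> inv (inv g) = s"
      using g s S by (simp add: subset_iff m_assoc) (simp add: subset_iff m_assoc[symmetric])
    ultimately show "s \<in> conj_set (inv g) (generate G S)" by simp
  qed
  hence "generate G S \<subseteq> conj_set (inv g) (generate G S)" using sub' by (rule generate_subgroup_incl)
  hence "conj_set g (generate G S) \<subseteq> conj_set g (conj_set (inv g) (generate G S))" by (rule conj_set_mono)
  thus "conj_set g (generate G S) \<subseteq> generate G S" using conj_set_inv g sub subgroup.subset by metis
  show "generate G S \<subseteq> carrier G" "finite (generate G S)" using sub subgroup.subset sub_finite by auto
qed (rule g)

lemma residual_sub: "X \<subseteq> carrier G \<Longrightarrow> subgroup (residual \<pi> X) G"
  unfolding residual_def by (intro generate_is_subgroup) auto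

lemma residual_sub': "subgroup X G \<Longrightarrow> subgroup (residual \<pi> X) G"
  by (intro residual_sub subgroup.subset)

lemma residual_le: "subgroup X G \<Longrightarrow> residual \<pi> X \<subseteq> X"
  unfolding residual_def by (intro generate_subgroup_incl) auto

lemma residual_leI:
  assumes "subgroup H G" "\<And>r x. nat_prime r \<Longrightarrow> r \<notin> \<pi> \<Longrightarrow> prime_power_elt r x \<Longrightarrow> x \<in> X \<Longrightarrow> x \<in> H"
  shows "residual \<pi> X \<subseteq> H"
  unfolding residual_def using assms by (intro generate_subgroup_incl) auto

lemma prime_power_elt_residual: "nat_prime r \<Longrightarrow> r \<notin> \<pi> \<Longrightarrow> prime_power_elt r x \<Longrightarrow> x \<in> X \<Longrightarrow> x \<in> residual \<pi> X"
  unfolding residual_def by (intro generate.incl) auto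

lemma residual_normalizer: "X \<subseteq> carrier G \<Longrightarrow> normalizer X \<subseteq> normalizer (residual \<pi> X)"
  unfolding residual_def
  by (rule subsetI, rule generate_normalizer) (auto dest: normalizer_carrier normalizerD prime_power_elt_conj intro!: generate.incl)

text \<open>A prime outside \<open>\<pi>\<close> dividing the index would produce an element of its
  power order in \<open>X - H\<close>, but such elements generate the residual.\<close>

lemma residual_index:
  assumes "subgroup X G" "subgroup H G" "residual \<pi> X \<subseteq> H" "H \<subseteq> X"
  shows "pi_number \<pi> (index X H)"
  unfolding pi_number_def
proof (intro allI impI, rule ccontr)
  fix p assume "nat_prime p" "p dvd index X H" "p \<notin> \<pi>"
  with prime_power_elt_outside[OF assms(2,1,4)] obtain x where "x \<in> X - H" "prime_power_elt p x" by blast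
  thus False using prime_power_elt_residual[of p \<pi> x X] \<open>nat_prime p\<close> \<open>p \<notin> \<pi>\<close> assms by blast
qed

section \<open>Maximal subgroups and prime indices\<close>

lemma maximal_in_over:
  assumes "subgroup T G" "subgroup M G" "T \<subset> M"
  shows "\<exists>L. T \<subseteq> L \<and> maximal_in L M"
proof -
  let ?P = "\<lambda>L. subgroup L G \<and> T \<subseteq> L \<and> L \<subset> M"
  have "\<exists>L. ?P L \<and> (\<forall>K. ?P K \<longrightarrow> card K \<le> card L)"
  proof (rule ex_has_greatest_nat)
    show "?P T" using assms by auto
    show "\<forall>K. ?P K \<longrightarrow> card K < card M" using sub_finite[OF assms(2)] by (auto intro: psubset_card_mono)
  qed
  then obtain L where L: "?P L" and mx: "\<And>K. ?P K \<Longrightarrow> card K \<le> card L" by blast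
  have "K = L \<or> K = M" if "subgroup K G" "L \<subseteq> K" "K \<subseteq> M" for K
  proof (cases "K = M")
    case False
    hence "card K \<le> card L" using that L by (intro mx) auto
    thus ?thesis using that sub_finite card_seteq by metis
  qed simp
  thus ?thesis unfolding maximal_in_def using L assms(2) by blast
qed

lemma maximal_inD:
  assumes "maximal_in T M"
  shows "subgroup T G" "subgroup M G" "T \<subseteq> M" "T \<noteq> M"
  using assms unfolding maximal_in_def by auto

lemma maximal_inE:
  assumes "maximal_in T M" "subgroup K G" "T \<subseteq> K" "K \<subseteq> M"
  shows "K = T \<or> K = M"
  using assms unfolding maximal_in_def by auto

lemma index_prime_max:
  assumes "subgroup T G" "subgroup M G" "T \<subseteq> M" "nat_prime (index M T)"
  shows "maximal_in T M"
proof -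
  have "K = T \<or> K = M" if K: "subgroup K G" "T \<subseteq> K" "K \<subseteq> M" for K
  proof -
    have "index M T = index M K * index K T" using assms K by (intro index_tower)
    hence "index M K = 1 \<or> index K T = 1" using assms(4) prime_product by metis
    thus ?thesis using index_1D assms K by metis
  qed
  moreover have "T \<noteq> M" using assms index_self by auto
  ultimately show ?thesis unfolding maximal_in_def using assms by auto
qed

text \<open>The quotient would be a group without proper nontrivial subgroups. Elementwise: some
  \<open>y\<close> outside \<open>T\<close> has \<open>y [^] r\<close> in \<open>T\<close>,
  maximality gives \<open>T <#> \<langle>y\<rangle> = L\<close>, and this product is covered by
  \<open>r\<close> cosets of \<open>T\<close>.\<close>

lemma normal_max_prime:
  assumes m: "maximal_in T L" and n: "L \<subseteq> normalizer T"
  shows "nat_prime (index L T)"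
proof -
  note mD = maximal_inD[OF m]
  have "index L T \<noteq> 1" using index_1D mD by metis
  then obtain r where r: "nat_prime r" "r dvd index L T" using prime_factor_nat by blast
  obtain x where x: "x \<in> L - T" "prime_power_elt r x" using prime_power_elt_outside[OF mD(1-3) r] by blast
  obtain k :: nat where k: "x [^] (r ^ k) = \<one>" using x(2) unfolding prime_power_elt_def by blast
  have xc: "x \<in> carrier G" using x prime_power_elt_carrier by auto
  \<comment> \<open>The least exponent at which the iterated \<open>r\<close>-th powers of
    \<open>x\<close> enter \<open>T\<close>; one step earlier lies the element \<open>y\<close>
    outside \<open>T\<close> with \<open>y [^] r\<close> inside.\<close>
  define j where "j = (LEAST j::nat. x [^] (r ^ j) \<in> T)"
  have jT: "x [^] (r ^ j) \<in> T" unfolding j_def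
    by (rule LeastI[of _ k]) (use k mD(1) subgroup.one_closed in auto)
  have j0: "j \<noteq> 0" using jT x xc by (intro notI) auto
  define y where "y = x [^] (r ^ (j - 1))"
  have yT: "y \<notin> T" unfolding y_def using not_less_Least[of "j-1", folded j_def, of "\<lambda>j. x [^] (r ^ j) \<in> T"] j0
    by (metis (no_types, lifting) diff_less j_def less_numeral_extra(1) not_gr_zero not_less_Least)
  have yL: "y \<in> L" unfolding y_def using x mD by (auto intro: sub_pow_closed)
  have yc: "y \<in> carrier G" using yL mD sub_carrier by auto
  have "r ^ (j - 1) * r = r ^ j" using j0 by (metis power_minus_mult not_gr_zero)
  hence yr: "y [^] r \<in> T" unfolding y_def using jT xc by (simp add: nat_pow_pow)
  define C where "C = generate G {y}"
  have C: "subgroup C G" unfolding C_def using yc by (intro generate_is_subgroup) auto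
  have CL: "C \<subseteq> L" unfolding C_def using yL mD by (intro generate_subgroup_incl) auto
  have yC: "y \<in> C" unfolding C_def by (intro generate.incl) auto
  have pm: "T <#> C = C <#> T" using CL n C mD by (intro perm_normalizer) auto
  have "T <#> C = T \<or> T <#> C = L"
    using m set_mult_sub[OF mD(1) C pm] sub_set_mult1[OF mD(1) C] set_mult_least[OF mD(2,3) CL]
    by (rule maximal_inE)
  hence TC: "T <#> C = L" using sub_set_mult2[OF mD(1) C] yC yT by auto
  have "T <#> C \<subseteq> (\<Union>i<r. (\<lambda>t. t \<otimes> y [^] i) ` T)"
  proof
    fix z assume "z \<in> T <#> C"
    then obtain t c where tc: "t \<in> T" "c \<in> C" "z = t \<otimes> c" by (rule set_multE)
    obtain i :: nat where i: "c = y [^] i"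
      using tc(2) unfolding C_def generate_pow_on_finite_carrier[OF fin yc] by blast
    have "y [^] i = (y [^] r) [^] (i div r) \<otimes> y [^] (i mod r)"
      using yc by (simp add: nat_pow_pow nat_pow_mult)
    hence "z = (t \<otimes> (y [^] r) [^] (i div r)) \<otimes> y [^] (i mod r)"
      using tc i yc mD sub_carrier by (simp add: m_assoc)
    moreover have "t \<otimes> (y [^] r) [^] (i div r) \<in> T"
      using tc yr mD by (auto intro: subgroup.m_closed sub_pow_closed)
    moreover have "i mod r < r" using r(1) prime_gt_0_nat by simp
    ultimately show "z \<in> (\<Union>i<r. (\<lambda>t. t \<otimes> y [^] i) ` T)" by blast
  qed
  hence "card L \<le> card (\<Union>i<r. (\<lambda>t. t \<otimes> y [^] i) ` T)"
    unfolding TC by (intro card_mono) (use mD sub_finite in auto)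
  also have "\<dots> \<le> (\<Sum>i<r. card ((\<lambda>t. t \<otimes> y [^] i) ` T))" by (rule card_UN_le) simp
  also have "\<dots> \<le> (\<Sum>i<r. card T)" by (intro sum_mono card_image_le) (use mD sub_finite in auto)
  also have "\<dots> = r * card T" by simp
  finally have "index L T * card T \<le> r * card T" using index_mult mD by simp
  hence "index L T \<le> r" using sub_card_pos[OF mD(1)] by simp
  moreover have "index L T > 0" using index_pos mD by auto
  ultimately have "index L T = r" using r(2) by (simp add: dvd_imp_le le_antisym)
  thus ?thesis using r by simp
qed

end

section \<open>Subgroups permuting with a complete Hall set\<close>

locale sigma_group = fin_group G for G :: "('a, 'b) monoid_scheme" (structure) +
  fixes \<sigma> :: "nat set set"
  assumes part: "partition_on {p. nat_prime p} \<sigma>"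
begin

lemma part_exists: "nat_prime r \<Longrightarrow> \<exists>S \<in> \<sigma>. r \<in> S"
  using partition_onD1[OF part] by blast

lemma part_unique: "S \<in> \<sigma> \<Longrightarrow> T \<in> \<sigma> \<Longrightarrow> r \<in> S \<Longrightarrow> r \<in> T \<Longrightarrow> S = T"
  using partition_onD2[OF part] unfolding disjoint_def by blast

lemma parts_disjoint: "S \<in> \<sigma> \<Longrightarrow> T \<in> \<sigma> \<Longrightarrow> S \<noteq> T \<Longrightarrow> S \<inter> T = {}"
  using part_unique by blast

definition hall_for :: "nat set \<Rightarrow> 'a set \<Rightarrow> bool" where
  "hall_for S A \<longleftrightarrow> subgroup A G \<and> pi_number S (card A) \<and> pi_number (- S) (index (carrier G) A)"

lemma hall_iff: "hall_subgroup G S A \<longleftrightarrow> hall_for S A"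
  unfolding hall_subgroup_def hall_for_def pi_number_def using index_rcosets[of A] by auto

text \<open>The Hall set is a parameter because joins are taken over a common one, while
  \<open>sigma_quasinormal\<close> hides it behind an existential quantifier.\<close>

definition permutable :: "'a set set \<Rightarrow> 'a set set" where
  "permutable \<H> = {H. subgroup H G \<and> (\<forall>A \<in> \<H>. \<forall>x \<in> carrier G. H <#> conj_set x A = conj_set x A <#> H)}"

abbreviation complete_hall :: "'a set set \<Rightarrow> bool" where
  "complete_hall \<H> \<equiv> complete_hall_sigma_set \<sigma> G \<H>"

lemma conjugate_eq_conj_set: "conjugate G A x = conj_set (inv x) A" if "x \<in> carrier G"
  unfolding conjugate_def conj_set_def l_coset_def r_coset_def using that by auto

lemma sigma_quasinormal_iff:
  "sigma_quasinormal \<sigma> G H \<longleftrightarrow> (\<exists>\<H>. complete_hall \<H> \<and> H \<in> permutable \<H>)"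
proof -
  have "(\<forall>x\<in>carrier G. H <#> conjugate G A x = conjugate G A x <#> H) \<longleftrightarrow>
      (\<forall>x\<in>carrier G. H <#> conj_set x A = conj_set x A <#> H)" for A
  proof
    assume a: "\<forall>x\<in>carrier G. H <#> conjugate G A x = conjugate G A x <#> H"
    show "\<forall>x\<in>carrier G. H <#> conj_set x A = conj_set x A <#> H"
    proof
      fix x assume x: "x \<in> carrier G"
      hence "H <#> conjugate G A (inv x) = conjugate G A (inv x) <#> H" using a by simp
      thus "H <#> conj_set x A = conj_set x A <#> H" using x by (simp add: conjugate_eq_conj_set)
    qed
  qed (simp add: conjugate_eq_conj_set)
  thus ?thesis unfolding sigma_quasinormal_def permutable_def by blast
qed

lemma complete_hall_sub: "complete_hall \<H> \<Longrightarrow> A \<in> \<H> \<Longrightarrow> subgroup A G"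
  unfolding complete_hall_sigma_set_def by blast

lemma complete_hall_cases:
  assumes "complete_hall \<H>" "A \<in> \<H>"
  shows "A = {\<one>} \<or> (\<exists>S \<in> \<sigma>. hall_for S A)"
  using assms unfolding complete_hall_sigma_set_def hall_iff by blast

lemma complete_hall_ex: "complete_hall \<H> \<Longrightarrow> S \<in> sigma_of_group \<sigma> G \<Longrightarrow> \<exists>A \<in> \<H>. hall_for S A"
  unfolding complete_hall_sigma_set_def hall_iff by (meson ex1_implies_ex)

lemma prime_power_elt_dvd_card:
  assumes X: "subgroup X G" and x: "x \<in> X" "prime_power_elt r x" "nat_prime r" "x \<noteq> \<one>"
  shows "r dvd card X"
proof -
  obtain n where "x [^] (r ^ n) = \<one>" using x(2) unfolding prime_power_elt_def by blast
  hence "ord x dvd r ^ n" using pow_eq_id x(2) prime_power_elt_carrier by blast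
  moreover have "ord x \<noteq> 1" using ord_eq_1 x prime_power_elt_carrier by blast
  ultimately have "r dvd ord x"
    using x(3) by (metis divides_primepow_nat dvd_power gr0I power_0)
  moreover have "ord x dvd card X" using pow_card_sub[OF X x(1)] pow_eq_id x(2) prime_power_elt_carrier by blast
  ultimately show ?thesis by (rule dvd_trans)
qed

text \<open>The index of the Hall subgroup for the part of \<open>r\<close> is prime to
  \<open>r\<close>, so \<open>prime_power_elt_in_conj\<close> applies. The identity is excluded
  since it is an \<open>r\<close>-element even for primes \<open>r\<close> not dividing the order of
  \<open>G\<close>, for whose part \<open>\<H>\<close> need not contain a Hall subgroup.\<close>

lemma complete_hall_elt:
  assumes h: "complete_hall \<H>" and x: "nat_prime r" "prime_power_elt r x" "x \<noteq> \<one>"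
  shows "\<exists>A \<in> \<H>. \<exists>S \<in> \<sigma>. \<exists>g \<in> carrier G. r \<in> S \<and> hall_for S A \<and> x \<in> conj_set g A"
proof -
  have rG: "r dvd order G"
    unfolding order_def using x prime_power_elt_carrier by (intro prime_power_elt_dvd_card[OF subgroup_self]) auto
  obtain S where S: "S \<in> \<sigma>" "r \<in> S" using part_exists x by blast
  have "S \<in> sigma_of_group \<sigma> G" unfolding sigma_of_group_def primes_of_group_def using S rG x by auto
  then obtain A where A: "A \<in> \<H>" "hall_for S A"
    using complete_hall_ex[OF h] by blast
  have "\<not> r dvd index (carrier G) A" using A(2) S x unfolding hall_for_def pi_number_def by auto
  then obtain g where "g \<in> carrier G" "x \<in> conj_set g A"
    using prime_power_elt_in_conj[of A r x] A x unfolding hall_for_def by blast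
  thus ?thesis using A S by blast
qed

lemma permutable_sub: "H \<in> permutable \<H> \<Longrightarrow> subgroup H G"
  unfolding permutable_def by auto

lemma permutable_commutes: "H \<in> permutable \<H> \<Longrightarrow> A \<in> \<H> \<Longrightarrow> x \<in> carrier G \<Longrightarrow> H <#> conj_set x A = conj_set x A <#> H"
  unfolding permutable_def by auto

lemma permutable_prod:
  "complete_hall \<H> \<Longrightarrow> H \<in> permutable \<H> \<Longrightarrow> A \<in> \<H> \<Longrightarrow> x \<in> carrier G \<Longrightarrow> subgroup (H <#> conj_set x A) G"
  by (rule set_mult_sub[OF permutable_sub conj_set_sub[OF complete_hall_sub] permutable_commutes])

lemma permutable_normal:
  assumes "complete_hall \<H>" "subgroup N G" "carrier G \<subseteq> normalizer N"
  shows "N \<in> permutable \<H>"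
  unfolding permutable_def
proof (intro CollectI conjI ballI)
  fix A x assume "A \<in> \<H>" "x \<in> carrier G"
  hence s: "subgroup (conj_set x A) G" using assms complete_hall_sub conj_set_sub by blast
  show "N <#> conj_set x A = conj_set x A <#> N"
    using assms(3) subgroup.subset[OF s] by (intro perm_normalizer[OF assms(2) s]) blast
qed (rule assms)

lemma permutable_conj:
  assumes h: "complete_hall \<H>" and H: "H \<in> permutable \<H>" and g: "g \<in> carrier G"
  shows "conj_set g H \<in> permutable \<H>"
  unfolding permutable_def
proof (intro CollectI conjI ballI)
  have Hc: "H \<subseteq> carrier G" using permutable_sub[OF H] subgroup.subset by blast
  show "subgroup (conj_set g H) G" using permutable_sub[OF H] g by (rule conj_set_sub)
  fix A x assume A: "A \<in> \<H>" and x: "x \<in> carrier G"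
  have Ac: "A \<subseteq> carrier G" using complete_hall_sub[OF h A] subgroup.subset by blast
  let ?B = "conj_set (inv g \<otimes> x) A"
  have B: "?B \<subseteq> carrier G" using Ac g x by (intro conj_set_sub_carrier) auto
  have gB: "conj_set g ?B = conj_set x A" using Ac g x by (simp add: conj_set_comp m_assoc[symmetric])
  have "H <#> ?B = ?B <#> H" using H A g x by (intro permutable_commutes) auto
  hence "conj_set g (H <#> ?B) = conj_set g (?B <#> H)" by simp
  thus "conj_set g H <#> conj_set x A = conj_set x A <#> conj_set g H"
    using conj_set_set_mult[OF Hc B g] conj_set_set_mult[OF B Hc g] gB by simp
qed

text \<open>An induction over the generation of \<open>j\<close> moves an element of
  \<open>B\<close> past \<open>j\<close> from left to right; taking inverses gives the other
  inclusion.\<close>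

lemma perm_join:
  assumes H: "subgroup H G" and K: "subgroup K G" and B: "subgroup B G"
    and p: "H <#> B = B <#> H" "K <#> B = B <#> K"
  shows "generate G (H \<union> K) <#> B = B <#> generate G (H \<union> K)"
proof -
  let ?J = "generate G (H \<union> K)"
  have HK: "H \<union> K \<subseteq> carrier G" using H K subgroup.subset by blast
  have J: "subgroup ?J G" using HK by (rule generate_is_subgroup)
  have HJ: "H \<subseteq> ?J" "K \<subseteq> ?J" by (auto intro: generate.incl)
  have s: "\<forall>b \<in> B. b \<otimes> j \<in> ?J <#> B" if "j \<in> ?J" for j
    using that
  proof (induction j rule: generate.induct)
    case one
    show ?case using B J by (auto simp: sub_carrier intro: subsetD[OF sub_set_mult2[OF J B]])
  next
    case (incl h)
    show ?case
    proof
      fix b assume b: "b \<in> B"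
      have "b \<otimes> h \<in> (B <#> H) \<union> (B <#> K)" using incl set_multI[OF b, of h H] set_multI[OF b, of h K] by blast
      hence "b \<otimes> h \<in> (H <#> B) \<union> (K <#> B)" using p by simp
      thus "b \<otimes> h \<in> ?J <#> B" using mono_set_mult[OF HJ(1) subset_refl] mono_set_mult[OF HJ(2) subset_refl] by blast
    qed
  next
    case (inv h)
    show ?case
    proof
      fix b assume b: "b \<in> B"
      have "inv h \<in> H \<union> K" using inv H K by (auto intro: subgroup.m_inv_closed)
      hence "b \<otimes> inv h \<in> (B <#> H) \<union> (B <#> K)" using set_multI[OF b, of "inv h" H] set_multI[OF b, of "inv h" K] by blast
      hence "b \<otimes> inv h \<in> (H <#> B) \<union> (K <#> B)" using p by simp
      thus "b \<otimes> inv h \<in> ?J <#> B" using mono_set_mult[OF HJ(1) subset_refl] mono_set_mult[OF HJ(2) subset_refl] by blast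
    qed
  next
    case (eng h1 h2)
    show ?case
    proof
      fix b assume b: "b \<in> B"
      obtain j1 b1 where 1: "j1 \<in> ?J" "b1 \<in> B" "b \<otimes> h1 = j1 \<otimes> b1" using eng(3) b by (blast elim: set_multE)
      obtain j2 b2 where 2: "j2 \<in> ?J" "b2 \<in> B" "b1 \<otimes> h2 = j2 \<otimes> b2" using eng(4) 1 by (blast elim: set_multE)
      have c: "b \<in> carrier G" "h1 \<in> carrier G" "h2 \<in> carrier G" "j1 \<in> carrier G" "j2 \<in> carrier G" "b1 \<in> carrier G" "b2 \<in> carrier G"
        using b 1 2 eng J B sub_carrier by auto
      have "b \<otimes> (h1 \<otimes> h2) = (b \<otimes> h1) \<otimes> h2" using c by (simp add: m_assoc)
      also have "\<dots> = j1 \<otimes> (b1 \<otimes> h2)" unfolding 1(3) using c by (simp add: m_assoc)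
      also have "\<dots> = (j1 \<otimes> j2) \<otimes> b2" unfolding 2(3) using c by (simp add: m_assoc)
      finally show "b \<otimes> (h1 \<otimes> h2) \<in> ?J <#> B" using 1 2 J by (auto intro!: set_multI subgroup.m_closed)
    qed
  qed
  show ?thesis
  proof
    show "B <#> ?J \<subseteq> ?J <#> B"
    proof
      fix z assume "z \<in> B <#> ?J"
      then obtain b j where "b \<in> B" "j \<in> ?J" "z = b \<otimes> j" by (rule set_multE)
      thus "z \<in> ?J <#> B" using s by simp
    qed
    show "?J <#> B \<subseteq> B <#> ?J"
    proof
      fix z assume "z \<in> ?J <#> B"
      then obtain j b where z: "j \<in> ?J" "b \<in> B" "z = j \<otimes> b" by (rule set_multE)
      have "inv b \<otimes> inv j \<in> ?J <#> B" using z s J B subgroup.m_inv_closed by metis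
      then obtain j' b' where z': "j' \<in> ?J" "b' \<in> B" "inv b \<otimes> inv j = j' \<otimes> b'" by (rule set_multE)
      have c: "j \<in> carrier G" "b \<in> carrier G" "j' \<in> carrier G" "b' \<in> carrier G" using z z' J B sub_carrier by auto
      have "z = inv (inv b \<otimes> inv j)" using z c by (simp add: inv_mult_group)
      also have "\<dots> = inv b' \<otimes> inv j'" unfolding z'(3) using c by (simp add: inv_mult_group)
      finally show "z \<in> B <#> ?J" using z' J B by (auto intro!: set_multI subgroup.m_inv_closed)
    qed
  qed
qed

lemma permutable_join:
  assumes h: "complete_hall \<H>" and H: "H \<in> permutable \<H>" and K: "K \<in> permutable \<H>"
  shows "generate G (H \<union> K) \<in> permutable \<H>"
  unfolding permutable_def
proof (intro CollectI conjI ballI)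
  show "subgroup (generate G (H \<union> K)) G"
    using permutable_sub[OF H] permutable_sub[OF K] subgroup.subset by (intro generate_is_subgroup) blast
  fix A x assume A: "A \<in> \<H>" and x: "x \<in> carrier G"
  show "generate G (H \<union> K) <#> conj_set x A = conj_set x A <#> generate G (H \<union> K)"
    using permutable_sub[OF H] permutable_sub[OF K] conj_set_sub[OF complete_hall_sub[OF h A] x] permutable_commutes[OF H A x] permutable_commutes[OF K A x] by (rule perm_join)
qed

text \<open>The index divides that of \<open>H\<close> in the product with the conjugate of
  \<open>A\<close>, hence divides \<open>card A\<close>.\<close>

lemma permutable_index:
  assumes h: "complete_hall \<H>" and H: "H \<in> permutable \<H>" and A: "A \<in> \<H>" "pi_number S (card A)" and x: "x \<in> carrier G"
    and K: "subgroup K G" "H \<subseteq> K" "K \<subseteq> H <#> conj_set x A"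
  shows "pi_number S (index K H)"
proof -
  let ?B = "conj_set x A"
  have B: "subgroup ?B G" using complete_hall_sub[OF h A(1)] x by (rule conj_set_sub)
  have I: "subgroup (H \<inter> ?B) G" using permutable_sub[OF H] B by (rule sub_Int)
  have "index (H <#> ?B) H = index (H <#> ?B) K * index K H"
    using permutable_sub[OF H] K permutable_prod[OF h H A(1) x] by (intro index_tower)
  hence "index K H dvd index (H <#> ?B) H" by simp
  also have "index (H <#> ?B) H = index ?B (H \<inter> ?B)" using permutable_sub[OF H] B permutable_commutes[OF H A(1) x] by (rule prod_idx)
  also have "\<dots> dvd card ?B" using index_mult[OF I B] by (metis Int_lower2 dvd_triv_left)
  also have "card ?B = card A" using complete_hall_sub[OF h A(1)] x by (intro conj_set_card subgroup.subset)
  finally show ?thesis using A(2) pi_number_dvd by blast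
qed

text \<open>Coprimality makes the index of \<open>H\<close> in \<open>G\<close> divide that of
  \<open>H \<inter> B\<close> in \<open>B\<close>, so the product formula leaves no room outside
  \<open>H <#> B\<close>.\<close>

lemma prod_coprime:
  assumes H: "subgroup H G" and B: "subgroup B G" and c: "coprime (index (carrier G) H) (index (carrier G) B)"
  shows "H <#> B = carrier G"
proof -
  have I: "subgroup (H \<inter> B) G" using H B by (rule sub_Int)
  have Gc: "H \<subseteq> carrier G" "B \<subseteq> carrier G" using H B subgroup.subset by auto
  note S = subgroup_self
  have tH: "index (carrier G) (H \<inter> B) = index (carrier G) H * index H (H \<inter> B)"
    using I H S Gc by (intro index_tower) auto
  have tB: "index (carrier G) (H \<inter> B) = index (carrier G) B * index B (H \<inter> B)"
    using I B S Gc by (intro index_tower) auto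
  have "index (carrier G) H dvd index (carrier G) B * index B (H \<inter> B)" using tH tB by (metis dvd_triv_left)
  hence d: "index (carrier G) H dvd index B (H \<inter> B)" using c by (simp add: coprime_dvd_mult_right_iff)
  have iB: "index B (H \<inter> B) * card (H \<inter> B) = card B" using I B by (intro index_mult) auto
  have "index B (H \<inter> B) > 0" using I B by (intro index_pos) auto
  hence "index (carrier G) H \<le> index B (H \<inter> B)" using d by (rule dvd_imp_le[rotated])
  hence "index (carrier G) H * card H * card (H \<inter> B) \<le> index B (H \<inter> B) * card H * card (H \<inter> B)" by simp
  also have "\<dots> = card (H <#> B) * card (H \<inter> B)" using iB prod_card[OF H B] by (simp add: ac_simps)
  finally have "card (carrier G) \<le> card (H <#> B)"
    using index_mult[OF H S Gc(1)] sub_card_pos[OF I] by simp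
  thus ?thesis using Gc fin by (intro card_seteq) (auto simp: set_mult_closed)
qed

lemma mult_absorb:
  assumes H: "subgroup H G" and B: "subgroup B G" "B \<subseteq> H"
  shows "H <#> B = H" "B <#> H = H"
  using sub_set_mult1[OF H B(1)] sub_set_mult2[OF B(1) H]
    set_mult_least[OF H subset_refl B(2)] set_mult_least[OF H B(2) subset_refl] by auto

lemma pi_number_sub_res:
  assumes B: "subgroup B G" and H: "subgroup H G" and T: "pi_number T (card B)"
    and r: "residual S X \<subseteq> H" "B \<subseteq> X" "S \<inter> T = {}"
  shows "B \<subseteq> H"
proof (rule primepower_generate[OF B H])
  fix r x assume x: "nat_prime r" "prime_power_elt r x" "x \<in> B"
  show "x \<in> H"
  proof (cases "x = \<one>")
    case True thus ?thesis using H subgroup.one_closed by auto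
  next
    case False
    hence "r dvd card B" using prime_power_elt_dvd_card B x by auto
    hence "r \<in> T" using T x unfolding pi_number_def by auto
    hence "r \<notin> S" using r by auto
    thus ?thesis using prime_power_elt_residual[of r S x X] x r by blast
  qed
qed

text \<open>A conjugate of a Hall subgroup for a part other than \<open>S\<close> is generated by
  elements of O^S(G) and thus lies in \<open>H\<close>. A conjugate of the one for \<open>S\<close>
  has index coprime to that of \<open>H\<close>, so the product in either order is all of
  \<open>G\<close>.\<close>

lemma permutable_of_residual:
  assumes h: "complete_hall \<H>" and S: "S \<in> \<sigma>" and H: "subgroup H G"
    and r: "residual S (carrier G) \<subseteq> H"
  shows "H \<in> permutable \<H>"
  unfolding permutable_def
proof (intro CollectI conjI ballI)
  show "subgroup H G" by (rule H)
  have i: "pi_number S (index (carrier G) H)" using H r by (intro residual_index) (simp_all add: subgroup_self subgroup.subset)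
  fix A x assume A: "A \<in> \<H>" and x: "x \<in> carrier G"
  have As: "subgroup A G" using complete_hall_sub[OF h A] .
  have B: "subgroup (conj_set x A) G" using As x by (rule conj_set_sub)
  have cB: "card (conj_set x A) = card A" using As x by (intro conj_set_card subgroup.subset)
  show "H <#> conj_set x A = conj_set x A <#> H"
  proof (cases "conj_set x A \<subseteq> H")
    case True thus ?thesis using mult_absorb H B by auto
  next
    case False
    have "\<exists>T \<in> \<sigma>. hall_for T A" using complete_hall_cases[OF h A]
    proof
      assume "A = {\<one>}"
      hence "conj_set x A = {\<one>}" unfolding conj_set_def using x by auto
      thus ?thesis using False H subgroup.one_closed by auto
    qed
    then obtain T where T: "T \<in> \<sigma>" "hall_for T A" by blast
    have "T = S"
    proof (rule ccontr)
      assume "T \<noteq> S"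
      hence "S \<inter> T = {}" using T S parts_disjoint by blast
      hence "conj_set x A \<subseteq> H" using B H T r subgroup.subset[OF B] cB
        by (intro pi_number_sub_res[OF B H, of T S "carrier G"]) (auto simp: hall_for_def)
      thus False using False by simp
    qed
    moreover have "index (carrier G) (conj_set x A) = index (carrier G) A" unfolding index_def cB ..
    ultimately have c: "coprime (index (carrier G) H) (index (carrier G) (conj_set x A))"
      using i T unfolding hall_for_def by (intro pi_number_coprime[of S _ "- S"]) auto
    show ?thesis using prod_coprime[OF H B c] prod_coprime[OF B H] c by (simp add: coprime_commute)
  qed
qed

section \<open>Sigma-subnormal chains\<close>

text \<open>One link of a \<sigma>-subnormal chain. An arbitrary normal \<open>N\<close> of primary
  index replaces the core: the core contains each such \<open>N\<close>, so its index divides that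
  of \<open>N\<close>.\<close>

definition sigma_step :: "'a set \<Rightarrow> 'a set \<Rightarrow> bool" where
  "sigma_step A B \<longleftrightarrow> subgroup A G \<and> subgroup B G \<and> A \<subseteq> B \<and>
    (B \<subseteq> normalizer A \<or> (\<exists>S\<in>\<sigma>. \<exists>N. subgroup N G \<and> N \<subseteq> A \<and> B \<subseteq> normalizer N \<and> pi_number S (index B N)))"

lemma sigma_primary_iff:
  fixes K :: "('c, 'd) monoid_scheme"
  assumes "order K > 0"
  shows "sigma_primary \<sigma> K \<longleftrightarrow> (\<exists>S\<in>\<sigma>. pi_number S (order K))"
proof
  assume a: "sigma_primary \<sigma> K"
  \<comment> \<open>A default part for a trivial group, whose order 1 is a number for every part;
    the part of 2 is one that surely exists.\<close>
  obtain S0 where S0: "S0 \<in> \<sigma>" using part_exists two_is_prime_nat by blast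
  have fp: "finite (primes_of_group K)"
    unfolding primes_of_group_def using assms by (intro finite_subset[OF _ finite_divisors_nat[of "order K"]]) auto
  \<comment> \<open>Each part met by the order is recovered from one of finitely many primes.
    Finiteness matters because \<open>card\<close> is 0 on infinite sets.\<close>
  have "sigma_of_group \<sigma> K \<subseteq> (\<lambda>p. SOME S. S \<in> \<sigma> \<and> p \<in> S) ` primes_of_group K"
  proof
    fix S assume "S \<in> sigma_of_group \<sigma> K"
    then obtain p where p: "S \<in> \<sigma>" "p \<in> S" "p \<in> primes_of_group K" unfolding sigma_of_group_def by auto
    have "(SOME S. S \<in> \<sigma> \<and> p \<in> S) = S" using p part_unique by (intro some_equality) auto
    thus "S \<in> (\<lambda>p. SOME S. S \<in> \<sigma> \<and> p \<in> S) ` primes_of_group K"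
      using p(3) by (intro image_eqI[where x = p]) auto
  qed
  hence f: "finite (sigma_of_group \<sigma> K)" using fp by (meson finite_imageI finite_subset)
  have in_sig: "T \<in> sigma_of_group \<sigma> K" if "T \<in> \<sigma>" "p \<in> T" "nat_prime p" "p dvd order K" for p T
    unfolding sigma_of_group_def primes_of_group_def using that by auto
  show "\<exists>S\<in>\<sigma>. pi_number S (order K)"
  proof (cases "sigma_of_group \<sigma> K = {}")
    case True
    hence "pi_number S0 (order K)" unfolding pi_number_def using in_sig part_exists by blast
    thus ?thesis using S0 by blast
  next
    case False
    then obtain S where S: "S \<in> sigma_of_group \<sigma> K" by blast
    have "T = S" if "T \<in> sigma_of_group \<sigma> K" for T
      using a f S that unfolding sigma_primary_def by (metis card_le_Suc0_iff_eq One_nat_def)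
    hence "pi_number S (order K)" unfolding pi_number_def using in_sig part_exists by metis
    thus ?thesis using S unfolding sigma_of_group_def by blast
  qed
next
  assume "\<exists>S\<in>\<sigma>. pi_number S (order K)"
  then obtain S where S: "S \<in> \<sigma>" "pi_number S (order K)" by blast
  have "sigma_of_group \<sigma> K \<subseteq> {S}"
  proof
    fix T assume "T \<in> sigma_of_group \<sigma> K"
    then obtain p where "T \<in> \<sigma>" "p \<in> T" "nat_prime p" "p dvd order K"
      unfolding sigma_of_group_def primes_of_group_def by auto
    thus "T \<in> {S}" using S part_unique unfolding pi_number_def by blast
  qed
  thus "sigma_primary \<sigma> K" unfolding sigma_primary_def
    by (metis card.empty card_mono finite.emptyI finite.insertI card_insert_disjoint empty_iff One_nat_def)
qed

lemma factor_order:
  assumes B: "subgroup B G" and N: "subgroup N G" "N \<subseteq> B"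
  shows "order (G\<lparr>carrier := B\<rparr> Mod N) = index B N"
proof -
  interpret B: group "G\<lparr>carrier := B\<rparr>" using B by (rule subgroup_imp_group)
  have "card (rcosets\<^bsub>G\<lparr>carrier := B\<rparr>\<^esub> N) * card N = card B"
    using B.lagrange[OF subgroup_incl[OF N(1) B N(2)]] by (simp add: order_def)
  hence "index B N = card (rcosets\<^bsub>G\<lparr>carrier := B\<rparr>\<^esub> N)" by (rule index_eqI[OF N(1)])
  thus ?thesis by (simp add: order_def FactGroup_def)
qed

lemma sigma_step_iff:
  assumes A: "subgroup A G" and B: "subgroup B G" "A \<subseteq> B"
  shows "sigma_step A B \<longleftrightarrow> A \<lhd> G\<lparr>carrier := B\<rparr> \<or>
     sigma_primary \<sigma> (G\<lparr>carrier := B\<rparr> Mod normal_core (G\<lparr>carrier := B\<rparr>) A)"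
proof -
  interpret B: group "G\<lparr>carrier := B\<rparr>" using B(1) by (rule subgroup_imp_group)
  let ?N = "normal_core (G\<lparr>carrier := B\<rparr>) A"
  note core = B.normal_core_properties[OF subgroup_incl[OF A B]]
  have N: "subgroup ?N G" "?N \<subseteq> B" "B \<subseteq> normalizer ?N" using core(1) normal_rel[OF B(1)] by auto
  have o: "order (G\<lparr>carrier := B\<rparr> Mod ?N) = index B ?N" using B(1) N(1,2) by (rule factor_order)
  have p: "index B ?N > 0" using N B by (intro index_pos)
  have "sigma_primary \<sigma> (G\<lparr>carrier := B\<rparr> Mod ?N) \<longleftrightarrow> (\<exists>S\<in>\<sigma>. pi_number S (index B ?N))"
    using sigma_primary_iff[of "G\<lparr>carrier := B\<rparr> Mod ?N"] o p by simp
  also have "\<dots> \<longleftrightarrow> (\<exists>S\<in>\<sigma>. \<exists>N. subgroup N G \<and> N \<subseteq> A \<and> B \<subseteq> normalizer N \<and> pi_number S (index B N))"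
  proof
    assume "\<exists>S\<in>\<sigma>. pi_number S (index B ?N)"
    thus "\<exists>S\<in>\<sigma>. \<exists>N. subgroup N G \<and> N \<subseteq> A \<and> B \<subseteq> normalizer N \<and> pi_number S (index B N)"
      using N core(2) by blast
  next
    assume "\<exists>S\<in>\<sigma>. \<exists>N. subgroup N G \<and> N \<subseteq> A \<and> B \<subseteq> normalizer N \<and> pi_number S (index B N)"
    then obtain S M where M: "S \<in> \<sigma>" "subgroup M G" "M \<subseteq> A" "B \<subseteq> normalizer M" "pi_number S (index B M)" by blast
    have "M \<lhd> G\<lparr>carrier := B\<rparr>" using normal_rel[OF B(1)] M B(2) by auto
    hence "M \<subseteq> ?N" using core(3) M(3) by blast
    hence "index B M = index B ?N * index ?N M" using M N B by (intro index_tower)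
    hence "pi_number S (index B ?N)" using M(5) by (simp add: pi_number_mult)
    thus "\<exists>S\<in>\<sigma>. pi_number S (index B ?N)" using M(1) by blast
  qed
  finally show ?thesis unfolding sigma_step_def using A B normal_rel[OF B(1), of A] by blast
qed

lemma sigma_subnormal_iff: "sigma_subnormal \<sigma> G A \<longleftrightarrow> subgroup A G \<and> sigma_step\<^sup>*\<^sup>* A (carrier G)"
proof
  assume "sigma_subnormal \<sigma> G A"
  then obtain t :: nat and C where C: "C 0 = A" "C t = carrier G" "\<forall>i\<le>t. subgroup (C i) G"
    "\<forall>i<t. C i \<subseteq> C (Suc i) \<and> (C i \<lhd> G\<lparr>carrier := C (Suc i)\<rparr> \<or>
       sigma_primary \<sigma> (G\<lparr>carrier := C (Suc i)\<rparr> Mod normal_core (G\<lparr>carrier := C (Suc i)\<rparr>) (C i)))"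
    unfolding sigma_subnormal_def by blast
  have st: "sigma_step (C i) (C (Suc i))" if "i < t" for i
    using that C(3,4) sigma_step_iff[of "C i" "C (Suc i)"] by auto
  have chain: "sigma_step\<^sup>*\<^sup>* (C 0) (C i)" if "i \<le> t" for i
    using that
  proof (induction i)
    case (Suc i)
    thus ?case using st[of i] by (meson Suc_leD Suc_le_lessD rtranclp.rtrancl_into_rtrancl)
  qed simp
  show "subgroup A G \<and> sigma_step\<^sup>*\<^sup>* A (carrier G)" using C(1-3) chain[OF le_refl] by auto
next
  assume a: "subgroup A G \<and> sigma_step\<^sup>*\<^sup>* A (carrier G)"
  hence "sigma_step\<^sup>*\<^sup>* A (carrier G)" ..
  thus "sigma_subnormal \<sigma> G A"
  proof (induction rule: converse_rtranclp_induct)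
    case base
    show ?case unfolding sigma_subnormal_def
      by (rule exI[of _ 0], rule exI[of _ "\<lambda>_. carrier G"]) (simp add: subgroup_self)
  next
    case (step A B)
    then obtain t :: nat and C where C: "C 0 = B" "C t = carrier G" "\<forall>i\<le>t. subgroup (C i) G"
      "\<forall>i<t. C i \<subseteq> C (Suc i) \<and> (C i \<lhd> G\<lparr>carrier := C (Suc i)\<rparr> \<or>
         sigma_primary \<sigma> (G\<lparr>carrier := C (Suc i)\<rparr> Mod normal_core (G\<lparr>carrier := C (Suc i)\<rparr>) (C i)))"
      unfolding sigma_subnormal_def by blast
    have AB: "subgroup A G" "subgroup B G" "A \<subseteq> B" using step(1) unfolding sigma_step_def by auto
    let ?C = "\<lambda>i. case i of 0 \<Rightarrow> A | Suc j \<Rightarrow> C j"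
    show ?case unfolding sigma_subnormal_def
      by (rule exI[of _ "Suc t"], rule exI[of _ ?C])
        (use C AB step(1) sigma_step_iff[OF AB] in \<open>auto simp: le_Suc_eq less_Suc_eq_0_disj split: nat.split\<close>)
  qed
qed

text \<open>The index of \<open>A\<close> in the product of \<open>A\<close> with the group
  generated by \<open>x\<close> divides a power of \<open>r\<close> and also
  \<open>index B A\<close>, hence is 1.\<close>

lemma prime_power_elt_in_normal:
  assumes A: "subgroup A G" and B: "subgroup B G" "A \<subseteq> B" "B \<subseteq> normalizer A"
    and r: "nat_prime r" "\<not> r dvd index B A" and x: "prime_power_elt r x" "x \<in> B"
  shows "x \<in> A"
proof -
  let ?P = "generate G {x}"
  have xc: "x \<in> carrier G" using x prime_power_elt_carrier by auto
  have P: "subgroup ?P G" using xc by (intro generate_is_subgroup) auto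
  have PB: "?P \<subseteq> B" using x B by (intro generate_subgroup_incl) auto
  have xP: "x \<in> ?P" by (intro generate.incl) auto
  have pm: "A <#> ?P = ?P <#> A" using PB B by (intro perm_normalizer[OF A P]) auto
  have K: "subgroup (A <#> ?P) G" using A P pm by (rule set_mult_sub)
  have AK: "A \<subseteq> A <#> ?P" using A P by (rule sub_set_mult1)
  have KB: "A <#> ?P \<subseteq> B" using B PB by (intro set_mult_least) auto
  have I: "subgroup (A \<inter> ?P) G" using A P by (rule sub_Int)
  obtain n where n: "card ?P dvd r ^ n" using generate_single_card_dvd[OF x(1)] by blast
  have "index (A <#> ?P) A dvd card ?P"
    unfolding prod_idx[OF A P pm] using index_mult[OF I P] by (metis Int_lower2 dvd_triv_left)
  hence 1: "index (A <#> ?P) A dvd r ^ n" using n by (rule dvd_trans)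
  have "index B A = index B (A <#> ?P) * index (A <#> ?P) A" using A K B AK KB by (intro index_tower)
  hence "\<not> r dvd index (A <#> ?P) A" using r(2) by (metis dvd_mult)
  hence "index (A <#> ?P) A = 1" using 1 r(1) by (metis divides_primepow_nat dvd_power gr0I power_0)
  hence "A = A <#> ?P" using index_1D[OF A K AK] by simp
  thus ?thesis using sub_set_mult2[OF A P] xP by blast
qed

text \<open>In the normal case the elements outside \<open>S\<close> fall into \<open>A\<close> by
  index. Otherwise there is a normal \<open>N\<close> of \<open>T\<close>-index: for
  \<open>T = S\<close> they already fall into \<open>N\<close>, and for \<open>T \<noteq> S\<close>
  the index of \<open>A\<close> belongs to two parts, so \<open>A = B\<close>.\<close>

lemma sigma_step_residual:
  assumes s: "sigma_step A B" and S: "S \<in> \<sigma>" "pi_number S (index B A)"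
  shows "residual S B \<subseteq> A"
proof (rule residual_leI)
  show A: "subgroup A G" using s unfolding sigma_step_def by blast
  have B: "subgroup B G" "A \<subseteq> B" using s unfolding sigma_step_def by auto
  fix r x assume x: "nat_prime r" "r \<notin> S" "prime_power_elt r x" "x \<in> B"
  show "x \<in> A"
  proof (cases "B \<subseteq> normalizer A")
    case True
    have "\<not> r dvd index B A" using S x unfolding pi_number_def by auto
    thus ?thesis using prime_power_elt_in_normal[OF A B True x(1) _ x(3,4)] by blast
  next
    case False
    then obtain T N where N: "T \<in> \<sigma>" "subgroup N G" "N \<subseteq> A" "B \<subseteq> normalizer N" "pi_number T (index B N)"
      using s unfolding sigma_step_def by blast
    have "index B N = index B A * index A N" using A B N by (intro index_tower)
    hence pT: "pi_number T (index B A)" using N(5) pi_number_dvd by (metis dvd_triv_left)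
    show ?thesis
    proof (cases "T = S")
      case True
      hence "\<not> r dvd index B N" using N x unfolding pi_number_def by auto
      hence "x \<in> N" using N B A x by (intro prime_power_elt_in_normal[of N B r]) auto
      thus ?thesis using N by blast
    next
      case False
      hence "index B A = 1" using pi_number_disjoint[OF S(2) pT] parts_disjoint S N by blast
      thus ?thesis using index_1D[OF A B] x by blast
    qed
  qed
qed

text \<open>Descent along the chain: generators of O^S(G) that lie in \<open>B\<close> are
  generators of O^S(B), and these lie in the next smaller member.\<close>

lemma sigma_subnormal_residual:
  assumes "sigma_step\<^sup>*\<^sup>* A (carrier G)" and S: "S \<in> \<sigma>" "pi_number S (index (carrier G) A)" and A: "subgroup A G"
  shows "residual S (carrier G) \<subseteq> A"
  using assms(1,3)
proof (induction rule: converse_rtranclp_induct)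
  case base
  show ?case by (rule residual_le[OF subgroup_self])
next
  case (step A B)
  have AB: "subgroup A G" "subgroup B G" "A \<subseteq> B" using step(1) unfolding sigma_step_def by auto
  have "index (carrier G) A = index (carrier G) B * index B A"
    using AB subgroup_self by (intro index_tower subgroup.subset)
  hence p: "pi_number S (index (carrier G) B)" "pi_number S (index B A)" using step.prems by (simp_all add: pi_number_mult)
  have IH: "residual S (carrier G) \<subseteq> B" using step.IH p by blast
  have "residual S B \<subseteq> A" using sigma_step_residual[OF step(1) S(1) p(2)] .
  show ?case
  proof (rule residual_leI[OF AB(1)])
    fix r x assume "nat_prime r" "r \<notin> S" "prime_power_elt r x" "x \<in> carrier G"
    thus "x \<in> A" using IH \<open>residual S B \<subseteq> A\<close> prime_power_elt_residual[of r S x] by blast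
  qed
qed

text \<open>O^S(K) itself serves as the normal subgroup of \<open>S\<close>-index required by
  \<open>sigma_step\<close>.\<close>

lemma sigma_step_of_residual:
  assumes "subgroup H G" "subgroup K G" "H \<subseteq> K" "S \<in> \<sigma>" "residual S K \<subseteq> H"
  shows "sigma_step H K"
proof -
  have "K \<subseteq> normalizer (residual S K)" using sub_normalizer[OF assms(2)] residual_normalizer[of K S] subgroup.subset[OF assms(2)] by blast
  moreover have "pi_number S (index K (residual S K))"
    using assms by (intro residual_index) (auto intro: residual_sub' subsetD[OF residual_le])
  ultimately show ?thesis unfolding sigma_step_def using assms residual_sub'[OF assms(2)] by blast
qed

lemma sigma_step_normal: "subgroup H G \<Longrightarrow> subgroup K G \<Longrightarrow> H \<subseteq> K \<Longrightarrow> K \<subseteq> normalizer H \<Longrightarrow> sigma_step H K"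
  unfolding sigma_step_def by blast

text \<open>
  Let \<open>K\<close> be a smallest permutable subgroup above \<open>H\<close>. An element \<open>k \<in> K\<close> of prime power order
  not normalizing \<open>H\<close> gives \<open>K = \<langle>H, H\<^sup>k\<rangle>\<close>, so the index of \<open>H\<close> in \<open>K\<close> is a \<open>S\<close>-number for the part
  \<open>S\<close> of its prime; hence all elements for primes outside \<open>S\<close> normalize \<open>H\<close>.
\<close>

theorem permutable_imp_sigma_subnormal:
  assumes h: "complete_hall \<H>" and "H \<in> permutable \<H>"
  shows "sigma_step\<^sup>*\<^sup>* H (carrier G)"
  using assms(2)
proof (induction "card (carrier G) - card H" arbitrary: H rule: less_induct)
  case less
  have H: "subgroup H G" using less(2) by (rule permutable_sub)
  have Hc: "H \<subseteq> carrier G" using H by (rule subgroup.subset)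
  show ?case
  proof (cases "H = carrier G")
    case True thus ?thesis by simp
  next
    case False
    have "carrier G \<in> permutable \<H>"
      by (rule permutable_normal[OF h subgroup_self sub_normalizer[OF subgroup_self]])
    hence "\<exists>K. K \<in> permutable \<H> \<and> H \<subset> K" using False Hc by blast
    then obtain K where K: "K \<in> permutable \<H>" "H \<subset> K" and mn: "\<And>L. L \<in> permutable \<H> \<Longrightarrow> H \<subset> L \<Longrightarrow> card K \<le> card L"
      using ex_has_least_nat[of "\<lambda>K. K \<in> permutable \<H> \<and> H \<subset> K" _ card] by metis
    have Ks: "subgroup K G" using K(1) by (rule permutable_sub)
    have Kc: "K \<subseteq> carrier G" using Ks by (rule subgroup.subset)
    have "card H < card K" using K(2) sub_finite[OF Ks] by (rule psubset_card_mono[rotated])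
    moreover have "card K \<le> card (carrier G)" using Kc fin by (intro card_mono)
    ultimately have KG: "sigma_step\<^sup>*\<^sup>* K (carrier G)" using K(1) by (intro less(1)) auto
    have key: "\<exists>S\<in>\<sigma>. r \<in> S \<and> pi_number S (index K H)" if k: "nat_prime r" "prime_power_elt r k" "k \<in> K" "k \<notin> normalizer H" for r k
    proof -
      have kc: "k \<in> carrier G" using k prime_power_elt_carrier by auto
      have "k \<noteq> \<one>" using k(4) conj_set_one[OF Hc] unfolding normalizer_def by auto
      then obtain A S g where A: "A \<in> \<H>" "S \<in> \<sigma>" "g \<in> carrier G" "r \<in> S" "hall_for S A" "k \<in> conj_set g A"
        using complete_hall_elt[OF h k(1,2)] by blast
      have As: "subgroup (conj_set g A) G" using A complete_hall_sub[OF h] conj_set_sub by blast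
      let ?J = "generate G (H \<union> conj_set k H)"
      have J: "?J \<in> permutable \<H>" using permutable_join[OF h less(2) permutable_conj[OF h less(2) kc]] .
      have HJ: "H \<subseteq> ?J" "conj_set k H \<subseteq> ?J" by (auto intro: generate.incl)
      have "H \<noteq> ?J" using HJ normalizer_subI[OF Hc sub_finite[OF H] kc] k(4) by blast
      hence "card K \<le> card ?J" using J HJ by (intro mn) auto
      moreover have "?J \<subseteq> K"
        using K(2) Ks k(3) conj_set_mono[of H K k] conj_set_self[OF Ks k(3)] by (intro generate_subgroup_incl) auto
      ultimately have JK: "?J = K" using sub_finite[OF Ks] by (intro card_seteq)
      \<comment> \<open>Since \<open>k\<close> lies in this product, the product contains
        \<open>H\<close> together with its conjugate by \<open>k\<close>, hence their join
        \<open>K\<close>; the index of \<open>H\<close> in \<open>K\<close> therefore involves only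
        primes of \<open>S\<close>.\<close>
      let ?L = "H <#> conj_set g A"
      have L: "subgroup ?L G" by (rule permutable_prod[OF h less(2) A(1,3)])
      have HL: "H \<subseteq> ?L" "conj_set g A \<subseteq> ?L" using sub_set_mult1[OF H As] sub_set_mult2[OF H As] by auto
      have "conj_set k H \<subseteq> ?L" using conj_set_mono[OF HL(1), of k] conj_set_self[OF L, of k] HL A by blast
      hence "?J \<subseteq> ?L" using HL L by (intro generate_subgroup_incl) auto
      hence "pi_number S (index K H)" using JK K Ks A hall_for_def less(2) by (intro permutable_index[OF h, of H A S g]) auto
      thus ?thesis using A by blast
    qed
    show ?thesis
    proof (cases "K \<subseteq> normalizer H")
      case True
      hence "sigma_step H K" using H Ks K by (intro sigma_step_normal) auto
      thus ?thesis using KG by (rule converse_rtranclp_into_rtranclp)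
    next
      case False
      then obtain r k where k: "nat_prime r" "prime_power_elt r k" "k \<in> K" "k \<notin> normalizer H"
        using primepower_generate[OF Ks normalizer_sub[OF Hc]] by blast
      then obtain S where S: "S \<in> \<sigma>" "pi_number S (index K H)" using key by blast
      have "residual S K \<subseteq> normalizer H"
      proof (rule residual_leI[OF normalizer_sub[OF Hc]], rule ccontr)
        fix r k assume r: "nat_prime r" "r \<notin> S" "prime_power_elt r k" "k \<in> K" "k \<notin> normalizer H"
        then obtain T where T: "T \<in> \<sigma>" "r \<in> T" "pi_number T (index K H)" using key by blast
        hence "index K H = 1" using S r parts_disjoint[of S T] by (intro pi_number_disjoint[of S _ T]) auto
        thus False using index_1D[OF H Ks] K by auto
      qed
      \<comment> \<open>The chain is refined at \<open>H <#> ?W\<close>: the lower step is normal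
        because O^S(K) normalizes \<open>H\<close>, the upper one is \<sigma>-primary because O^S(K)
        is contained in it.\<close>
      let ?W = "residual S K"
      have W: "subgroup ?W G" using Ks by (rule residual_sub')
      have pm: "H <#> ?W = ?W <#> H" using \<open>?W \<subseteq> normalizer H\<close> by (intro perm_normalizer[OF H W])
      have HW: "subgroup (H <#> ?W) G" using H W pm by (rule set_mult_sub)
      have "H <#> ?W \<subseteq> normalizer H" using normalizer_sub[OF Hc] sub_normalizer[OF H] \<open>?W \<subseteq> normalizer H\<close> by (rule set_mult_least)
      hence "sigma_step H (H <#> ?W)" using H HW sub_set_mult1[OF H W] by (intro sigma_step_normal)
      moreover have "sigma_step (H <#> ?W) K"
        using HW Ks set_mult_least[OF Ks, of H ?W] K residual_le[OF Ks, of S] S sub_set_mult2[OF H W]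
        by (intro sigma_step_of_residual[of _ _ S]) auto
      ultimately show ?thesis using KG by (meson converse_rtranclp_into_rtranclp)
    qed
  qed
qed

end

section \<open>Normal closures, counting conjugates, and cyclic chains\<close>

context fin_group begin

lemma normal_closure:
  assumes "X \<subseteq> carrier G"
  shows "carrier G \<subseteq> normalizer (generate G (\<Union>u\<in>carrier G. conj_set u X))"
proof
  fix g assume g: "g \<in> carrier G"
  show "g \<in> normalizer (generate G (\<Union>u\<in>carrier G. conj_set u X))"
  proof (rule generate_normalizer[OF _ g])
    show "(\<Union>u\<in>carrier G. conj_set u X) \<subseteq> carrier G" using conj_set_sub_carrier[OF assms] by blast
    fix s assume "s \<in> (\<Union>u\<in>carrier G. conj_set u X)"
    then obtain u where u: "u \<in> carrier G" "s \<in> conj_set u X" by blast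
    have "g \<otimes> s \<otimes> inv g \<in> conj_set g (conj_set u X)" using u by (intro conj_setI)
    hence "g \<otimes> s \<otimes> inv g \<in> conj_set (g \<otimes> u) X" using conj_set_comp[OF assms g u(1)] by simp
    thus "g \<otimes> s \<otimes> inv g \<in> generate G (\<Union>u\<in>carrier G. conj_set u X)"
      using g u by (intro generate.incl UN_I[of "g \<otimes> u"]) auto
  qed
qed

lemma conj_set_id: "X \<subseteq> carrier G \<Longrightarrow> X \<subseteq> (\<Union>u\<in>carrier G. conj_set u X)"
  using conj_set_one[of X] UN_upper[of \<one> "carrier G" "\<lambda>u. conj_set u X"] by simp

lemma maximal_in_conj_prime:
  assumes T: "subgroup T G" "carrier G \<subseteq> normalizer T" and M: "subgroup M G" "T \<subseteq> M" "nat_prime (index M T)"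
    and g: "g \<in> carrier G"
  shows "maximal_in T (conj_set g M)" "index (conj_set g M) T = index M T"
proof -
  have "conj_set g T = T" using T g unfolding normalizer_def by auto
  hence TM: "T \<subseteq> conj_set g M" using conj_set_mono[OF M(2), of g] by simp
  show i: "index (conj_set g M) T = index M T" unfolding index_def using M g by (simp add: conj_set_card subgroup.subset)
  show "maximal_in T (conj_set g M)" using T conj_set_sub[OF M(1) g] TM M(3) i by (intro index_prime_max) auto
qed

definition conj_diff :: "'a set \<Rightarrow> 'a set \<Rightarrow> 'a set" where
  "conj_diff M T = (\<lambda>(g,m). g \<otimes> m \<otimes> inv g) ` (carrier G \<times> (M - T))"

lemma conj_diff_out:
  assumes T: "subgroup T G" "carrier G \<subseteq> normalizer T" and M: "subgroup M G" and g: "g \<in> carrier G" and m: "m \<in> M - T"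
  shows "g \<otimes> m \<otimes> inv g \<in> conj_set g M - T"
proof -
  have mc: "m \<in> carrier G" using M m sub_carrier by auto
  have "g \<otimes> m \<otimes> inv g \<notin> T"
  proof
    assume a: "g \<otimes> m \<otimes> inv g \<in> T"
    have "inv g \<in> normalizer T" using T g by auto
    from normalizerD[OF this a] have "m \<in> T" using g mc by (simp add: m_assoc) (simp add: m_assoc[symmetric])
    thus False using m by simp
  qed
  thus ?thesis using m conj_setI by auto
qed

text \<open>Double counting of the pairs \<open>(g, m)\<close>: all \<open>h\<close> leading to the
  same element lie in one coset of \<open>M\<close>, and \<open>h\<close> determines the second
  component, so each fibre has at most \<open>card M\<close> pairs. The factor 2 comes from
  \<open>index M T \<ge> 2\<close>, by which \<open>M - T\<close> is at least half of
  \<open>M\<close>.\<close>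

lemma conj_diff_card:
  assumes T: "subgroup T G" "carrier G \<subseteq> normalizer T" and M: "subgroup M G" "T \<subseteq> M" "nat_prime (index M T)" "normalizer M = M"
  shows "card (carrier G) \<le> 2 * card (conj_diff M T)"
proof -
  let ?f = "\<lambda>(g,m). g \<otimes> m \<otimes> inv g" and ?D = "carrier G \<times> (M - T)"
  have fD: "finite ?D" using fin sub_finite[OF M(1)] by auto
  have fib: "card {p \<in> ?D. ?f p = u} \<le> card M" if "u \<in> conj_diff M T" for u
  proof -
    from that obtain g m where gm: "g \<in> carrier G" "m \<in> M - T" "u = g \<otimes> m \<otimes> inv g"
      unfolding conj_diff_def by auto
    have u1: "u \<in> conj_set g M - T" using conj_diff_out[OF T M(1) gm(1,2)] gm(3) by simp
    \<comment> \<open>\<open>T\<close> is maximal in every conjugate of \<open>M\<close>, so two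
      conjugates sharing an element outside \<open>T\<close> coincide; self-normalization then gives
      the coset.\<close>
    have sub: "inv g \<otimes> h \<in> M" if h: "h \<in> carrier G" "n \<in> M - T" "u = h \<otimes> n \<otimes> inv h" for h n
    proof -
      have u2: "u \<in> conj_set h M - T" using conj_diff_out[OF T M(1) h(1,2)] h(3) by simp
      note mg = maximal_in_conj_prime[OF T M(1-3) gm(1)] and mh = maximal_in_conj_prime[OF T M(1-3) h(1)]
      let ?I = "conj_set g M \<inter> conj_set h M"
      have I: "subgroup ?I G" "T \<subseteq> ?I" using maximal_inD[OF mg(1)] maximal_inD[OF mh(1)] sub_Int by auto
      have "?I = conj_set g M" using maximal_inE[OF mg(1) I] u1 u2 by auto
      moreover have "?I = conj_set h M" using maximal_inE[OF mh(1) I] u1 u2 by auto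
      ultimately have "conj_set g M = conj_set h M" by simp
      hence "conj_set (inv g) (conj_set h M) = M" using gm(1) M(1) by (metis conj_set_inv2 subgroup.subset)
      hence "conj_set (inv g \<otimes> h) M = M" using gm(1) h(1) M(1) by (simp add: conj_set_comp subgroup.subset)
      hence "inv g \<otimes> h \<in> normalizer M" unfolding normalizer_def using gm h by auto
      thus ?thesis using M(4) by simp
    qed
    have "inj_on (\<lambda>p. inv g \<otimes> fst p) {p \<in> ?D. ?f p = u}"
    proof (rule inj_onI)
      fix p p' assume p: "p \<in> {p \<in> ?D. ?f p = u}" "p' \<in> {p \<in> ?D. ?f p = u}" and e: "inv g \<otimes> fst p = inv g \<otimes> fst p'"
      obtain h n h' n' where hn: "p = (h, n)" "p' = (h', n')" by (cases p, cases p')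
      have c: "h \<in> carrier G" "h' \<in> carrier G" "n \<in> carrier G" "n' \<in> carrier G"
        using p hn M(1) sub_carrier by auto
      have "h = h'" using e hn c gm(1) by simp
      moreover have "h \<otimes> n \<otimes> inv h = h' \<otimes> n' \<otimes> inv h'" using p hn by auto
      ultimately show "p = p'" using hn c by simp
    qed
    moreover have "(\<lambda>p. inv g \<otimes> fst p) ` {p \<in> ?D. ?f p = u} \<subseteq> M" using sub by auto
    ultimately show ?thesis using sub_finite[OF M(1)] by (rule card_inj_on_le)
  qed
  have cM: "index M T * card T = card M" using T(1) M(1,2) by (rule index_mult)
  have "card (M - T) = card M - card T" using T M sub_finite by (intro card_Diff_subset) auto
  moreover have "2 * card T \<le> card M" unfolding cM[symmetric] using prime_ge_2_nat[OF M(3)] by simp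
  ultimately have "card M \<le> 2 * card (M - T)" by simp
  hence "card (carrier G) * card M \<le> 2 * card ?D" by (simp add: card_cartesian_product)
  also have "card ?D = (\<Sum>p\<in>?D. 1)" by simp
  also have "\<dots> = (\<Sum>u\<in>?f ` ?D. \<Sum>p\<in>{p \<in> ?D. ?f p = u}. 1)" using fD by (rule sum.image_gen)
  also have "\<dots> = (\<Sum>u\<in>conj_diff M T. card {p \<in> ?D. ?f p = u})" by (simp only: card_eq_sum conj_diff_def)
  also have "\<dots> \<le> (\<Sum>u\<in>conj_diff M T. card M)" using fib by (rule sum_mono)
  also have "\<dots> = card (conj_diff M T) * card M" by simp
  finally have "card (carrier G) * card M \<le> (2 * card (conj_diff M T)) * card M" by simp
  thus ?thesis using sub_card_pos[OF M(1)] by simp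
qed

text \<open>
  The conjugates of \<open>M - T\<close> and those of \<open>L - T\<close> are disjoint, avoid \<open>\<one>\<close>, and each
  cover at least half of the group.
\<close>

lemma two_self_normalizing_contra:
  assumes T: "subgroup T G" "carrier G \<subseteq> normalizer T"
    and M: "subgroup M G" "T \<subseteq> M" "nat_prime (index M T)" "normalizer M = M"
    and L: "subgroup L G" "T \<subseteq> L" "nat_prime (index L T)" "normalizer L = L"
    and ne: "index M T \<noteq> index L T"
  shows False
proof -
  have sub: "conj_diff X T \<subseteq> carrier G - {\<one>}" if X: "subgroup X G" for X
  proof
    fix u assume "u \<in> conj_diff X T"
    then obtain g m where gm: "g \<in> carrier G" "m \<in> X - T" "u = g \<otimes> m \<otimes> inv g"
      unfolding conj_diff_def by auto
    have "u \<in> conj_set g X - T" using conj_diff_out[OF T X gm(1,2)] gm(3) by simp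
    thus "u \<in> carrier G - {\<one>}" using T(1) subgroup.one_closed conj_set_sub[OF X gm(1)] sub_carrier by blast
  qed
  have dis: "conj_diff M T \<inter> conj_diff L T = {}"
  proof (rule ccontr)
    assume "conj_diff M T \<inter> conj_diff L T \<noteq> {}"
    then obtain u where u: "u \<in> conj_diff M T" "u \<in> conj_diff L T" by blast
    obtain g m where gm: "g \<in> carrier G" "m \<in> M - T" "u = g \<otimes> m \<otimes> inv g"
      using u(1) unfolding conj_diff_def by auto
    obtain h l where hl: "h \<in> carrier G" "l \<in> L - T" "u = h \<otimes> l \<otimes> inv h"
      using u(2) unfolding conj_diff_def by auto
    note mg = maximal_in_conj_prime[OF T M(1-3) gm(1)] and mh = maximal_in_conj_prime[OF T L(1-3) hl(1)]
    have u1: "u \<in> conj_set g M - T" using conj_diff_out[OF T M(1) gm(1,2)] gm(3) by simp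
    have u2: "u \<in> conj_set h L - T" using conj_diff_out[OF T L(1) hl(1,2)] hl(3) by simp
    \<comment> \<open>By the maximality of \<open>T\<close>, a common element outside
      \<open>T\<close> would make the two conjugates equal, although their indices over
      \<open>T\<close> differ.\<close>
    let ?I = "conj_set g M \<inter> conj_set h L"
    have I: "subgroup ?I G" "T \<subseteq> ?I" using maximal_inD[OF mg(1)] maximal_inD[OF mh(1)] sub_Int by auto
    have "?I = conj_set g M" using maximal_inE[OF mg(1) I] u1 u2 by auto
    moreover have "?I = conj_set h L" using maximal_inE[OF mh(1) I] u1 u2 by auto
    ultimately show False using mg(2) mh(2) ne by metis
  qed
  have f: "finite (conj_diff M T)" "finite (conj_diff L T)"
    using sub M L fin by (meson finite_Diff finite_subset)+
  have "card (conj_diff M T) + card (conj_diff L T) = card (conj_diff M T \<union> conj_diff L T)"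
    using card_Un_disjoint[OF f dis] by simp
  also have "\<dots> \<le> card (carrier G - {\<one>})" using sub M L fin by (intro card_mono) auto
  also have "\<dots> < card (carrier G)" using fin by (intro card_Diff1_less) auto
  finally have "card (conj_diff M T) + card (conj_diff L T) < card (carrier G)" .
  thus False using conj_diff_card[OF T M] conj_diff_card[OF T L] by linarith
qed

lemma max_normal_cyclic:
  assumes m: "maximal_in T L" and n: "L \<subseteq> normalizer T" and x: "x \<in> L - T"
  shows "L = T <#> generate G {x}"
proof -
  note mD = maximal_inD[OF m]
  have xc: "x \<in> carrier G" using x mD sub_carrier by auto
  let ?C = "generate G {x}"
  have C: "subgroup ?C G" using xc by (intro generate_is_subgroup) auto
  have CL: "?C \<subseteq> L" using x mD by (intro generate_subgroup_incl) auto
  have pm: "T <#> ?C = ?C <#> T" using CL n by (intro perm_normalizer[OF mD(1) C]) auto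
  have "T <#> ?C = T \<or> T <#> ?C = L"
    using m set_mult_sub[OF mD(1) C pm] sub_set_mult1[OF mD(1) C] set_mult_least[OF mD(2,3) CL]
    by (rule maximal_inE)
  moreover have "x \<in> T <#> ?C" using sub_set_mult2[OF mD(1) C] generate.incl[of x "{x}" G] by auto
  ultimately show ?thesis using x by auto
qed

lemma cyclic_factor:
  assumes N: "subgroup N G" and K: "subgroup K G" "N \<subseteq> K" "K \<subseteq> normalizer N" and x: "x \<in> K" "K = N <#> generate G {x}"
  shows "cyclic_group (G\<lparr>carrier := K\<rparr> Mod N)"
proof -
  have nor: "N \<lhd> G\<lparr>carrier := K\<rparr>" using normal_rel[OF K(1)] N K by auto
  interpret n: normal N "G\<lparr>carrier := K\<rparr>" by (rule nor)
  interpret F: group "G\<lparr>carrier := K\<rparr> Mod N" by (rule n.factorgroup_is_group)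
  have Kg: "group (G\<lparr>carrier := K\<rparr>)" using K(1) by (rule subgroup_imp_group)
  have xc: "x \<in> carrier G" using x K sub_carrier by auto
  have car: "carrier (G\<lparr>carrier := K\<rparr> Mod N) = (\<lambda>k. N #> k) ` K" by (simp add: carrier_FactGroup)
  have Xin: "N #> x \<in> carrier (G\<lparr>carrier := K\<rparr> Mod N)" unfolding car using x by auto
  have pw: "(N #> x) [^]\<^bsub>G\<lparr>carrier := K\<rparr> Mod N\<^esub> i = N #> (x [^] i)" for i :: int
  proof -
    have "(N #>\<^bsub>G\<lparr>carrier := K\<rparr>\<^esub> x) [^]\<^bsub>G\<lparr>carrier := K\<rparr> Mod N\<^esub> i = N #>\<^bsub>G\<lparr>carrier := K\<rparr>\<^esub> (x [^]\<^bsub>G\<lparr>carrier := K\<rparr>\<^esub> i)"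
      using x by (intro n.FactGroup_int_pow) simp
    thus ?thesis using int_pow_consistent[OF K(1) x(1)] by simp
  qed
  have "carrier (G\<lparr>carrier := K\<rparr> Mod N) = range (\<lambda>i::int. (N #> x) [^]\<^bsub>G\<lparr>carrier := K\<rparr> Mod N\<^esub> i)"
  proof
    show "range (\<lambda>i::int. (N #> x) [^]\<^bsub>G\<lparr>carrier := K\<rparr> Mod N\<^esub> i) \<subseteq> carrier (G\<lparr>carrier := K\<rparr> Mod N)"
      using Xin by auto
    show "carrier (G\<lparr>carrier := K\<rparr> Mod N) \<subseteq> range (\<lambda>i::int. (N #> x) [^]\<^bsub>G\<lparr>carrier := K\<rparr> Mod N\<^esub> i)"
    proof
      fix X assume "X \<in> carrier (G\<lparr>carrier := K\<rparr> Mod N)"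
      then obtain k where k: "k \<in> K" "X = N #> k" unfolding car by auto
      obtain t c where tc: "t \<in> N" "c \<in> generate G {x}" "k = t \<otimes> c" using k(1) x(2) by (auto elim: set_multE)
      obtain i :: int where i: "c = x [^] i" using tc(2) generate_pow[OF xc] by auto
      have c: "t \<in> carrier G" "c \<in> carrier G" using tc N sub_carrier i xc by auto
      have "X = (N #> t) #> c" unfolding k(2) tc(3) using c N by (simp add: coset_mult_assoc subgroup.subset)
      also have "N #> t = N" using tc(1) N c by (intro coset_join2)
      finally have "X = (N #> x) [^]\<^bsub>G\<lparr>carrier := K\<rparr> Mod N\<^esub> i" unfolding pw i .
      thus "X \<in> range (\<lambda>i::int. (N #> x) [^]\<^bsub>G\<lparr>carrier := K\<rparr> Mod N\<^esub> i)" by auto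
    qed
  qed
  thus ?thesis unfolding F.cyclic_group using Xin by blast
qed

lemma sub_of_cyclic:
  assumes m: "m \<in> carrier G" and T: "subgroup T G" "T \<subseteq> generate G {m}"
  shows "\<exists>t \<in> T. T = generate G {t}"
proof -
  let ?P = "\<lambda>d::nat. d > 0 \<and> m [^] d \<in> T"
  have "?P (ord m)" using ord_ge_1[OF fin m] m T subgroup.one_closed by auto
  from nat_least[of ?P, OF this] obtain d where least: "?P d \<and> (\<forall>e. ?P e \<longrightarrow> d \<le> e)" ..
  hence d: "d > 0" "m [^] d \<in> T" and mn: "\<And>e. e > 0 \<Longrightarrow> m [^] e \<in> T \<Longrightarrow> d \<le> e" by auto
  have gt: "generate G {m [^] d} \<subseteq> T" using d T by (intro generate_subgroup_incl) auto
  have S: "subgroup (generate G {m [^] d}) G" using m by (intro generate_is_subgroup) auto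
  have "T \<subseteq> generate G {m [^] d}"
  proof
    fix y assume y: "y \<in> T"
    then obtain k :: nat where k: "y = m [^] k" using T(2) generate_pow_on_finite_carrier[OF fin m] by blast
    have e: "y = (m [^] d) [^] (k div d) \<otimes> m [^] (k mod d)"
      unfolding k using m by (simp add: nat_pow_pow nat_pow_mult)
    have a: "(m [^] d) [^] (k div d) \<in> T" by (rule sub_pow_closed[OF T(1) d(2)])
    have "m [^] (k mod d) = inv ((m [^] d) [^] (k div d)) \<otimes> y"
      unfolding e using m by (simp add: m_assoc[symmetric])
    hence "m [^] (k mod d) \<in> T" using a y T by (auto intro: subgroup.m_closed subgroup.m_inv_closed)
    hence "k mod d = 0" using mn[of "k mod d"] d by (metis gr0I mod_less_divisor not_less)
    hence "y = (m [^] d) [^] (k div d)" using e m by simp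
    moreover have "m [^] d \<in> generate G {m [^] d}" by (intro generate.incl) auto
    ultimately show "y \<in> generate G {m [^] d}" using sub_pow_closed[OF S] by simp
  qed
  thus ?thesis using gt d by (intro bexI[of _ "m [^] d"]) auto
qed

text \<open>The bottom factor is cyclic by its generator; over a normal maximal subgroup any element
  outside generates, which settles the two upper factors.\<close>

lemma supersoluble_of_chain:
  assumes T: "subgroup T G" "carrier G \<subseteq> normalizer T" "T = generate G {t}" "t \<in> T"
    and L: "maximal_in T L" "carrier G \<subseteq> normalizer L" and G: "maximal_in L (carrier G)"
  shows "supersoluble G"
proof -
  note LD = maximal_inD[OF L(1)] and GD = maximal_inD[OF G]
  have Gc: "G\<lparr>carrier := carrier G\<rparr> = G" by simp
  let ?N = "\<lambda>i::nat. if i = 0 then {\<one>} else if i = 1 then T else if i = 2 then L else carrier G"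
  have one: "subgroup {\<one>} G" by (rule triv_subgroup)
  have n1: "{\<one>} \<lhd> G" by (rule one_is_normal)
  have nT: "T \<lhd> G" using T normal_normalizer by auto
  have nL: "L \<lhd> G" using L LD normal_normalizer by auto
  have nG: "carrier G \<lhd> G" using normal_normalizer subgroup_self sub_normalizer by auto
  have c0: "cyclic_group (G\<lparr>carrier := T\<rparr> Mod {\<one>})"
  proof (rule cyclic_factor[OF one T(1)])
    show "{\<one>} \<subseteq> T" using T(1) subgroup.one_closed by auto
    show "T \<subseteq> normalizer {\<one>}" using n1 normal_normalizer T(1) subgroup.subset by blast
    show "t \<in> T" by (rule T)
    have "{\<one>} <#> T = T" using sub_carrier[OF T(1)] unfolding set_mult_def by force
    thus "T = {\<one>} <#> generate G {t}" using T(3) by simp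
  qed
  obtain x where x: "x \<in> L - T" using LD by blast
  have LT: "L \<subseteq> normalizer T" using T LD subgroup.subset by blast
  have c1: "cyclic_group (G\<lparr>carrier := L\<rparr> Mod T)"
    using x by (intro cyclic_factor[OF LD(1,2,3) LT _ max_normal_cyclic[OF L(1) LT x]]) auto
  obtain y where y: "y \<in> carrier G - L" using GD by blast
  have c2: "cyclic_group (G Mod L)"
    using cyclic_factor[OF GD(1,2,3) L(2) _ max_normal_cyclic[OF G L(2) y]] y unfolding Gc by auto
  show ?thesis unfolding supersoluble_def
  proof (rule exI[of _ 3], rule exI[of _ ?N], intro conjI allI impI)
    show "?N i \<lhd> G" for i using n1 nT nL nG by auto
    fix i :: nat assume "i < 3"
    hence i: "i = 0 \<or> i = 1 \<or> i = 2" by auto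
    show "?N i \<subseteq> ?N (Suc i)" using i T(1) subgroup.one_closed LD GD by auto
    show "cyclic_group (G\<lparr>carrier := ?N (Suc i)\<rparr> Mod ?N i)" using i c0 c1 c2 Gc by auto
  qed auto
qed

text \<open>A proper subgroup generated by \<open>m\<close> would be contained in some maximal one.
  With a single maximal subgroup, any element outside it qualifies.\<close>

lemma unique_max_cyclic:
  assumes "subgroup M G" "m \<in> M" "\<And>L. maximal_in L M \<Longrightarrow> m \<notin> L"
  shows "generate G {m} = M"
proof (rule ccontr)
  assume ne: "generate G {m} \<noteq> M"
  have "m \<in> carrier G" using assms sub_carrier by auto
  hence s: "subgroup (generate G {m}) G" by (intro generate_is_subgroup) auto
  have "generate G {m} \<subset> M" using ne assms generate_subgroup_incl[of "{m}" M] by auto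
  then obtain L where "generate G {m} \<subseteq> L" "maximal_in L M" using maximal_in_over[OF s assms(1)] by blast
  thus False using assms(3) generate.incl[of m "{m}" G] by auto
qed

end

section \<open>Permutable 2-maximal subgroups force supersolubility\<close>

context sigma_group begin

text \<open>The permutable analogue of \<open>sigma_subnormal_residual\<close>. An element
  \<open>y\<close> for a prime outside \<open>S\<close> lies in a conjugate of a Hall subgroup for
  another part; the product of \<open>T\<close> with it, cut down to \<open>K\<close>, has an index
  over \<open>T\<close> belonging to both parts, so \<open>y\<close> is in \<open>T\<close>.\<close>

lemma permutable_residual:
  assumes h: "complete_hall \<H>" and T: "T \<in> permutable \<H>" and K: "subgroup K G" "T \<subseteq> K" and S: "S \<in> \<sigma>" "pi_number S (index K T)"
  shows "residual S K \<subseteq> T"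
proof (rule residual_leI[OF permutable_sub[OF T]])
  fix r y assume y: "nat_prime r" "r \<notin> S" "prime_power_elt r y" "y \<in> K"
  have Ts: "subgroup T G" using T by (rule permutable_sub)
  show "y \<in> T"
  proof (cases "y = \<one>")
    case True thus ?thesis using Ts subgroup.one_closed by auto
  next
    case False
    then obtain A S' g where A: "A \<in> \<H>" "S' \<in> \<sigma>" "g \<in> carrier G" "r \<in> S'" "hall_for S' A" "y \<in> conj_set g A"
      using complete_hall_elt[OF h y(1,3)] by blast
    have As: "subgroup (conj_set g A) G" using A complete_hall_sub[OF h] conj_set_sub by blast
    let ?L = "(T <#> conj_set g A) \<inter> K"
    have L: "subgroup ?L G" using permutable_prod[OF h T A(1,3)] K(1) by (rule sub_Int)
    have TL: "T \<subseteq> ?L" using sub_set_mult1[OF Ts As] K by auto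
    have yL: "y \<in> ?L" using sub_set_mult2[OF Ts As] A y by auto
    have p: "pi_number S' (index ?L T)" using A(5) hall_for_def TL L by (intro permutable_index[OF h T A(1) _ A(3)]) auto
    have "index K T = index K ?L * index ?L T" using Ts L K TL by (intro index_tower) auto
    hence "pi_number S (index ?L T)" using S by (simp add: pi_number_mult)
    hence "index ?L T = 1" using p parts_disjoint[of S S'] S A y by (intro pi_number_disjoint[of S _ S']) auto
    thus ?thesis using index_1D[OF Ts L TL] yL by simp
  qed
qed

lemma normalizer_non_permutable:
  assumes h: "complete_hall \<H>" and M: "maximal_in M (carrier G)" "M \<notin> permutable \<H>"
  shows "normalizer M = M"
proof -
  note MD = maximal_inD[OF M(1)]
  have "normalizer M = M \<or> normalizer M = carrier G"
    using MD sub_normalizer normalizer_sub by (intro maximal_inE[OF M(1)]) (auto simp: normalizer_def)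
  thus ?thesis using permutable_normal[OF h MD(1)] M(2) by auto
qed

text \<open>If some \<open>m\<close> in \<open>M\<close> moved \<open>T\<close>, the join of
  \<open>T\<close> with its conjugate would be permutable and, by maximality of \<open>T\<close>,
  equal to \<open>M\<close>.\<close>

lemma two_max_prime_normal:
  assumes h: "complete_hall \<H>" and M: "maximal_in M (carrier G)" "M \<notin> permutable \<H>" and T: "maximal_in T M" "T \<in> permutable \<H>"
  shows "M \<subseteq> normalizer T"
proof (rule ccontr)
  note MD = maximal_inD[OF M(1)] and TD = maximal_inD[OF T(1)]
  assume "\<not> M \<subseteq> normalizer T"
  then obtain m where m: "m \<in> M" "m \<notin> normalizer T" by blast
  have mc: "m \<in> carrier G" using m MD by auto
  let ?J = "generate G (T \<union> conj_set m T)"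
  have J: "?J \<in> permutable \<H>" using permutable_join[OF h T(2) permutable_conj[OF h T(2) mc]] .
  have TJ: "T \<subseteq> ?J" "conj_set m T \<subseteq> ?J" by (auto intro: generate.incl)
  have JM: "?J \<subseteq> M" using TD conj_set_mono[OF TD(3), of m] conj_set_self[OF TD(2) m(1)]
    by (intro generate_subgroup_incl) auto
  have "?J \<noteq> T" using TJ normalizer_subI[OF subgroup.subset[OF TD(1)] sub_finite[OF TD(1)] mc] m(2) by auto
  hence "?J = M" using maximal_inE[OF T(1) permutable_sub[OF J] TJ(1) JM] by auto
  thus False using J M by auto
qed

text \<open>A conjugate of a Hall subgroup catches an element of \<open>M - T\<close>, so its
  product with \<open>T\<close> contains \<open>M\<close>. Were the product all of \<open>G\<close>,
  then \<open>T\<close> would have \<open>S\<close>-index and contain O^S(G), making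
  \<open>M\<close> permutable.\<close>

lemma hall_supplement:
  assumes h: "complete_hall \<H>" and M: "maximal_in M (carrier G)" "M \<notin> permutable \<H>" and T: "maximal_in T M" "T \<in> permutable \<H>"
  obtains S A g where "A \<in> \<H>" "S \<in> \<sigma>" "g \<in> carrier G" "hall_for S A" "index M T \<in> S" "T <#> conj_set g A = M" "nat_prime (index M T)"
proof -
  note MD = maximal_inD[OF M(1)] and TD = maximal_inD[OF T(1)]
  have q: "nat_prime (index M T)" using normal_max_prime[OF T(1) two_max_prime_normal[OF assms]] .
  obtain x where x: "x \<in> M - T" "prime_power_elt (index M T) x" using prime_power_elt_outside[OF TD(1,2,3) q] by auto
  have "x \<noteq> \<one>" using x TD(1) subgroup.one_closed by auto
  then obtain A S g where A: "A \<in> \<H>" "S \<in> \<sigma>" "g \<in> carrier G" "index M T \<in> S" "hall_for S A" "x \<in> conj_set g A"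
    using complete_hall_elt[OF h q x(2)] by blast
  let ?B = "conj_set g A"
  have B: "subgroup ?B G" using A complete_hall_sub[OF h] conj_set_sub by blast
  let ?L = "T <#> ?B"
  have L: "subgroup ?L G" using permutable_prod[OF h T(2) A(1,3)] .
  have TL: "T \<subseteq> ?L" "?B \<subseteq> ?L" using sub_set_mult1[OF TD(1) B] sub_set_mult2[OF TD(1) B] by auto
  have "M \<inter> ?L = M" using maximal_inE[OF T(1) sub_Int[OF TD(2) L]] TL TD x A by blast
  hence subML: "M \<subseteq> ?L" by blast
  have "?L \<noteq> carrier G"
  proof
    assume e: "?L = carrier G"
    have "pi_number S (index (carrier G) T)"
      using A(5) hall_for_def subgroup_self subgroup.subset[OF TD(1)] e
      by (intro permutable_index[OF h T(2) A(1) _ A(3)]) auto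
    hence "residual S (carrier G) \<subseteq> T"
      using subgroup.subset[OF TD(1)] A by (intro permutable_residual[OF h T(2) subgroup_self])
    hence "M \<in> permutable \<H>" using TD A by (intro permutable_of_residual[OF h A(2)]) auto
    thus False using M by simp
  qed
  hence "?L = M" using maximal_inE[OF M(1) L subML] subgroup.subset[OF L] by auto
  thus thesis using that A q by blast
qed

text \<open>
  If \<open>T\<close> is not normal in \<open>G\<close>, all products \<open>T A\<^sup>u\<close> have the order of \<open>M\<close> for a suitable Hall
  subgroup \<open>A\<close>. Either all \<open>A\<^sup>u\<close> lie in \<open>M\<close>, and \<open>M\<close> is the join of \<open>T\<close> with their normal closure,
  or \<open>O\<^sup>S(T)\<close> is normal in \<open>G\<close>, which forces all conjugates of \<open>T\<close> into \<open>M\<close>.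
\<close>

lemma two_max_normal:
  assumes h: "complete_hall \<H>" and M: "maximal_in M (carrier G)" "M \<notin> permutable \<H>" and T: "maximal_in T M" "T \<in> permutable \<H>"
  shows "carrier G \<subseteq> normalizer T"
proof (rule ccontr)
  note MD = maximal_inD[OF M(1)] and TD = maximal_inD[OF T(1)]
  assume nn: "\<not> carrier G \<subseteq> normalizer T"
  have Tc: "T \<subseteq> carrier G" using TD subgroup.subset by blast
  have MT: "M \<subseteq> normalizer T" using two_max_prime_normal[OF assms] .
  obtain S A g where A: "A \<in> \<H>" "S \<in> \<sigma>" "g \<in> carrier G" "hall_for S A" "index M T \<in> S" "T <#> conj_set g A = M" "nat_prime (index M T)"
    by (rule hall_supplement[OF assms])
  define q where "q = index M T"
  have q: "nat_prime q" "q \<in> S" using A unfolding q_def by auto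
  have As: "subgroup A G" using A complete_hall_sub[OF h] by blast
  have B: "subgroup (conj_set u A) G" if "u \<in> carrier G" for u using As that by (rule conj_set_sub)
  have cB: "index (carrier G) (conj_set u A) = index (carrier G) A" if "u \<in> carrier G" for u
    unfolding index_def using As that by (simp add: conj_set_card subgroup.subset)
  let ?M = "\<lambda>u. T <#> conj_set u A"
  have Ms: "subgroup (?M u) G" if "u \<in> carrier G" for u using permutable_prod[OF h T(2) A(1) that] .
  have TM: "T \<subseteq> ?M u" "conj_set u A \<subseteq> ?M u" if "u \<in> carrier G" for u
    using sub_set_mult1[OF TD(1) B[OF that]] sub_set_mult2[OF TD(1) B[OF that]] by auto
  have Mc: "?M u \<subseteq> carrier G" if "u \<in> carrier G" for u using Ms[OF that] by (rule subgroup.subset)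
  have BM: "conj_set g A \<subseteq> M" using TM[OF A(3)] A(6) by auto
  have iGM: "pi_number (- S) (index (carrier G) M)"
  proof -
    have "index (carrier G) (conj_set g A) = index (carrier G) M * index M (conj_set g A)"
      using B[OF A(3)] MD BM by (intro index_tower)
    hence "index (carrier G) M dvd index (carrier G) A" using cB[OF A(3)] by (metis dvd_triv_left)
    thus ?thesis using A(4) unfolding hall_for_def by (blast intro: pi_number_dvd)
  qed
  \<comment> \<open>This \<open>S\<close>-number divides \<open>index (carrier G) M * q\<close>,
    whose first factor is prime to \<open>S\<close>, so it divides \<open>q\<close>. Value 1 would
    put a Hall subgroup inside \<open>T\<close>, although \<open>q\<close> divides the index of
    \<open>T\<close>.\<close>
  have iM: "index (?M u) T = q" if u: "u \<in> carrier G" for u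
  proof -
    let ?s = "index (?M u) T"
    have ps: "pi_number S ?s" using A(4) hall_for_def Ms[OF u] TM[OF u] by (intro permutable_index[OF h T(2) A(1) _ u]) auto
    have e1: "index (carrier G) T = index (carrier G) M * q" unfolding q_def using TD MD by (intro index_tower)
    have e2: "index (carrier G) T = index (carrier G) (?M u) * ?s"
      using TD Ms[OF u] TM[OF u] Mc[OF u] MD by (intro index_tower)
    have "coprime ?s (index (carrier G) M)" using ps iGM by (intro pi_number_coprime[of S _ "- S"]) auto
    moreover have "?s dvd index (carrier G) M * q" using e1 e2 by (metis dvd_triv_right)
    ultimately have "?s dvd q" by (simp add: coprime_dvd_mult_right_iff)
    moreover have "?s \<noteq> 1"
    proof
      assume "?s = 1"
      hence "conj_set u A \<subseteq> T" using index_1D[OF TD(1) Ms[OF u] TM(1)[OF u]] TM[OF u] by simp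
      hence "index (carrier G) (conj_set u A) = index (carrier G) T * index T (conj_set u A)"
        using B[OF u] TD Tc subgroup_self by (intro index_tower)
      hence "q dvd index (carrier G) A" using e1 cB[OF u] by (metis dvd_mult dvd_mult2 dvd_refl)
      thus False using A(4) q unfolding hall_for_def pi_number_def by blast
    qed
    ultimately show ?thesis using q(1) by (metis prime_nat_iff)
  qed
  show False
  proof (cases "\<forall>u\<in>carrier G. conj_set u A \<subseteq> M")
    case True
    let ?N = "generate G (\<Union>u\<in>carrier G. conj_set u A)"
    have Ac: "A \<subseteq> carrier G" using As by (rule subgroup.subset)
    have NM: "?N \<subseteq> M" using True MD by (intro generate_subgroup_incl) auto
    have N: "subgroup ?N G" using conj_set_sub_carrier[OF Ac] by (intro generate_is_subgroup) blast
    have NQ: "?N \<in> permutable \<H>" using permutable_normal[OF h N normal_closure[OF Ac]] .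
    have J: "generate G (T \<union> ?N) \<in> permutable \<H>" using permutable_join[OF h T(2) NQ] .
    have "M \<subseteq> generate G (T \<union> ?N)"
    proof -
      have "conj_set g A \<subseteq> ?N" using A(3) by (auto intro!: generate.incl)
      hence "T \<subseteq> generate G (T \<union> ?N)" "conj_set g A \<subseteq> generate G (T \<union> ?N)" by (auto intro: generate.incl)
      thus ?thesis using set_mult_least[OF permutable_sub[OF J]] A(6) by blast
    qed
    moreover have "generate G (T \<union> ?N) \<subseteq> M" using NM TD by (intro generate_subgroup_incl) auto
    ultimately show False using J M by auto
  next
    case False
    then obtain u where u: "u \<in> carrier G" "\<not> conj_set u A \<subseteq> M" by blast
    define W where "W = residual S T"
    have W: "subgroup W G" unfolding W_def using TD(1) by (rule residual_sub')
    have WT: "W \<subseteq> T" unfolding W_def using TD(1) by (rule residual_le)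
    \<comment> \<open>Each product has \<open>S\<close>-index \<open>q\<close> over the permutable
      \<open>T\<close>, so its residual already lies in \<open>T\<close>. All these products thus
      share the residual \<open>W\<close> and normalize it.\<close>
    have rW: "residual S (?M v) = W" if v: "v \<in> carrier G" for v
    proof
      have a: "residual S (?M v) \<subseteq> T"
        using q iM[OF v] pi_number_prime[OF q(1)] by (intro permutable_residual[OF h T(2) Ms[OF v] TM(1)[OF v] A(2)]) auto
      show "residual S (?M v) \<subseteq> W"
        using a W prime_power_elt_residual[of _ S _ "?M v"] prime_power_elt_residual[of _ S _ T] unfolding W_def by (intro residual_leI) blast+
      show "W \<subseteq> residual S (?M v)" unfolding W_def
        using residual_sub'[OF Ms[OF v]] prime_power_elt_residual[of _ S _ "?M v"] TM(1)[OF v] by (intro residual_leI) blast+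
    qed
    have Mn: "?M v \<subseteq> normalizer W" if "v \<in> carrier G" for v
      using rW[OF that] sub_normalizer[OF Ms[OF that]] residual_normalizer[OF Mc[OF that], of S] by auto
    have nW: "normalizer W = carrier G"
    proof -
      have "M \<subseteq> normalizer W" using Mn[OF A(3)] A(6) by simp
      moreover have "\<not> normalizer W \<subseteq> M" using Mn[OF u(1)] TM(2)[OF u(1)] u(2) by blast
      ultimately show ?thesis using maximal_inE[OF M(1) normalizer_sub[OF subgroup.subset[OF W]]]
        by (auto simp: normalizer_def)
    qed
    \<comment> \<open>The index of the left side in the right one is an \<open>S\<close>-number
      because \<open>W\<close> is the residual, and prime to \<open>S\<close> because the left side
      contains a Hall subgroup.\<close>
    have WA: "W <#> conj_set v A = ?M v" if v: "v \<in> carrier G" for v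
    proof -
      let ?X = "W <#> conj_set v A"
      have pm: "W <#> conj_set v A = conj_set v A <#> W"
        using nW subgroup.subset[OF B[OF v]] by (intro perm_normalizer[OF W B[OF v]]) auto
      have X: "subgroup ?X G" using W B[OF v] pm by (rule set_mult_sub)
      have XM: "?X \<subseteq> ?M v" using Ms[OF v] WT TM[OF v] by (intro set_mult_least) auto
      have WX: "W \<subseteq> ?X" "conj_set v A \<subseteq> ?X" using sub_set_mult1[OF W B[OF v]] sub_set_mult2[OF W B[OF v]] by auto
      have "pi_number S (index (?M v) W)" using rW[OF v] Ms[OF v] W WT TM(1)[OF v] by (intro residual_index) auto
      moreover have "index (?M v) W = index (?M v) ?X * index ?X W" using W X Ms[OF v] WX XM by (intro index_tower)
      ultimately have p1: "pi_number S (index (?M v) ?X)" by (simp add: pi_number_mult)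
      have "index (carrier G) (conj_set v A) = index (carrier G) ?X * index ?X (conj_set v A)"
        using B[OF v] X WX MD subgroup.subset[OF X] by (intro index_tower)
      moreover have "index (carrier G) ?X = index (carrier G) (?M v) * index (?M v) ?X"
        using X Ms[OF v] XM Mc[OF v] MD by (intro index_tower)
      ultimately have "index (?M v) ?X dvd index (carrier G) A" using cB[OF v] by (metis dvd_mult dvd_mult2 dvd_triv_right)
      hence "pi_number (- S) (index (?M v) ?X)" using A(4) unfolding hall_for_def by (blast intro: pi_number_dvd)
      hence "index (?M v) ?X = 1" using p1 by (intro pi_number_disjoint[of S _ "- S"]) auto
      thus ?thesis using index_1D[OF X Ms[OF v] XM] by simp
    qed
    \<comment> \<open>Conjugates of \<open>M\<close> are again of the form
      \<open>W <#> conj_set v A\<close>, as \<open>W\<close> is normal; by \<open>WA\<close> such a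
      product equals \<open>T <#> conj_set v A\<close> and contains \<open>T\<close>.\<close>
    have cT: "conj_set y T \<subseteq> M" if y: "y \<in> carrier G" for y
    proof -
      let ?v = "inv y \<otimes> g"
      have Ac: "A \<subseteq> carrier G" using As by (rule subgroup.subset)
      have v: "?v \<in> carrier G" using y A by auto
      have "conj_set (inv y) M = conj_set (inv y) (W <#> conj_set g A)" using A(6) WA[OF A(3)] by simp
      also have "\<dots> = conj_set (inv y) W <#> conj_set (inv y) (conj_set g A)"
        using subgroup.subset[OF W] subgroup.subset[OF B[OF A(3)]] y by (intro conj_set_set_mult) auto
      also have "conj_set (inv y) W = W" using nW y unfolding normalizer_def by blast
      also have "conj_set (inv y) (conj_set g A) = conj_set ?v A" using Ac y A by (intro conj_set_comp) auto
      finally have "conj_set (inv y) M = ?M ?v" using WA[OF v] by simp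
      hence "T \<subseteq> conj_set (inv y) M" using TM(1)[OF v] by simp
      hence "conj_set y T \<subseteq> conj_set y (conj_set (inv y) M)" by (rule conj_set_mono)
      thus ?thesis using conj_set_inv[of M y] y MD by simp
    qed
    let ?V = "generate G (\<Union>u\<in>carrier G. conj_set u T)"
    have VM: "?V \<subseteq> M" using cT MD by (intro generate_subgroup_incl) auto
    have V: "subgroup ?V G" using conj_set_sub_carrier[OF Tc] by (intro generate_is_subgroup) blast
    have "T \<subseteq> ?V" using conj_set_id[OF Tc] by (auto intro: generate.incl)
    hence "?V = T \<or> ?V = M" using maximal_inE[OF T(1) V _ VM] by blast
    moreover have "?V \<noteq> T" using normal_closure[OF Tc] nn by auto
    moreover have "?V \<noteq> M" using permutable_normal[OF h V normal_closure[OF Tc]] M by auto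
    ultimately show False by blast
  qed
qed

text \<open>The two subgroups may permute with different Hall sets. Both are normal, so the second
  permutes also with the Hall set of the first, and their join \<open>M\<close> would be
  permutable.\<close>

lemma two_max_unique:
  assumes M: "maximal_in M (carrier G)" "\<And>\<H>. complete_hall \<H> \<Longrightarrow> M \<notin> permutable \<H>"
    and two: "\<And>T. maximal_in T M \<Longrightarrow> \<exists>\<H>. complete_hall \<H> \<and> T \<in> permutable \<H>"
    and T: "maximal_in T1 M" "maximal_in T2 M"
  shows "T1 = T2"
proof (rule ccontr)
  assume ne: "T1 \<noteq> T2"
  note MD = maximal_inD[OF M(1)] and T1 = maximal_inD[OF T(1)] and T2 = maximal_inD[OF T(2)]
  obtain \<H> where h: "complete_hall \<H>" "T1 \<in> permutable \<H>" using two T by blast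
  obtain \<H>' where h': "complete_hall \<H>'" "T2 \<in> permutable \<H>'" using two T by blast
  have n: "carrier G \<subseteq> normalizer T1" "carrier G \<subseteq> normalizer T2"
    using two_max_normal[OF h(1) M(1) M(2)[OF h(1)] T(1) h(2)]
      two_max_normal[OF h'(1) M(1) M(2)[OF h'(1)] T(2) h'(2)] by auto
  let ?J = "generate G (T1 \<union> T2)"
  have J: "?J \<in> permutable \<H>" using permutable_join[OF h(1,2) permutable_normal[OF h(1) T2(1) n(2)]] .
  have TJ: "T1 \<subseteq> ?J" "T2 \<subseteq> ?J" by (auto intro: generate.incl)
  have JM: "?J \<subseteq> M" using T1 T2 by (intro generate_subgroup_incl) auto
  have "?J = M" using maximal_inE[OF T(1) permutable_sub[OF J] TJ(1) JM] maximal_inE[OF T(2) permutable_sub[OF J] TJ(2) JM] ne by auto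
  thus False using J M(2)[OF h(1)] by auto
qed

text \<open>Every conjugate of \<open>M\<close> is \<open>T\<close> times a conjugate of
  \<open>A\<close>, and replacing \<open>T\<close> by \<open>E\<close> does not enlarge it. Hence
  \<open>E\<close> lies in all conjugates of \<open>M\<close>, its normal closure lies in
  \<open>M\<close>, and since a normal \<open>M\<close> would be permutable, this closure is
  \<open>T\<close>.\<close>

lemma two_maximal_over_eq:
  assumes h: "complete_hall \<H>" and M: "maximal_in M (carrier G)" "M \<notin> permutable \<H>" and T: "maximal_in T M" "carrier G \<subseteq> normalizer T"
    and E: "maximal_in L (carrier G)" "maximal_in E L" "T \<subseteq> E" "E \<in> permutable \<H>"
  shows "E = T"
proof -
  note MD = maximal_inD[OF M(1)] and TD = maximal_inD[OF T(1)] and LD = maximal_inD[OF E(1)] and ED = maximal_inD[OF E(2)]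
  have TQ: "T \<in> permutable \<H>" using permutable_normal[OF h TD(1) T(2)] .
  obtain S A g where A: "A \<in> \<H>" "S \<in> \<sigma>" "g \<in> carrier G" "hall_for S A" "index M T \<in> S" "T <#> conj_set g A = M" "nat_prime (index M T)"
    by (rule hall_supplement[OF h M T(1) TQ])
  have As: "subgroup A G" using A complete_hall_sub[OF h] by blast
  have Ac: "A \<subseteq> carrier G" using As by (rule subgroup.subset)
  have Ec: "E \<subseteq> carrier G" using ED subgroup.subset by blast
  have EM: "E \<subseteq> conj_set v M" if v: "v \<in> carrier G" for v
  proof -
    let ?B = "conj_set (v \<otimes> g) A"
    have B: "subgroup ?B G" using As v A by (intro conj_set_sub) auto
    have "conj_set v M = conj_set v T <#> conj_set v (conj_set g A)" unfolding A(6)[symmetric]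
      using subgroup.subset[OF TD(1)] conj_set_sub_carrier[OF Ac A(3)] v by (intro conj_set_set_mult)
    also have "conj_set v T = T" using T(2) v unfolding normalizer_def by blast
    also have "conj_set v (conj_set g A) = ?B" using Ac v A(3) by (intro conj_set_comp)
    finally have vM: "conj_set v M = T <#> ?B" .
    have vMs: "subgroup (conj_set v M) G" using MD v by (intro conj_set_sub)
    have TvM: "T \<subseteq> conj_set v M" unfolding vM using TD(1) B by (rule sub_set_mult1)
    let ?F = "E <#> ?B"
    have vg: "v \<otimes> g \<in> carrier G" using v A by auto
    have F: "subgroup ?F G" using permutable_prod[OF h E(4) A(1) vg] .
    have EF: "E \<subseteq> ?F" "?B \<subseteq> ?F" using sub_set_mult1[OF ED(1) B] sub_set_mult2[OF ED(1) B] by auto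
    have MF: "conj_set v M \<subseteq> ?F" unfolding vM using EF E(3) by (intro set_mult_least[OF F]) auto
    \<comment> \<open>If it were \<open>G\<close>, the index of \<open>E\<close> in \<open>G\<close>
      would equal that of \<open>E \<inter> conj_set v M\<close> in the conjugate of
      \<open>M\<close> and so divide the prime \<open>index M T\<close>; but it is a product of two
      factors different from 1.\<close>
    have "?F \<noteq> carrier G"
    proof
      assume FG: "?F = carrier G"
      have BM: "?B \<subseteq> conj_set v M" unfolding vM using TD(1) B by (rule sub_set_mult2)
      have "E <#> conj_set v M = carrier G"
        using FG mono_set_mult[OF subset_refl BM, of G E] Ec subgroup.subset[OF vMs] set_mult_closed[of E "conj_set v M"] by auto
      moreover have "conj_set v M <#> E = carrier G"
        using FG permutable_commutes[OF E(4) A(1) vg] mono_set_mult[OF BM subset_refl, of G E] Ec subgroup.subset[OF vMs]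
          set_mult_closed[of "conj_set v M" E] by auto
      ultimately have e: "index (carrier G) E = index (conj_set v M) (E \<inter> conj_set v M)"
        using prod_idx[OF ED(1) vMs] by simp
      have I: "subgroup (E \<inter> conj_set v M) G" using ED(1) vMs by (rule sub_Int)
      have "index (conj_set v M) T = index (conj_set v M) (E \<inter> conj_set v M) * index (E \<inter> conj_set v M) T"
        using TD I vMs TvM E(3) by (intro index_tower) auto
      moreover have "index (conj_set v M) T = index M T" unfolding index_def using MD v by (simp add: conj_set_card)
      ultimately have "index (carrier G) E dvd index M T" using e by (metis dvd_triv_left)
      moreover have tw: "index (carrier G) E = index (carrier G) L * index L E" using ED LD by (intro index_tower)
      moreover have ne: "index (carrier G) L \<noteq> 1" "index L E \<noteq> 1"
        using index_1D[OF LD(1-3)] LD(4) index_1D[OF ED(1-3)] ED(4) by auto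
      ultimately have "index (carrier G) E = 1 \<or> nat_prime (index (carrier G) E)" using A(7) by (metis prime_nat_iff)
      thus False using ne prime_product[of "index (carrier G) L" "index L E"] unfolding tw by auto
    qed
    have "?F = conj_set v M"
    proof -
      have "conj_set (inv v) (conj_set v M) \<subseteq> conj_set (inv v) ?F" using MF by (rule conj_set_mono)
      hence 1: "M \<subseteq> conj_set (inv v) ?F" using conj_set_inv2[of M v] v MD by simp
      have 2: "subgroup (conj_set (inv v) ?F) G" using F v by (intro conj_set_sub) auto
      have "conj_set (inv v) ?F = M \<or> conj_set (inv v) ?F = carrier G"
        using maximal_inE[OF M(1) 2 1] subgroup.subset[OF 2] by blast
      moreover have vv: "conj_set v (conj_set (inv v) ?F) = ?F" using v subgroup.subset[OF F] by (intro conj_set_inv)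
      moreover have "conj_set v (carrier G) = carrier G" using conj_set_self[OF subgroup_self v] .
      ultimately show ?thesis using \<open>?F \<noteq> carrier G\<close> by metis
    qed
    thus ?thesis using EF by simp
  qed
  have cE: "conj_set v E \<subseteq> M" if v: "v \<in> carrier G" for v
  proof -
    have "E \<subseteq> conj_set (inv v) M" using EM v by auto
    hence "conj_set v E \<subseteq> conj_set v (conj_set (inv v) M)" by (rule conj_set_mono)
    thus ?thesis using conj_set_inv[of M v] v MD by simp
  qed
  let ?V = "generate G (\<Union>u\<in>carrier G. conj_set u E)"
  have VM: "?V \<subseteq> M" using cE MD by (intro generate_subgroup_incl) auto
  have V: "subgroup ?V G" using conj_set_sub_carrier[OF Ec] by (intro generate_is_subgroup) blast
  have EV: "E \<subseteq> ?V" using conj_set_id[OF Ec] by (auto intro: generate.incl)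
  hence "?V = T \<or> ?V = M" using maximal_inE[OF T(1) V _ VM] E(3) by blast
  moreover have "?V \<noteq> M" using permutable_normal[OF h V normal_closure[OF Ec]] M by auto
  ultimately show ?thesis using EV E(3) by auto
qed

theorem supersoluble_of_two_maximal_permutable:
  assumes M: "maximal_in M (carrier G)" "M \<noteq> {\<one>}" "\<And>\<H>. complete_hall \<H> \<Longrightarrow> M \<notin> permutable \<H>"
    and two: "\<And>T L. maximal_in L (carrier G) \<Longrightarrow> maximal_in T L \<Longrightarrow> \<exists>\<H>. complete_hall \<H> \<and> T \<in> permutable \<H>"
  shows "supersoluble G"
proof -
  note MD = maximal_inD[OF M(1)]
  have "{\<one>} \<subset> M" using M(2) MD(1) subgroup.one_closed by auto
  then obtain T where T: "maximal_in T M" using maximal_in_over[OF triv_subgroup MD(1)] by blast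
  note TD = maximal_inD[OF T]
  obtain \<H> where h: "complete_hall \<H>" "T \<in> permutable \<H>" using two M(1) T by blast
  have MQ: "M \<notin> permutable \<H>" using M(3) h by blast
  have nT: "carrier G \<subseteq> normalizer T" using two_max_normal[OF h(1) M(1) MQ T h(2)] .
  have nM: "normalizer M = M" using normalizer_non_permutable[OF h(1) M(1) MQ] .
  obtain m where m: "m \<in> M" "m \<notin> T" using TD by blast
  have mM: "generate G {m} = M"
    using two_max_unique[OF M(1,3) two[OF M(1)] T] m by (intro unique_max_cyclic[OF MD(1)]) auto
  have mc: "m \<in> carrier G" using m MD by auto
  obtain t where t: "t \<in> T" "T = generate G {t}" using sub_of_cyclic[OF mc TD(1)] TD mM by auto
  have over: "E = T" if E: "maximal_in L (carrier G)" "maximal_in E L" "T \<subseteq> E" for L E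
  proof -
    obtain \<H>' where h': "complete_hall \<H>'" "E \<in> permutable \<H>'" using two E by blast
    show ?thesis using two_maximal_over_eq[OF h'(1) M(1) M(3)[OF h'(1)] T nT E h'(2)] .
  qed
  have q: "nat_prime (index M T)" using normal_max_prime[OF T two_max_prime_normal[OF h(1) M(1) MQ T h(2)]] .
  obtain S where S: "S \<in> \<sigma>" "index M T \<in> S" using part_exists q by blast
  \<comment> \<open>Supplies a second prime: some \<open>r\<close> outside the part of
    \<open>index M T\<close> divides the index of \<open>T\<close>, and an \<open>r\<close>-element
    outside \<open>T\<close> starts the construction of \<open>L\<close>.\<close>
  have "\<not> pi_number S (index (carrier G) T)"
  proof
    assume "pi_number S (index (carrier G) T)"
    hence "residual S (carrier G) \<subseteq> T"
      using S subgroup.subset[OF TD(1)] by (intro permutable_residual[OF h subgroup_self])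
    hence "M \<in> permutable \<H>" using TD by (intro permutable_of_residual[OF h(1) S(1)]) auto
    thus False using MQ by simp
  qed
  then obtain r where r: "nat_prime r" "r dvd index (carrier G) T" "r \<notin> S" unfolding pi_number_def by blast
  obtain y where y: "y \<in> carrier G - T" "prime_power_elt r y"
    using prime_power_elt_outside[OF TD(1) subgroup_self _ r(1,2)] subgroup.subset[OF TD(1)] by blast
  let ?C = "generate G {y}"
  have C: "subgroup ?C G" using y by (intro generate_is_subgroup) auto
  have pm: "T <#> ?C = ?C <#> T" using nT subgroup.subset[OF C] by (intro perm_normalizer[OF TD(1) C]) auto
  let ?K = "T <#> ?C"
  have K: "subgroup ?K G" using TD(1) C pm by (rule set_mult_sub)
  have TK: "T \<subseteq> ?K" using TD(1) C by (rule sub_set_mult1)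
  have yK: "y \<in> ?K" using sub_set_mult2[OF TD(1) C] generate.incl[of y "{y}" G] by auto
  obtain n where n: "card ?C dvd r ^ n" using generate_single_card_dvd[OF y(2)] by blast
  have "index ?K T dvd card ?C" unfolding prod_idx[OF TD(1) C pm]
    using index_mult[OF sub_Int[OF TD(1) C] C] by (metis Int_lower2 dvd_triv_left)
  hence iK: "index ?K T dvd r ^ n" using n by (rule dvd_trans)
  \<comment> \<open>The prime \<open>index M T\<close> divides the index of \<open>T\<close> in
    \<open>G\<close>, whereas \<open>T\<close> has \<open>r\<close>-power index in
    \<open>?K\<close>.\<close>
  have "?K \<noteq> carrier G"
  proof
    assume "?K = carrier G"
    moreover have "index (carrier G) T = index (carrier G) M * index M T" using TD MD by (intro index_tower)
    ultimately have "index M T dvd r ^ n" using iK by (metis dvd_trans dvd_triv_right)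
    hence "index M T = r" using q r by (metis prime_dvd_power primes_dvd_imp_eq)
    thus False using S r by simp
  qed
  hence "?K \<subset> carrier G" using subgroup.subset[OF K] by auto
  then obtain L where L: "?K \<subseteq> L" "maximal_in L (carrier G)" using maximal_in_over[OF K subgroup_self] by blast
  note LD = maximal_inD[OF L(2)]
  have "T \<subset> L" using TK L yK y by blast
  then obtain E where E: "T \<subseteq> E" "maximal_in E L" using maximal_in_over[OF TD(1) LD(1)] by blast
  \<comment> \<open>By \<open>over\<close> there is nothing strictly between, so \<open>L\<close>
    equals \<open>?K\<close> and has index exactly \<open>r\<close> over \<open>T\<close>.\<close>
  have TL: "maximal_in T L" using over[OF L(2) E(2,1)] E by simp
  have "?K = L" using maximal_inE[OF TL K TK L(1)] yK y by auto
  moreover have pL: "nat_prime (index L T)" using nT LD by (intro normal_max_prime[OF TL]) auto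
  ultimately have iL: "index L T = r" using iK r by (metis prime_dvd_power primes_dvd_imp_eq)
  \<comment> \<open>Otherwise \<open>M\<close> and \<open>L\<close> are two self-normalizing
    subgroups of different prime indices over the normal subgroup \<open>T\<close>, which the
    counting of conjugates excludes.\<close>
  have nL: "carrier G \<subseteq> normalizer L"
  proof (rule ccontr)
    assume nn: "\<not> carrier G \<subseteq> normalizer L"
    have "normalizer L = L \<or> normalizer L = carrier G"
      using LD sub_normalizer normalizer_sub by (intro maximal_inE[OF L(2)]) (auto simp: normalizer_def)
    hence "normalizer L = L" using nn by auto
    moreover have "index M T \<noteq> index L T" using iL S r by auto
    ultimately show False using two_self_normalizing_contra[OF TD(1) nT MD(1) TD(3) q nM LD(1) _ pL] maximal_inD[OF TL] by blast
  qed
  show ?thesis using supersoluble_of_chain[OF TD(1) nT t(2,1) TL nL L(2)] .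
qed

text \<open>One Hall subgroup is chosen for each part. For the exactly-one clause, a group that is
  Hall for two parts would be trivial, and a prime of the first part would then divide its
  index.\<close>

lemma complete_hall_exI:
  assumes "\<And>S. S \<in> sigma_of_group \<sigma> G \<Longrightarrow> \<exists>A. hall_for S A"
  shows "\<exists>\<H>. complete_hall \<H>"
proof -
  define f where "f S = (SOME A. hall_for S A)" for S
  have f: "hall_for S (f S)" if "S \<in> sigma_of_group \<sigma> G" for S
    unfolding f_def using assms[OF that] by (rule someI_ex)
  have uniq: "S' = S" if S: "S \<in> sigma_of_group \<sigma> G" "S' \<in> sigma_of_group \<sigma> G" "hall_for S (f S')" for S S'
  proof (rule ccontr)
    assume ne: "S' \<noteq> S"
    have Ss: "S \<in> \<sigma>" "S' \<in> \<sigma>" using S unfolding sigma_of_group_def by auto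
    obtain p where p: "p \<in> S" "nat_prime p" "p dvd card (carrier G)"
      using S(1) unfolding sigma_of_group_def primes_of_group_def order_def by auto
    have "card (f S') = 1" using f[OF S(2)] S(3) parts_disjoint[OF Ss] ne
      unfolding hall_for_def by (intro pi_number_disjoint[of S _ S']) auto
    moreover have "index (carrier G) (f S') * card (f S') = card (carrier G)"
      using S(3) subgroup_self unfolding hall_for_def by (intro index_mult subgroup.subset) auto
    ultimately have "p dvd index (carrier G) (f S')" using p by simp
    thus False using S(3) p unfolding hall_for_def pi_number_def by auto
  qed
  have "complete_hall (f ` sigma_of_group \<sigma> G)"
    unfolding complete_hall_sigma_set_def hall_iff
  proof (intro conjI ballI impI)
    fix A assume "A \<in> f ` sigma_of_group \<sigma> G"
    then obtain S where S: "S \<in> sigma_of_group \<sigma> G" "A = f S" by blast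
    show "subgroup A G" using f[OF S(1)] S(2) unfolding hall_for_def by simp
    show "\<exists>S\<in>\<sigma>. hall_for S A" using f[OF S(1)] S unfolding sigma_of_group_def by blast
  next
    fix S assume S: "S \<in> sigma_of_group \<sigma> G"
    show "\<exists>!A. A \<in> f ` sigma_of_group \<sigma> G \<and> hall_for S A"
      using S f uniq by (intro ex1I[of _ "f S"]) auto
  qed
  thus ?thesis by blast
qed

end

context fin_group begin

section \<open>Supersoluble groups\<close>

text \<open>Unpacks a cyclic quotient into a product decomposition, the form in which the series of
  a supersoluble group is used below.\<close>

lemma cyclic_factorD:
  assumes N: "subgroup N G" and K: "subgroup K G" "N \<subseteq> K" "K \<subseteq> normalizer N"
    and c: "cyclic_group (G\<lparr>carrier := K\<rparr> Mod N)"
  shows "\<exists>x \<in> K. K = N <#> generate G {x}"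
proof -
  have nor: "N \<lhd> G\<lparr>carrier := K\<rparr>" using normal_rel[OF K(1)] N K by auto
  interpret n: normal N "G\<lparr>carrier := K\<rparr>" by (rule nor)
  interpret F: group "G\<lparr>carrier := K\<rparr> Mod N" by (rule n.factorgroup_is_group)
  have car: "carrier (G\<lparr>carrier := K\<rparr> Mod N) = (\<lambda>k. N #> k) ` K" by (simp add: carrier_FactGroup)
  obtain X where X: "X \<in> carrier (G\<lparr>carrier := K\<rparr> Mod N)"
    "carrier (G\<lparr>carrier := K\<rparr> Mod N) = range (\<lambda>i::int. X [^]\<^bsub>G\<lparr>carrier := K\<rparr> Mod N\<^esub> i)"
    using c unfolding F.cyclic_group by blast
  obtain x where x: "x \<in> K" "X = N #> x" using X(1) unfolding car by blast
  have xc: "x \<in> carrier G" using x K sub_carrier by auto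
  have pw: "X [^]\<^bsub>G\<lparr>carrier := K\<rparr> Mod N\<^esub> i = N #> (x [^] i)" for i :: int
  proof -
    have "(N #>\<^bsub>G\<lparr>carrier := K\<rparr>\<^esub> x) [^]\<^bsub>G\<lparr>carrier := K\<rparr> Mod N\<^esub> i = N #>\<^bsub>G\<lparr>carrier := K\<rparr>\<^esub> (x [^]\<^bsub>G\<lparr>carrier := K\<rparr>\<^esub> i)"
      using x by (intro n.FactGroup_int_pow) simp
    thus ?thesis using int_pow_consistent[OF K(1) x(1)] x(2) by simp
  qed
  have gK: "generate G {x} \<subseteq> K" using x K by (intro generate_subgroup_incl) auto
  have "K \<subseteq> N <#> generate G {x}"
  proof
    fix k assume k: "k \<in> K"
    have kc: "k \<in> carrier G" using k K sub_carrier by auto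
    have "N #> k \<in> carrier (G\<lparr>carrier := K\<rparr> Mod N)" unfolding car using k by blast
    then obtain i :: int where i: "N #> k = N #> (x [^] i)" unfolding X(2) pw by blast
    have "k \<in> N #> (x [^] i)" using rcos_self[OF kc N] i by simp
    then obtain n where "n \<in> N" "k = n \<otimes> x [^] i" unfolding r_coset_def by blast
    moreover have "x [^] i \<in> generate G {x}" unfolding generate_pow[OF xc] by blast
    ultimately show "k \<in> N <#> generate G {x}" using set_multI by blast
  qed
  moreover have "N <#> generate G {x} \<subseteq> K" using K gK by (intro set_mult_least) auto
  ultimately show ?thesis using x(1) by blast
qed

text \<open>The classical proof that subgroups of cyclic groups are cyclic, carried out modulo
  \<open>N\<close>: the generator \<open>y\<close> is an element of \<open>X\<close> in the coset of
  \<open>a [^] d\<close> with \<open>d > 0\<close> least, and division with remainder does the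
  rest.\<close>

lemma sub_cyclic_mod:
  assumes N: "subgroup N G" "carrier G \<subseteq> normalizer N" and a: "a \<in> carrier G"
    and X: "subgroup X G" "X \<subseteq> N <#> generate G {a}"
  shows "\<exists>y \<in> X. X = (X \<inter> N) <#> generate G {y}"
proof -
  have rep: "\<exists>n\<in>N. \<exists>k::nat. x = n \<otimes> a [^] k" if "x \<in> X" for x
  proof -
    have "x \<in> N <#> generate G {a}" using that X by auto
    then obtain n c where nc: "n \<in> N" "c \<in> generate G {a}" "x = n \<otimes> c" by (rule set_multE)
    moreover obtain k :: nat where "c = a [^] k"
      using nc(2) unfolding generate_pow_on_finite_carrier[OF fin a] by blast
    ultimately show ?thesis by blast
  qed
  let ?P = "\<lambda>d::nat. d > 0 \<and> (\<exists>n\<in>N. n \<otimes> a [^] d \<in> X)"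
  have "\<one> \<otimes> a [^] ord a \<in> X" using a X subgroup.one_closed by simp
  hence "?P (ord a)" using ord_ge_1[OF fin a] subgroup.one_closed[OF N(1)] by auto
  from nat_least[of ?P, OF this] obtain d where least: "?P d \<and> (\<forall>e. ?P e \<longrightarrow> d \<le> e)" ..
  note d = conjunct1[OF least] and mn = spec[OF conjunct2[OF least], THEN mp]
  obtain n0 where n0: "n0 \<in> N" "n0 \<otimes> a [^] d \<in> X" using d by blast
  define y where "y = n0 \<otimes> a [^] d"
  have yX: "y \<in> X" using n0 y_def by simp
  have yc: "y \<in> carrier G" using yX X sub_carrier by auto
  have nc: "n \<in> carrier G" if "n \<in> N" for n using that N sub_carrier by auto
  have move: "\<exists>n'\<in>N. g \<otimes> n = n' \<otimes> g" if "n \<in> N" "g \<in> carrier G" for n g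
  proof -
    have "g \<otimes> n \<otimes> inv g \<in> N" using normalizerD[of g N n] N that by blast
    moreover have "g \<otimes> n = (g \<otimes> n \<otimes> inv g) \<otimes> g" using that nc by (simp add: m_assoc)
    ultimately show ?thesis by blast
  qed
  have ypow: "\<exists>n\<in>N. y [^] (e::nat) = n \<otimes> a [^] (d * e)" for e
  proof (induction e)
    case 0
    show ?case using N subgroup.one_closed by (intro bexI[of _ \<one>]) auto
  next
    case (Suc e)
    then obtain n where n: "n \<in> N" "y [^] e = n \<otimes> a [^] (d * e)" by blast
    obtain n' where n': "n' \<in> N" "a [^] (d * e) \<otimes> n0 = n' \<otimes> a [^] (d * e)"
      using move[OF n0(1), of "a [^] (d * e)"] a by auto
    have "y [^] Suc e = n \<otimes> (a [^] (d * e) \<otimes> n0) \<otimes> a [^] d"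
      using n n0(1) nc a by (simp add: y_def m_assoc)
    also have "\<dots> = (n \<otimes> n') \<otimes> (a [^] (d * e) \<otimes> a [^] d)"
      unfolding n'(2) using n n' nc a by (simp add: m_assoc)
    also have "\<dots> = (n \<otimes> n') \<otimes> a [^] (d * Suc e)" using a by (simp add: nat_pow_mult add.commute)
    finally show ?case using subgroup.m_closed[OF N(1) n(1) n'(1)] by blast
  qed
  have "X \<subseteq> (X \<inter> N) <#> generate G {y}"
  proof
    fix x assume x: "x \<in> X"
    obtain n and k :: nat where nk: "n \<in> N" "x = n \<otimes> a [^] k" using rep[OF x] by blast
    define e where "e = k div d"
    obtain n1 where n1: "n1 \<in> N" "y [^] e = n1 \<otimes> a [^] (d * e)" using ypow by blast
    have yeX: "y [^] e \<in> X" using X(1) yX by (rule sub_pow_closed)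
    have k: "a [^] k = a [^] (k mod d) \<otimes> a [^] (d * e)"
      unfolding e_def using a by (simp add: nat_pow_mult)
    have z: "x \<otimes> inv (y [^] e) \<in> X" using x yeX X by (auto intro: subgroup.m_closed subgroup.m_inv_closed)
    have "x \<otimes> inv (y [^] e) = n \<otimes> (a [^] (k mod d) \<otimes> inv n1)"
      unfolding nk(2) n1(2) k using nk(1) n1(1) nc a
      by (simp add: inv_mult_group m_assoc) (simp add: m_assoc[symmetric])
    moreover obtain n2 where n2: "n2 \<in> N" "a [^] (k mod d) \<otimes> inv n1 = n2 \<otimes> a [^] (k mod d)"
      using move[OF subgroup.m_inv_closed[OF N(1) n1(1)], of "a [^] (k mod d)"] a by blast
    ultimately have e2: "x \<otimes> inv (y [^] e) = (n \<otimes> n2) \<otimes> a [^] (k mod d)"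
      using nk(1) n2(1) nc a by (simp add: m_assoc)
    have nn: "n \<otimes> n2 \<in> N" using nk n2 N by (auto intro: subgroup.m_closed)
    have "k mod d = 0"
    proof (rule ccontr)
      assume "k mod d \<noteq> 0"
      hence "?P (k mod d)" using z nn unfolding e2 by blast
      hence "d \<le> k mod d" by (rule mn)
      moreover have "k mod d < d" using d by simp
      ultimately show False by simp
    qed
    hence "x \<otimes> inv (y [^] e) \<in> X \<inter> N" using e2 nn nc z by auto
    moreover have "y [^] e \<in> generate G {y}" unfolding generate_pow_on_finite_carrier[OF fin yc] by blast
    moreover have "x = (x \<otimes> inv (y [^] e)) \<otimes> y [^] e" using x X yc sub_carrier by (simp add: m_assoc)
    ultimately show "x \<in> (X \<inter> N) <#> generate G {y}" using set_multI by metis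
  qed
  moreover have "(X \<inter> N) <#> generate G {y} \<subseteq> X"
    using X yX by (intro set_mult_least generate_subgroup_incl) auto
  ultimately show ?thesis using yX by blast
qed

lemma pow_conj_self:
  assumes "y \<in> carrier G"
  shows "y \<otimes> y [^] (n::nat) \<otimes> inv y = y [^] n"
proof -
  have "y \<otimes> y [^] n = y [^] n \<otimes> y" using nat_pow_Suc2[OF assms, of n] by simp
  thus ?thesis using assms by (simp add: m_assoc)
qed

text \<open>\<open>X\<close> is cyclic modulo \<open>Y\<close>, so \<open>M\<close> normalizes every
  subgroup between them. With \<open>Z = T \<inter> X\<close> and \<open>M = T <#> X\<close>, a
  group strictly between \<open>Z\<close> and \<open>X\<close> would, multiplied by
  \<open>T\<close>, lie strictly between \<open>T\<close> and \<open>M\<close>. Hence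
  \<open>Z\<close> is normal and maximal in \<open>X\<close>, and
  \<open>index M T = index X Z\<close> is prime.\<close>

lemma prime_index_cyclic_section:
  assumes m: "maximal_in T M" and X: "subgroup X G" "X \<subseteq> M" "M \<subseteq> normalizer X" "\<not> X \<subseteq> T"
    and Y: "subgroup Y G" "Y \<subseteq> T" "M \<subseteq> normalizer Y" and y: "y \<in> X" "X = Y <#> generate G {y}"
  shows "nat_prime (index M T)"
proof -
  note TD = maximal_inD[OF m]
  define Z where "Z = T \<inter> X"
  have Z: "subgroup Z G" unfolding Z_def using TD X by (intro sub_Int)
  have yc: "y \<in> carrier G" using y X sub_carrier by auto
  let ?C = "generate G {y}"
  have C: "subgroup ?C G" using yc by (intro generate_is_subgroup) auto
  have YX: "Y \<subseteq> X" using sub_set_mult1[OF Y(1) C] y(2) by simp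
  have YZ: "Y \<subseteq> Z" unfolding Z_def using Y YX by auto
  have Zc: "Z \<subseteq> carrier G" using Z by (rule subgroup.subset)
  have rep: "\<exists>z\<in>Y. \<exists>e::nat. x = z \<otimes> y [^] e" if "x \<in> X" for x
  proof -
    have "x \<in> Y <#> ?C" using that y(2) by simp
    then obtain z c where zc: "z \<in> Y" "c \<in> ?C" "x = z \<otimes> c" by (rule set_multE)
    moreover obtain e :: nat where "c = y [^] e"
      using zc(2) unfolding generate_pow_on_finite_carrier[OF fin yc] by blast
    ultimately show ?thesis by blast
  qed
  \<comment> \<open>\<open>y\<close> commutes with its own powers, so modulo \<open>Y\<close> it
    centralizes \<open>X\<close>; as \<open>Y\<close> lies in \<open>Z\<close>, it normalizes
    \<open>Z\<close>.\<close>
  have yZ: "y \<in> normalizer Z"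
  proof (rule normalizer_subI[OF Zc sub_finite[OF Z] yc])
    show "conj_set y Z \<subseteq> Z"
    proof
      fix w assume "w \<in> conj_set y Z"
      then obtain z where z: "z \<in> Z" "w = y \<otimes> z \<otimes> inv y" unfolding conj_set_def by blast
      obtain u e where u: "u \<in> Y" "z = u \<otimes> y [^] (e::nat)" using rep[of z] z unfolding Z_def by blast
      have uc: "u \<in> carrier G" using u Y sub_carrier by auto
      have "y \<in> normalizer Y" using y X Y by auto
      hence v: "y \<otimes> u \<otimes> inv y \<in> Y" using u by (intro normalizerD)
      have "w = (y \<otimes> u \<otimes> inv y) \<otimes> (y \<otimes> y [^] e \<otimes> inv y)"
        unfolding z(2) u(2) using yc uc by (intro conj_set_mult1) auto
      also have "y \<otimes> y [^] e \<otimes> inv y = y [^] e"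
        using yc by (rule pow_conj_self)
      also have "y [^] e = inv u \<otimes> z" unfolding u(2) using uc yc by (simp add: m_assoc[symmetric])
      finally have "w = y \<otimes> u \<otimes> inv y \<otimes> (inv u \<otimes> z)" .
      moreover have "y \<otimes> u \<otimes> inv y \<in> Z" "u \<in> Z" using v u(1) YZ by auto
      ultimately show "w \<in> Z" using z(1) subgroup.m_closed[OF Z] subgroup.m_inv_closed[OF Z] by metis
    qed
  qed
  have XZ: "X \<subseteq> normalizer Z"
    unfolding y(2) using YZ sub_normalizer[OF Z] yZ normalizer_sub[OF Zc]
    by (intro set_mult_least generate_subgroup_incl) auto
  have TZ: "T \<subseteq> normalizer Z"
  proof
    fix t assume t: "t \<in> T"
    have tc: "t \<in> carrier G" using t TD sub_carrier by auto
    have "t \<in> normalizer X" using t TD X by auto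
    hence "conj_set t X = X" unfolding normalizer_def by auto
    moreover have "conj_set t T = T" using conj_set_self TD t by auto
    ultimately have "conj_set t Z = Z" unfolding Z_def
      using conj_set_Int[of T X t] TD(1) X(1) tc by (simp add: subgroup.subset)
    thus "t \<in> normalizer Z" unfolding normalizer_def using tc by auto
  qed
  have pTX: "T <#> X = X <#> T" using perm_normalizer[OF X(1) TD(1)] X TD by auto
  have TX: "subgroup (T <#> X) G" using TD(1) X(1) pTX by (rule set_mult_sub)
  have "T <#> X = T \<or> T <#> X = M"
    using maximal_inE[OF m TX sub_set_mult1[OF TD(1) X(1)]] set_mult_least[OF TD(2,3) X(2)] by blast
  hence TXM: "T <#> X = M" using sub_set_mult2[OF TD(1) X(1)] X(4) by auto
  have MZ: "M \<subseteq> normalizer Z" unfolding TXM[symmetric] using normalizer_sub[OF Zc] TZ XZ by (rule set_mult_least)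
  have ZX: "Z \<subseteq> X" unfolding Z_def by auto
  have "Z \<noteq> X" using X(4) unfolding Z_def by auto
  have "K = Z \<or> K = X" if K: "subgroup K G" "Z \<subseteq> K" "K \<subseteq> X" for K
  proof -
    have zpow: "\<exists>z'\<in>Z. (z \<otimes> w) [^] (e::nat) = z' \<otimes> w [^] e" if zw: "z \<in> Z" "w \<in> X" for z w e
    proof (induction e)
      case 0 show ?case using Z subgroup.one_closed by (intro bexI[of _ \<one>]) auto
    next
      case (Suc e)
      then obtain z' where z': "z' \<in> Z" "(z \<otimes> w) [^] e = z' \<otimes> w [^] e" by blast
      have c: "z \<in> carrier G" "z' \<in> carrier G" "w \<in> carrier G" using zw z' Z X sub_carrier by auto
      have we: "w [^] e \<in> normalizer Z" using sub_pow_closed[OF X(1) zw(2)] XZ by auto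
      have zz: "w [^] e \<otimes> z \<otimes> inv (w [^] e) \<in> Z" using we zw(1) by (rule normalizerD)
      have "(z \<otimes> w) [^] Suc e = (z' \<otimes> (w [^] e \<otimes> z \<otimes> inv (w [^] e))) \<otimes> w [^] Suc e"
        using z'(2) c by (simp add: m_assoc) (simp add: m_assoc[symmetric])
      thus ?case using subgroup.m_closed[OF Z z'(1) zz] by blast
    qed
    \<comment> \<open>\<open>g\<close> sends \<open>y\<close> to some \<open>y [^] j\<close> up to a
      factor in \<open>Y\<close>. It therefore raises each power of \<open>y\<close> to its
      \<open>j\<close>-th power up to a factor in \<open>Z\<close>, and \<open>K\<close> contains
      these factors.\<close>
    have MK: "M \<subseteq> normalizer K"
    proof
      fix g assume g: "g \<in> M"
      have gc: "g \<in> carrier G" using g TD sub_carrier by auto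
      have "g \<otimes> y \<otimes> inv g \<in> X" using normalizerD[of g X y] g X y by auto
      then obtain u j where u: "u \<in> Y" "g \<otimes> y \<otimes> inv g = u \<otimes> y [^] (j::nat)" using rep by blast
      show "g \<in> normalizer K"
      proof (rule normalizer_subI[OF subgroup.subset[OF K(1)] sub_finite[OF K(1)] gc])
        show "conj_set g K \<subseteq> K"
        proof
          fix w assume "w \<in> conj_set g K"
          then obtain k where k: "k \<in> K" "w = g \<otimes> k \<otimes> inv g" unfolding conj_set_def by blast
          obtain z e where z: "z \<in> Y" "k = z \<otimes> y [^] (e::nat)" using rep[of k] k K by blast
          have zc: "z \<in> carrier G" using z Y sub_carrier by auto
          have yj: "y [^] j \<in> X" using X(1) y(1) by (rule sub_pow_closed)
          obtain z' where z': "z' \<in> Z" "(u \<otimes> y [^] j) [^] e = z' \<otimes> (y [^] j) [^] e"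
            using zpow[OF _ yj, of u e] u YZ by blast
          have ke: "y [^] e \<in> K"
          proof -
            have "y [^] e = inv z \<otimes> k" unfolding z(2) using zc yc by (simp add: m_assoc[symmetric])
            thus ?thesis using z(1) YZ K k by (auto intro!: subgroup.m_closed subgroup.m_inv_closed)
          qed
          have "w = (g \<otimes> z \<otimes> inv g) \<otimes> (g \<otimes> y [^] e \<otimes> inv g)"
            unfolding k(2) z(2) using gc zc yc by (intro conj_set_mult1) auto
          also have "g \<otimes> y [^] e \<otimes> inv g = z' \<otimes> (y [^] j) [^] e"
            using pow_conj[OF gc yc, of e] u(2) z'(2) by simp
          also have "(y [^] j) [^] e = (y [^] e) [^] j" using yc by (simp add: nat_pow_pow mult.commute)
          finally have w: "w = (g \<otimes> z \<otimes> inv g) \<otimes> (z' \<otimes> (y [^] e) [^] j)" .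
          have "g \<otimes> z \<otimes> inv g \<in> Y" using normalizerD[of g Y z] g Y z by auto
          hence "g \<otimes> z \<otimes> inv g \<in> K" using YZ K by auto
          moreover have "z' \<otimes> (y [^] e) [^] j \<in> K"
            using z'(1) K sub_pow_closed[OF K(1) ke] by (auto intro: subgroup.m_closed)
          ultimately show "w \<in> K" unfolding w by (rule subgroup.m_closed[OF K(1)])
        qed
      qed
    qed
    have pm: "T <#> K = K <#> T" using perm_normalizer[OF K(1) TD(1)] MK TD by auto
    have TK: "subgroup (T <#> K) G" using TD(1) K(1) pm by (rule set_mult_sub)
    have "T <#> K = T \<or> T <#> K = M"
      using maximal_inE[OF m TK sub_set_mult1[OF TD(1) K(1)]] set_mult_least[OF TD(2,3), of K] K X by blast
    thus ?thesis
    proof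
      assume "T <#> K = T"
      hence "K \<subseteq> Z" unfolding Z_def using sub_set_mult2[OF TD(1) K(1)] K by auto
      thus ?thesis using K by auto
    next
      assume e: "T <#> K = M"
      \<comment> \<open>Dedekind's modular law: in a factorization of an element of \<open>X\<close>
        over \<open>T <#> K\<close> the left factor lies in \<open>T \<inter> X = Z\<close>, hence
        in \<open>K\<close>.\<close>
      have "X \<subseteq> K"
      proof
        fix x assume x: "x \<in> X"
        have "x \<in> T <#> K" unfolding e using x X by auto
        then obtain t k where tk: "t \<in> T" "k \<in> K" "x = t \<otimes> k" by (rule set_multE)
        have c: "t \<in> carrier G" "k \<in> carrier G" using tk TD K sub_carrier by auto
        have "k \<in> X" using tk K by auto
        hence "x \<otimes> inv k \<in> X" using subgroup.m_closed[OF X(1) x subgroup.m_inv_closed[OF X(1)]] by blast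
        moreover have "x \<otimes> inv k = t" unfolding tk(3) using c by (simp add: m_assoc)
        ultimately have "t \<in> X" by simp
        hence "t \<in> K" using tk K unfolding Z_def by auto
        thus "x \<in> K" unfolding tk(3) using tk K by (intro subgroup.m_closed)
      qed
      thus ?thesis using K by auto
    qed
  qed
  hence mx: "maximal_in Z X" unfolding maximal_in_def using Z X ZX \<open>Z \<noteq> X\<close> by auto
  have "index M T = index X Z" unfolding TXM[symmetric] Z_def using TD(1) X(1) pTX by (rule prod_idx)
  thus ?thesis using normal_max_prime[OF mx XZ] by simp
qed

text \<open>Take the first member of the series whose intersection with \<open>M\<close> is not
  inside \<open>T\<close>. This intersection is cyclic modulo the preceding one, and the two form
  the section to which \<open>prime_index_cyclic_section\<close> applies.\<close>

theorem supersoluble_prime_index: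
  assumes s: "supersoluble G" and m: "maximal_in T M"
  shows "nat_prime (index M T)"
proof -
  note TD = maximal_inD[OF m]
  obtain t :: nat and N where N: "N 0 = {\<one>}" "N t = carrier G" "\<forall>i\<le>t. N i \<lhd> G"
    "\<forall>i<t. N i \<subseteq> N (Suc i) \<and> cyclic_group (G\<lparr>carrier := N (Suc i)\<rparr> Mod N i)"
    using s unfolding supersoluble_def by blast
  let ?P = "\<lambda>i. i \<le> t \<and> \<not> M \<inter> N i \<subseteq> T"
  have "?P t" using N(2) TD subgroup.subset by blast
  from nat_least[of ?P, OF this] obtain j where least: "?P j \<and> (\<forall>i. ?P i \<longrightarrow> j \<le> i)" ..
  note j = conjunct1[OF least] and mn = spec[OF conjunct2[OF least], THEN mp]
  have "j \<noteq> 0"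
  proof
    assume "j = 0"
    thus False using j N(1) TD(1) subgroup.one_closed by auto
  qed
  then obtain i where i: "j = Suc i" by (cases j) auto
  have Yt: "M \<inter> N i \<subseteq> T" using mn[of i] i j by force
  have Ni: "subgroup (N i) G" "carrier G \<subseteq> normalizer (N i)" using N(3) i j normal_normalizer[of "N i"] by auto
  have Nj: "subgroup (N j) G" "carrier G \<subseteq> normalizer (N j)" using N(3) j normal_normalizer[of "N j"] by auto
  have Nij: "N i \<subseteq> N j" "cyclic_group (G\<lparr>carrier := N j\<rparr> Mod N i)" using N(4) i j by auto
  obtain a where a: "a \<in> N j" "N j = N i <#> generate G {a}"
    using cyclic_factorD[OF Ni(1) Nj(1) Nij(1) _ Nij(2)] Ni(2) subgroup.subset[OF Nj(1)] by blast
  let ?X = "M \<inter> N j"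
  have X: "subgroup ?X G" using TD Nj by (intro sub_Int)
  have ac: "a \<in> carrier G" using a(1) Nj sub_carrier by auto
  have "?X \<subseteq> N i <#> generate G {a}" unfolding a(2)[symmetric] by auto
  then obtain y where y: "y \<in> ?X" "?X = (?X \<inter> N i) <#> generate G {y}"
    using sub_cyclic_mod[OF Ni ac X] by blast
  have Y: "?X \<inter> N i = M \<inter> N i" using Nij by auto
  have Mn: "M \<subseteq> normalizer (M \<inter> K)" if "subgroup K G" "carrier G \<subseteq> normalizer K" for K
  proof
    fix g assume g: "g \<in> M"
    have gc: "g \<in> carrier G" using g TD sub_carrier by auto
    have "conj_set g (M \<inter> K) = conj_set g M \<inter> conj_set g K" using TD(2) that gc by (intro conj_set_Int) (auto dest: subgroup.subset)
    also have "\<dots> = M \<inter> K" using conj_set_self[OF TD(2) g] that gc unfolding normalizer_def by auto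
    finally show "g \<in> normalizer (M \<inter> K)" unfolding normalizer_def using gc by auto
  qed
  show ?thesis
  proof (rule prime_index_cyclic_section[OF m X _ Mn[OF Nj] _ sub_Int[OF TD(2) Ni(1)] Yt Mn[OF Ni] y(1)])
    show "\<not> ?X \<subseteq> T" using j by simp
    show "?X = (M \<inter> N i) <#> generate G {y}" using y(2) Y by simp
  qed auto
qed

section \<open>Translation of maximal and 2-maximal subgroups\<close>

lemma maximal_in_iff:
  assumes K: "subgroup K G"
  shows "maximal_subgroup M (G\<lparr>carrier := K\<rparr>) \<longleftrightarrow> maximal_in M K"
proof -
  have e: "subgroup H (G\<lparr>carrier := K\<rparr>) \<longleftrightarrow> subgroup H G \<and> H \<subseteq> K" for H
    using incl_subgroup[OF K] subgroup_incl[OF _ K] subgroup.subset by fastforce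
  show ?thesis unfolding maximal_subgroup_def maximal_in_def e using K by auto
qed

lemma n_maximal_1: "n_maximal_subgroup (Suc 0) H G \<longleftrightarrow> maximal_in H (carrier G)"
proof -
  have "n_maximal_subgroup (Suc 0) H G \<longleftrightarrow> maximal_subgroup H (G\<lparr>carrier := carrier G\<rparr>)"
    unfolding n_maximal_subgroup_def
    by (auto intro!: exI[of _ "\<lambda>i::nat. if i = 0 then carrier G else H"])
  thus ?thesis using maximal_in_iff[OF subgroup_self] by simp
qed

lemma n_maximal_2: "n_maximal_subgroup 2 H G \<longleftrightarrow> (\<exists>L. maximal_in L (carrier G) \<and> maximal_in H L)"
proof
  assume "n_maximal_subgroup 2 H G"
  then obtain M where M: "M (0::nat) = carrier G" "M 2 = H"
    "\<forall>i<2. maximal_subgroup (M (Suc i)) (G\<lparr>carrier := M i\<rparr>)"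
    unfolding n_maximal_subgroup_def by blast
  have "maximal_subgroup (M 1) (G\<lparr>carrier := M 0\<rparr>)" using M(3)[rule_format, of 0] by simp
  hence 1: "maximal_in (M 1) (carrier G)" using maximal_in_iff[OF subgroup_self] M(1) by simp
  have "maximal_subgroup (M 2) (G\<lparr>carrier := M 1\<rparr>)" using M(3)[rule_format, of 1] by (simp add: numeral_2_eq_2)
  hence "maximal_in H (M 1)" using maximal_in_iff[of "M 1"] maximal_inD(1)[OF 1] M(2) by simp
  thus "\<exists>L. maximal_in L (carrier G) \<and> maximal_in H L" using 1 by blast
next
  assume "\<exists>L. maximal_in L (carrier G) \<and> maximal_in H L"
  then obtain L where L: "maximal_in L (carrier G)" "maximal_in H L" by blast
  have a: "maximal_subgroup L (G\<lparr>carrier := carrier G\<rparr>)" "maximal_subgroup H (G\<lparr>carrier := L\<rparr>)"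
    using L maximal_in_iff[OF subgroup_self] maximal_in_iff[of L] maximal_inD(1)[OF L(1)] by blast+
  show "n_maximal_subgroup 2 H G" unfolding n_maximal_subgroup_def
    by (rule conjI, simp, rule exI[of _ "\<lambda>i::nat. if i = 0 then carrier G else if i = 1 then L else H"])
      (use a in \<open>auto simp: less_2_cases_iff\<close>)
qed

end

lemma prime_mult_cases:
  fixes a b p q :: nat
  assumes "nat_prime p" "nat_prime q" "a * b = p * q" "a \<noteq> 1" "b \<noteq> 1"
  shows "a = p \<and> b = q \<or> a = q \<and> b = p"
proof -
  have pos: "p > 0" "q > 0" using assms prime_gt_0_nat by auto
  have "p dvd a * b" using assms(3) by simp
  hence "p dvd a \<or> p dvd b" using assms(1) by (simp add: prime_dvd_mult_iff)
  thus ?thesis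
  proof
    assume "p dvd a"
    then obtain c where c: "a = p * c" by blast
    hence "c * b = q" using assms(3) pos by simp
    hence "c = 1" using assms(2,5) prime_product by blast
    thus ?thesis using c \<open>c * b = q\<close> by auto
  next
    assume "p dvd b"
    then obtain c where c: "b = p * c" by blast
    hence "a * c = q" using assms(3) pos by simp
    hence "c = 1" using assms(2,4) prime_product by blast
    thus ?thesis using c \<open>a * c = q\<close> by auto
  qed
qed

section \<open>Maximal subgroups that are sigma-subnormal\<close>

context sigma_group begin

text \<open>\<open>sigma_step\<close> is reflexive on subgroups, so a chain may start with
  repetitions; these are skipped.\<close>

lemma sigma_subnormal_proper_step:
  assumes "sigma_step\<^sup>*\<^sup>* A (carrier G)" "A \<noteq> carrier G"
  shows "\<exists>B. A \<subset> B \<and> sigma_step A B \<and> sigma_step\<^sup>*\<^sup>* B (carrier G)"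
  using assms
proof (induction rule: converse_rtranclp_induct)
  case (step A B)
  show ?case
  proof (cases "A = B")
    case True thus ?thesis using step by blast
  next
    case False
    hence "A \<subset> B" using step(1) unfolding sigma_step_def by auto
    thus ?thesis using step by blast
  qed
qed simp

text \<open>The first proper link must reach \<open>G\<close>. So \<open>M\<close> is normal, or it
  contains a normal subgroup of \<open>S\<close>-index and with it O^S(G).\<close>

lemma maximal_sigma_subnormal_permutable:
  assumes M: "maximal_in M (carrier G)" "sigma_step\<^sup>*\<^sup>* M (carrier G)" and h: "complete_hall \<H>"
  shows "M \<in> permutable \<H>"
proof -
  note MD = maximal_inD[OF M(1)]
  obtain B where B: "M \<subset> B" "sigma_step M B" using sigma_subnormal_proper_step[OF M(2) MD(4)] by blast
  have Bs: "subgroup B G" using B(2) unfolding sigma_step_def by blast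
  have "B = carrier G" using maximal_inE[OF M(1) Bs] B(1) subgroup.subset[OF Bs] by blast
  hence st: "sigma_step M (carrier G)" using B(2) by simp
  show ?thesis
  proof (cases "carrier G \<subseteq> normalizer M")
    case True thus ?thesis using permutable_normal[OF h MD(1)] by simp
  next
    case False
    then obtain S N where N: "S \<in> \<sigma>" "subgroup N G" "N \<subseteq> M" "carrier G \<subseteq> normalizer N" "pi_number S (index (carrier G) N)"
      using st unfolding sigma_step_def by blast
    have "sigma_step N (carrier G)" using N subgroup.subset[OF N(2)] by (intro sigma_step_normal subgroup_self) auto
    hence "residual S (carrier G) \<subseteq> N" using N by (intro sigma_step_residual)
    thus ?thesis using N MD by (intro permutable_of_residual[OF h N(1)]) auto
  qed
qed

end

section \<open>Maximal subgroups that are not sigma-subnormal\<close>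

text \<open>Setting of the converse direction: \<open>prime_idx\<close> is what supersolubility
  contributes, and \<open>M\<close> is a fixed maximal subgroup that is not
  \<sigma>-subnormal.\<close>

locale ssn_critical = sigma_group +
  fixes M :: "'a set"
  assumes prime_idx: "\<And>T L. maximal_in T L \<Longrightarrow> nat_prime (index L T)"
    and M: "maximal_in M (carrier G)" and M_not: "\<not> sigma_step\<^sup>*\<^sup>* M (carrier G)"
    and two: "\<And>T L. maximal_in L (carrier G) \<Longrightarrow> maximal_in T L \<Longrightarrow> sigma_step\<^sup>*\<^sup>* T (carrier G)"
begin

lemmas MD = maximal_inD[OF M]

abbreviation "p \<equiv> index (carrier G) M"

lemma p: "nat_prime p" using prime_idx[OF M] .

definition index_part :: "nat set" where "index_part = (SOME S. S \<in> \<sigma> \<and> p \<in> S)"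

lemma index_part: "index_part \<in> \<sigma>" "p \<in> index_part"
  using someI_ex[of "\<lambda>S. S \<in> \<sigma> \<and> p \<in> S"] part_exists[OF p] unfolding index_part_def by blast+

lemma residual_not_le: "S \<in> \<sigma> \<Longrightarrow> \<not> residual S (carrier G) \<subseteq> M"
  using sigma_step_of_residual[OF MD(1,2,3)] M_not by blast

lemma normalizer_M: "normalizer M = M"
proof -
  have "normalizer M = M \<or> normalizer M = carrier G"
    using MD sub_normalizer normalizer_sub by (intro maximal_inE[OF M]) (auto simp: normalizer_def)
  moreover have "\<not> carrier G \<subseteq> normalizer M" using sigma_step_normal[OF MD(1,2,3)] M_not by blast
  ultimately show ?thesis by auto
qed

text \<open>If both primes lay in one part, \<open>T\<close> would contain the residual of
  \<open>G\<close> for that part, and so would \<open>M\<close>.\<close>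

lemma index_not_in_part:
  assumes T: "maximal_in T M" shows "index M T \<notin> index_part"
proof
  assume q: "index M T \<in> index_part"
  note TD = maximal_inD[OF T]
  have "index (carrier G) T = p * index M T" using TD MD by (intro index_tower)
  hence "pi_number index_part (index (carrier G) T)" using q index_part(2) prime_idx[OF T] p by (simp add: pi_number_mult pi_number_prime)
  hence "residual index_part (carrier G) \<subseteq> T" using two[OF M T] index_part TD by (intro sigma_subnormal_residual)
  thus False using residual_not_le[OF index_part(1)] TD by blast
qed

text \<open>Produces a path from \<open>T\<close> to \<open>G\<close> with the two primes in the
  opposite order to the path through \<open>M\<close>. It is the first proper link above
  \<open>T\<close> in a \<sigma>-subnormal chain, or, if that link is \<open>G\<close> itself, the
  product of \<open>T\<close> with the group generated by a \<open>p\<close>-element.\<close>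

lemma intermediate:
  assumes T: "maximal_in T M"
  obtains C S where "subgroup C G" "T \<subseteq> C" "index (carrier G) C = index M T" "index C T = p"
    "S \<in> \<sigma>" "index M T \<in> S" "S \<noteq> index_part" "residual index_part C \<subseteq> T" "residual S (carrier G) \<subseteq> C"
proof -
  note TD = maximal_inD[OF T]
  define q where "q = index M T"
  have q: "nat_prime q" unfolding q_def using prime_idx[OF T] .
  obtain S where S: "S \<in> \<sigma>" "q \<in> S" using part_exists[OF q] by blast
  have qS: "q \<notin> index_part" unfolding q_def using index_not_in_part[OF T] .
  have SS: "S \<noteq> index_part" using qS S by auto
  have pq: "p \<noteq> q" using qS index_part by auto
  have Tc: "T \<subseteq> carrier G" using TD subgroup.subset by blast
  have iT: "index (carrier G) T = p * q" unfolding q_def using TD MD by (intro index_tower)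
  have pS: "pi_number S q" "pi_number index_part p" using S index_part q p by (simp_all add: pi_number_prime)
  have "T \<noteq> carrier G" using TD MD by blast
  then obtain B where B: "T \<subset> B" "sigma_step T B" "sigma_step\<^sup>*\<^sup>* B (carrier G)" using sigma_subnormal_proper_step[OF two[OF M T]] by blast
  have Bs: "subgroup B G" using B(2) unfolding sigma_step_def by blast
  have Bc: "B \<subseteq> carrier G" using Bs by (rule subgroup.subset)
  have "\<exists>C. subgroup C G \<and> T \<subseteq> C \<and> index (carrier G) C = q \<and> index C T = p \<and> residual index_part C \<subseteq> T \<and> residual S (carrier G) \<subseteq> C"
  proof (cases "B = carrier G")
    case True
    \<comment> \<open>The other kind of link would place \<open>p\<close> and \<open>q\<close> in
      the same part.\<close>
    have nT: "carrier G \<subseteq> normalizer T"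
    proof (rule ccontr)
      assume "\<not> carrier G \<subseteq> normalizer T"
      then obtain S' N where N: "S' \<in> \<sigma>" "subgroup N G" "N \<subseteq> T" "pi_number S' (index (carrier G) N)"
        using B(2) True unfolding sigma_step_def by blast
      have "index (carrier G) N = index (carrier G) T * index T N" using N TD Tc by (intro index_tower subgroup_self)
      hence "pi_number S' (p * q)" using N(4) iT by (simp add: pi_number_mult)
      hence "p \<in> S'" "q \<in> S'" using p q by (simp_all add: pi_number_mult pi_number_prime)
      thus False using part_unique[OF N(1) index_part(1)] index_part(2) qS by blast
    qed
    obtain y where y: "y \<in> carrier G - T" "prime_power_elt p y"
      using prime_power_elt_outside[OF TD(1) subgroup_self Tc p] iT by auto
    let ?C = "generate G {y}"
    have C: "subgroup ?C G" using y by (intro generate_is_subgroup) auto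
    have pm: "T <#> ?C = ?C <#> T" using nT subgroup.subset[OF C] by (intro perm_normalizer[OF TD(1) C]) auto
    let ?K = "T <#> ?C"
    have K: "subgroup ?K G" using TD(1) C pm by (rule set_mult_sub)
    have TK: "T \<subseteq> ?K" using TD(1) C by (rule sub_set_mult1)
    have yK: "y \<in> ?K" using sub_set_mult2[OF TD(1) C] generate.incl[of y "{y}" G] by auto
    have Kc: "?K \<subseteq> carrier G" using K by (rule subgroup.subset)
    obtain n where n: "card ?C dvd p ^ n" using generate_single_card_dvd[OF y(2)] by blast
    have "index ?K T dvd card ?C" unfolding prod_idx[OF TD(1) C pm]
      using index_mult[OF sub_Int[OF TD(1) C] C] by (metis Int_lower2 dvd_triv_left)
    hence 1: "index ?K T dvd p ^ n" using n by (rule dvd_trans)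
    have tw: "index (carrier G) T = index (carrier G) ?K * index ?K T" using TD K TK Kc MD by (intro index_tower)
    hence 2: "index ?K T dvd p * q" using iT by (metis dvd_triv_right)
    have "coprime (p ^ n) q" using p q pq primes_coprime[of p q] by simp
    hence "coprime (index ?K T) q" using 1 by (meson coprime_divisors dvd_refl)
    hence "index ?K T dvd p" using 2 by (simp add: coprime_dvd_mult_left_iff)
    moreover have "index ?K T \<noteq> 1" using index_1D[OF TD(1) K TK] yK y by auto
    ultimately have iK: "index ?K T = p" using p by (metis prime_nat_iff)
    hence iG: "index (carrier G) ?K = q" using tw iT p by (auto dest: prime_gt_0_nat)
    have Kmax: "maximal_in ?K (carrier G)" using K Kc MD iG q by (intro index_prime_max) auto
    have nK: "carrier G \<subseteq> normalizer ?K"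
    proof (rule ccontr)
      assume nn: "\<not> carrier G \<subseteq> normalizer ?K"
      have "normalizer ?K = ?K \<or> normalizer ?K = carrier G"
        using sub_normalizer[OF K] normalizer_sub[OF Kc] by (intro maximal_inE[OF Kmax]) (auto simp: normalizer_def)
      hence "normalizer ?K = ?K" using nn by auto
      thus False using two_self_normalizing_contra[OF TD(1) nT MD(1) TD(3) _ normalizer_M K TK] iK p q pq q_def by auto
    qed
    have "residual S (carrier G) \<subseteq> ?K"
      using sigma_step_residual[OF sigma_step_normal[OF K MD(2) Kc nK] S(1)] iG pS by simp
    moreover have "residual index_part ?K \<subseteq> T"
      using sigma_step_residual[OF sigma_step_normal[OF TD(1) K TK] index_part(1)] nT Kc iK pS by auto
    ultimately show ?thesis using K TK iK iG by blast
  next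
    case False
    have tw: "index (carrier G) T = index (carrier G) B * index B T" using TD Bs B Bc MD by (intro index_tower) auto
    have "index (carrier G) B \<noteq> 1" using index_1D[OF Bs MD(2) Bc] False by auto
    moreover have "index B T \<noteq> 1" using index_1D[OF TD(1) Bs] B(1) by auto
    ultimately have "index (carrier G) B = p \<and> index B T = q \<or> index (carrier G) B = q \<and> index B T = p"
      using tw iT prime_mult_cases[OF p q] by simp
    thus ?thesis
    proof
      \<comment> \<open>In this order of primes \<open>B\<close> contains the residual of
        \<open>G\<close> for \<open>index_part\<close>, hence a \<open>q\<close>-element of
        \<open>M - T\<close>; this forces \<open>B = M\<close>, which is not
        \<sigma>-subnormal.\<close>
      assume a: "index (carrier G) B = p \<and> index B T = q"
      have rB: "residual index_part (carrier G) \<subseteq> B" using B(3) index_part pS a Bs by (intro sigma_subnormal_residual) auto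
      obtain x where x: "x \<in> M - T" "prime_power_elt q x" using prime_power_elt_outside[OF TD(1,2,3) q] q_def by auto
      have "x \<in> B" using rB prime_power_elt_residual[OF q qS x(2)] prime_power_elt_carrier[OF x(2)] by blast
      hence "M \<inter> B = M" using maximal_inE[OF T sub_Int[OF TD(2) Bs]] TD B x by blast
      hence "B = M" using maximal_inE[OF M Bs _ Bc] False by blast
      thus ?thesis using B(3) M_not by simp
    next
      assume a: "index (carrier G) B = q \<and> index B T = p"
      have "residual S (carrier G) \<subseteq> B" using B(3) S pS a Bs by (intro sigma_subnormal_residual) auto
      moreover have "residual index_part B \<subseteq> T" using sigma_step_residual[OF B(2) index_part(1)] a pS by simp
      ultimately show ?thesis using Bs B a by blast
    qed
  qed
  thus thesis using that S SS unfolding q_def by blast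
qed

text \<open>
  For two maximal subgroups of \<open>M\<close>, the join of the residuals of the intermediate subgroups \<open>C1\<close>,
  \<open>C2\<close> would be a normal subgroup inside \<open>M\<close>, modulo which \<open>C1\<close> and \<open>C2\<close> have to coincide.
\<close>

lemma unique_max:
  assumes T: "maximal_in T1 M" "maximal_in T2 M"
  shows "T1 = T2"
proof (rule ccontr)
  assume ne: "T1 \<noteq> T2"
  note D1 = maximal_inD[OF T(1)] and D2 = maximal_inD[OF T(2)]
  obtain C1 S1 where C1: "subgroup C1 G" "T1 \<subseteq> C1" "index (carrier G) C1 = index M T1" "index C1 T1 = p"
    "S1 \<in> \<sigma>" "index M T1 \<in> S1" "S1 \<noteq> index_part" "residual index_part C1 \<subseteq> T1" "residual S1 (carrier G) \<subseteq> C1"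
    by (rule intermediate[OF T(1)])
  obtain C2 S2 where C2: "subgroup C2 G" "T2 \<subseteq> C2" "index (carrier G) C2 = index M T2" "index C2 T2 = p"
    "S2 \<in> \<sigma>" "index M T2 \<in> S2" "S2 \<noteq> index_part" "residual index_part C2 \<subseteq> T2" "residual S2 (carrier G) \<subseteq> C2"
    by (rule intermediate[OF T(2)])
  have m1: "maximal_in C1 (carrier G)" using C1 subgroup.subset[OF C1(1)] MD prime_idx[OF T(1)] by (intro index_prime_max) auto
  have m2: "maximal_in C2 (carrier G)" using C2 subgroup.subset[OF C2(1)] MD prime_idx[OF T(2)] by (intro index_prime_max) auto
  note CD1 = maximal_inD[OF m1] and CD2 = maximal_inD[OF m2]
  \<comment> \<open>A common \<open>C1\<close> would meet \<open>M\<close> in \<open>T1\<close> and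
    also in \<open>T2\<close>, or contain \<open>M\<close>; then \<open>C1 = M\<close> and
    \<open>index M T1 = p\<close>.\<close>
  have Cne: "C1 \<noteq> C2"
  proof
    assume e: "C1 = C2"
    have I: "subgroup (M \<inter> C1) G" using MD C1 by (intro sub_Int)
    have "M \<inter> C1 = T1 \<or> M \<inter> C1 = M" using maximal_inE[OF T(1) I] D1 C1 by auto
    moreover have "M \<inter> C1 = T2 \<or> M \<inter> C1 = M" using maximal_inE[OF T(2) I] D2 C2 e by auto
    ultimately have "M \<subseteq> C1" using ne by auto
    hence "C1 = M" using maximal_inE[OF M C1(1)] CD1 by auto
    hence "index M T1 = p" using C1(3) by simp
    thus False using index_not_in_part[OF T(1)] index_part by simp
  qed
  have not12: "\<not> C2 \<subseteq> C1" using maximal_inE[OF m2 C1(1)] CD1 Cne by auto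
  let ?E1 = "residual index_part C1" and ?E2 = "residual index_part C2"
  have E: "subgroup ?E1 G" "subgroup ?E2 G" using C1 C2 residual_sub' by auto
  let ?J = "generate G (?E1 \<union> ?E2)"
  have EJc: "?E1 \<union> ?E2 \<subseteq> carrier G" using E subgroup.subset by blast
  have J: "subgroup ?J G" using EJc by (rule generate_is_subgroup)
  have EJ: "?E1 \<subseteq> ?J" "?E2 \<subseteq> ?J" by (auto intro: generate.incl)
  have JM: "?J \<subseteq> M" using C1(8) D1(3) C2(8) D2(3) by (intro generate_subgroup_incl[OF _ MD(1)]) blast
  \<comment> \<open>The primes of \<open>index_part\<close> lie outside \<open>S1\<close> and
    \<open>S2\<close>, so such elements belong to both residuals of \<open>G\<close> and thus to
    both intermediate subgroups.\<close>
  have inC: "x \<in> C1 \<inter> C2" if "nat_prime r" "prime_power_elt r x" "r \<in> index_part" for r x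
  proof -
    have "r \<notin> S1" "r \<notin> S2" using that part_unique index_part C1 C2 by blast+
    thus ?thesis using prime_power_elt_residual[of r S1 x "carrier G"] prime_power_elt_residual[of r S2 x "carrier G"]
        that prime_power_elt_carrier C1 C2 by blast
  qed
  have En: "C1 \<subseteq> normalizer ?E1" "C2 \<subseteq> normalizer ?E2"
    using sub_normalizer[OF C1(1)] residual_normalizer[of C1 index_part] CD1 sub_normalizer[OF C2(1)] residual_normalizer[of C2 index_part] CD2 by auto
  \<comment> \<open>Elements for primes in \<open>index_part\<close> normalize both residuals by
    \<open>inC\<close>; all others lie in one of the residuals.\<close>
  have Xn: "x \<in> normalizer ?J" if x: "nat_prime r" "prime_power_elt r x" "x \<in> C1 \<union> C2" for r x
  proof (cases "r \<in> index_part")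
    case True
    hence "x \<in> normalizer ?E1" "x \<in> normalizer ?E2" using inC[OF x(1,2)] En by auto
    thus ?thesis
      by (intro generate_normalizer[OF EJc prime_power_elt_carrier[OF x(2)]]) (auto dest: normalizerD intro: generate.incl)
  next
    case False
    hence "x \<in> ?E1 \<union> ?E2" using prime_power_elt_residual[OF x(1) False x(2)] x(3) by blast
    thus ?thesis using sub_normalizer[OF J] EJ by blast
  qed
  have "C1 \<subseteq> normalizer ?J" "C2 \<subseteq> normalizer ?J"
    using Xn primepower_generate[OF C1(1) normalizer_sub[OF subgroup.subset[OF J]]]
      primepower_generate[OF C2(1) normalizer_sub[OF subgroup.subset[OF J]]] by blast+
  hence nJ: "carrier G \<subseteq> normalizer ?J"
    using maximal_inE[OF m1 normalizer_sub[OF subgroup.subset[OF J]]] not12 by (auto simp: normalizer_def)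
  have pm: "?J <#> C1 = C1 <#> ?J" using nJ CD1 by (intro perm_normalizer[OF J C1(1)]) auto
  have JC: "subgroup (?J <#> C1) G" using J C1(1) pm by (rule set_mult_sub)
  have "?J <#> C1 = C1 \<or> ?J <#> C1 = carrier G"
    using maximal_inE[OF m1 JC sub_set_mult2[OF J C1(1)] subgroup.subset[OF JC]] .
  \<comment> \<open>Otherwise the normal subgroup \<open>?J\<close> has the same index as
    \<open>?J \<inter> C1\<close> in \<open>C1\<close>, a number for \<open>index_part\<close>, and
    \<open>M\<close> would contain the residual of \<open>G\<close>.\<close>
  moreover have "?J <#> C1 \<noteq> carrier G"
  proof
    assume e: "?J <#> C1 = carrier G"
    have I: "subgroup (?J \<inter> C1) G" using J C1 by (intro sub_Int)
    have "index (carrier G) ?J = index C1 (?J \<inter> C1)" using prod_idx[OF J C1(1) pm] e by simp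
    moreover have "pi_number index_part (index C1 (?J \<inter> C1))"
      using EJ residual_le[OF C1(1), of index_part] C1(1) I by (intro residual_index) auto
    ultimately have "residual index_part (carrier G) \<subseteq> ?J"
      using sigma_step_residual[OF sigma_step_normal[OF J MD(2) subgroup.subset[OF J] nJ] index_part(1)] by simp
    thus False using JM residual_not_le[OF index_part(1)] by blast
  qed
  ultimately have JC1: "?J \<subseteq> C1" using sub_set_mult1[OF J C1(1)] by simp
  have "C2 \<subseteq> C1"
  proof (rule primepower_generate[OF C2(1) C1(1)])
    fix r x assume x: "nat_prime r" "prime_power_elt r x" "x \<in> C2"
    show "x \<in> C1"
      using inC[OF x(1,2)] prime_power_elt_residual[OF x(1) _ x(2,3), of index_part] EJ JC1 by blast
  qed
  thus False using not12 by simp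
qed

text \<open>A \<open>q\<close>-element of \<open>M\<close> outside the unique maximal subgroup
  \<open>T\<close> generates \<open>M\<close>, so \<open>M\<close> is cyclic of
  \<open>q\<close>-power order and normalizes \<open>T\<close>. The intermediate \<open>C\<close>
  normalizes \<open>T\<close> as well, because all its \<open>q\<close>-elements lie in
  \<open>T\<close>; and \<open>C\<close> is not contained in the maximal subgroup
  \<open>M\<close>.\<close>

lemma critical_structure:
  obtains T q k where "maximal_in T M" "carrier G \<subseteq> normalizer T" "nat_prime q" "q \<notin> index_part" "card M = q ^ Suc k" "card T = q ^ k"
proof -
  have "M \<noteq> {\<one>}"
  proof
    assume "M = {\<one>}"
    hence "carrier G \<subseteq> normalizer M" using normal_normalizer one_is_normal by simp
    thus False using normalizer_M MD by simp
  qed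
  hence "{\<one>} \<subset> M" using MD(1) subgroup.one_closed by auto
  then obtain T where T: "maximal_in T M" using maximal_in_over[OF triv_subgroup MD(1)] by blast
  note TD = maximal_inD[OF T]
  define q where "q = index M T"
  have q: "nat_prime q" unfolding q_def using prime_idx[OF T] .
  have qS: "q \<notin> index_part" unfolding q_def using index_not_in_part[OF T] .
  obtain x where x: "x \<in> M - T" "prime_power_elt q x" using prime_power_elt_outside[OF TD(1,2,3) q] q_def by auto
  have xc: "x \<in> carrier G" using x prime_power_elt_carrier by auto
  have gx: "generate G {x} = M" using unique_max[OF T] x by (intro unique_max_cyclic[OF MD(1)]) auto
  obtain n where "card M dvd q ^ n" using generate_single_card_dvd[OF x(2)] gx by auto
  then obtain k' where k': "card M = q ^ k'" using q by (auto simp: divides_primepow_nat)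
  have cT: "q * card T = card M" unfolding q_def using TD by (intro index_mult)
  have "k' \<noteq> 0"
  proof
    assume "k' = 0"
    hence "q * card T = 1" using k' cT by simp
    thus False using q by simp
  qed
  then obtain k where k: "k' = Suc k" by (cases k') auto
  have ck: "card T = q ^ k" using cT k' k q by (auto dest: prime_gt_0_nat)
  obtain C S where C: "subgroup C G" "T \<subseteq> C" "index (carrier G) C = index M T" "index C T = p"
    "S \<in> \<sigma>" "index M T \<in> S" "S \<noteq> index_part" "residual index_part C \<subseteq> T" "residual S (carrier G) \<subseteq> C"
    by (rule intermediate[OF T])
  have Tc: "T \<subseteq> carrier G" using TD subgroup.subset by blast
  have CT: "C \<subseteq> normalizer T"
  proof
    fix c assume c: "c \<in> C"
    have cc: "c \<in> carrier G" using c C sub_carrier by auto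
    show "c \<in> normalizer T"
    proof (rule normalizer_subI[OF Tc sub_finite[OF TD(1)] cc])
      show "conj_set c T \<subseteq> T"
      proof
        fix w assume "w \<in> conj_set c T"
        then obtain t where t: "t \<in> T" "w = c \<otimes> t \<otimes> inv c" unfolding conj_set_def by blast
        have "prime_power_elt q w" unfolding t(2) using prime_power_elt_of_card[OF TD(1) ck t(1)] cc by (rule prime_power_elt_conj)
        moreover have "w \<in> C" unfolding t(2) using c t(1) C by (auto intro!: subgroup.m_closed subgroup.m_inv_closed)
        ultimately show "w \<in> T" using prime_power_elt_residual[OF q qS] C(8) by blast
      qed
    qed
  qed
  have "x \<in> normalizer T"
  proof (rule normalizer_subI[OF Tc sub_finite[OF TD(1)] xc])
    show "conj_set x T \<subseteq> T"
    proof
      fix w assume "w \<in> conj_set x T"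
      then obtain t where t: "t \<in> T" "w = x \<otimes> t \<otimes> inv x" unfolding conj_set_def by blast
      obtain b :: nat where b: "t = x [^] b"
        using t(1) TD(3) gx generate_pow_on_finite_carrier[OF fin xc] by blast
      have "x \<otimes> x [^] b \<otimes> inv x = x [^] b" using xc by (rule pow_conj_self)
      thus "w \<in> T" using t b by simp
    qed
  qed
  hence MT: "M \<subseteq> normalizer T" unfolding gx[symmetric] using normalizer_sub[OF Tc] by (intro generate_subgroup_incl) auto
  have mC: "maximal_in C (carrier G)" using C subgroup.subset[OF C(1)] MD prime_idx[OF T] by (intro index_prime_max) auto
  have "\<not> C \<subseteq> M"
  proof
    assume "C \<subseteq> M"
    hence "C = M" using maximal_inE[OF mC MD(1)] MD by auto
    hence "p = q" using C(3) q_def by simp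
    thus False using qS index_part by simp
  qed
  hence "carrier G \<subseteq> normalizer T" using maximal_inE[OF M normalizer_sub[OF Tc] MT] CT by (auto simp: normalizer_def)
  thus thesis using that[OF T _ q qS] k' k ck by blast
qed

text \<open>As the order of \<open>G\<close> is \<open>p * q ^ Suc k\<close>, the subgroup
  \<open>M\<close> is Hall for the part of \<open>q\<close> and a Sylow \<open>p\<close>-subgroup is
  Hall for \<open>index_part\<close>. The resulting Hall set permutes both with the normal
  \<open>T\<close> and with every subgroup containing O^S(G), the two possible kinds of
  \<open>E\<close>.\<close>

theorem two_maximal_permutable:
  assumes E: "maximal_in L (carrier G)" "maximal_in E L"
  shows "\<exists>\<H>. complete_hall \<H> \<and> E \<in> permutable \<H>"
proof -
  note LD = maximal_inD[OF E(1)] and ED = maximal_inD[OF E(2)]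
  obtain T q k where T: "maximal_in T M" "carrier G \<subseteq> normalizer T" and q: "nat_prime q" "q \<notin> index_part" and c: "card M = q ^ Suc k" "card T = q ^ k"
    by (rule critical_structure)
  note TD = maximal_inD[OF T(1)]
  obtain S where S: "S \<in> \<sigma>" "q \<in> S" using part_exists[OF q(1)] by blast
  have SS: "S \<noteq> index_part" using q S by auto
  have pq: "p \<noteq> q" using q index_part by auto
  have q0: "q > 0" and p0: "p > 0" using q p prime_gt_0_nat by auto
  have cG: "card (carrier G) = p * q ^ Suc k" using index_mult[OF MD(1,2,3)] c by simp
  have pS: "pi_number S q" "pi_number index_part p" using S index_part q p by (simp_all add: pi_number_prime)
  have qpow: "pi_number S (q ^ n)" for n
    unfolding pi_number_def using S(2) q(1) by (metis prime_dvd_power primes_dvd_imp_eq)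
  have ppS: "pi_number (- S) p" using p index_part S SS part_unique by (auto simp: pi_number_prime)
  have qqS: "pi_number (- index_part) (q ^ n)" for n
    unfolding pi_number_def using q by (metis ComplI prime_dvd_power primes_dvd_imp_eq)
  have "\<exists>\<H>. complete_hall \<H>"
  proof (rule complete_hall_exI)
    fix S' assume S': "S' \<in> sigma_of_group \<sigma> G"
    then obtain r where r: "S' \<in> \<sigma>" "r \<in> S'" "nat_prime r" "r dvd p * q ^ Suc k"
      unfolding sigma_of_group_def primes_of_group_def order_def cG by blast
    have "r dvd p \<or> r dvd q ^ Suc k" using r by (simp only: prime_dvd_mult_iff)
    hence "r = p \<or> r = q" using r(3) p q(1) by (metis prime_dvd_power primes_dvd_imp_eq)
    thus "\<exists>A. hall_for S' A"
    proof
      assume "r = q"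
      hence "S' = S" using r S part_unique by blast
      hence "hall_for S' M" unfolding hall_for_def using MD(1) c(1) qpow[of "Suc k"] ppS by (simp del: power_Suc)
      thus ?thesis by blast
    next
      assume "r = p"
      hence e: "S' = index_part" using r index_part part_unique by blast
      obtain P where P: "subgroup P G" "card P = p ^ 1"
        using sylow_thm[OF p group_axioms, of 1 "q ^ Suc k"] cG fin by (auto simp: order_def)
      have "index (carrier G) P = q ^ Suc k" using P cG by (intro index_eqI) auto
      hence "hall_for S' P" unfolding hall_for_def e using P pS qqS[of "Suc k"] by (simp del: power_Suc)
      thus ?thesis by blast
    qed
  qed
  then obtain \<H> where h: "complete_hall \<H>" by blast
  let ?a = "index (carrier G) L" and ?b = "index L E"
  have ab: "nat_prime ?a" "nat_prime ?b" using prime_idx E by auto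
  have tw: "index (carrier G) E = ?a * ?b" using ED LD by (intro index_tower)
  have Ec: "E \<subseteq> carrier G" using ED subgroup.subset by blast
  have e: "?a * ?b * card E = p * q ^ Suc k" using index_mult[OF ED(1) MD(2) Ec] tw cG by simp
  have cE: "card E = q ^ k" if d: "nat_prime d" "p * d * card E = p * q ^ Suc k" for d
  proof -
    have 1: "d * card E = q ^ Suc k" using d(2) p0 by (simp add: mult.assoc)
    hence "d dvd q ^ Suc k" by (metis dvd_triv_left)
    hence "d = q" using d(1) q(1) by (metis prime_dvd_power primes_dvd_imp_eq)
    thus ?thesis using 1 q0 by simp
  qed
  show ?thesis
  proof (cases "?a = p \<or> ?b = p")
    case True
    hence cEk: "card E = q ^ k"
    proof
      assume "?a = p"
      thus ?thesis using cE[OF ab(2)] e by simp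
    next
      assume "?b = p"
      thus ?thesis using cE[OF ab(1)] e mult.commute[of ?a ?b] by simp
    qed
    \<comment> \<open>Each element of \<open>E\<close> is conjugate to some \<open>w\<close> in
      \<open>M\<close> killed by \<open>q ^ k\<close>. Outside \<open>T\<close> such a
      \<open>w\<close> would generate \<open>M\<close> and have order \<open>q ^ Suc k\<close>; and
      \<open>T\<close> is normal.\<close>
    have "E \<subseteq> T"
    proof
      fix x assume x: "x \<in> E"
      have xq: "prime_power_elt q x" using prime_power_elt_of_card[OF ED(1) cEk x] .
      have "\<not> q dvd p" using p q pq primes_dvd_imp_eq by blast
      then obtain g where g: "g \<in> carrier G" "x \<in> conj_set g M" using prime_power_elt_in_conj[OF MD(1) q(1) _ xq] by blast
      obtain w where w: "w \<in> M" "x = g \<otimes> w \<otimes> inv g" using g(2) unfolding conj_set_def by blast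
      have wc: "w \<in> carrier G" using w MD sub_carrier by auto
      have "w \<in> T"
      proof (rule ccontr)
        assume "w \<notin> T"
        hence "generate G {w} = M" using unique_max[OF T(1)] w by (intro unique_max_cyclic[OF MD(1)]) auto
        hence ow: "ord w = q ^ Suc k" using generate_pow_card[OF wc] c by simp
        have "x [^] (q ^ k) = \<one>" using pow_card_sub[OF ED(1) x] cEk by simp
        hence "g \<otimes> w [^] (q ^ k) \<otimes> inv g = \<one>" using w(2) pow_conj[OF g(1) wc] by simp
        moreover have "w [^] (q ^ k) = inv g \<otimes> (g \<otimes> w [^] (q ^ k) \<otimes> inv g) \<otimes> g"
          using g(1) wc by (simp add: m_assoc) (simp add: m_assoc[symmetric])
        ultimately have "w [^] (q ^ k) = \<one>" using g(1) by simp
        hence "ord w dvd q ^ k" using pow_eq_id wc by blast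
        hence "q ^ Suc k dvd q ^ k" using ow by simp
        hence "Suc k \<le> k" using q(1) by (simp add: dvd_power_iff_le prime_ge_2_nat del: power_Suc)
        thus False by simp
      qed
      thus "x \<in> T" unfolding w(2) using normalizerD[of g T w] T(2) g by blast
    qed
    hence "E = T" using cEk c(2) sub_finite[OF TD(1)] by (intro card_subset_eq) auto
    thus ?thesis using permutable_normal[OF h TD(1) T(2)] h by blast
  next
    case False
    have dq: "d = q" if "nat_prime d" "d dvd p * q ^ Suc k" "d \<noteq> p" for d
    proof -
      have "d dvd p \<or> d dvd q ^ Suc k" using that by (simp only: prime_dvd_mult_iff)
      thus ?thesis using that p q(1) by (metis prime_dvd_power primes_dvd_imp_eq)
    qed
    have "?a dvd p * q ^ Suc k" "?b dvd p * q ^ Suc k" unfolding e[symmetric] by (simp_all add: mult.assoc)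
    hence "?a = q" "?b = q" using dq ab False by auto
    hence "pi_number S (index (carrier G) E)" using tw pS by (simp add: pi_number_mult)
    hence "residual S (carrier G) \<subseteq> E" using two[OF E] S ED by (intro sigma_subnormal_residual)
    hence "E \<in> permutable \<H>" using S ED by (intro permutable_of_residual[OF h S(1)])
    thus ?thesis using h by blast
  qed
qed

end

section \<open>The two implications combined\<close>

context sigma_group begin

theorem has_m_sigma_q_2_iff:
  "has_m_sigma_q \<sigma> G 2 \<longleftrightarrow> supersoluble G \<and> has_m_sigma \<sigma> G 2"
proof -
  have q_iff: "has_m_sigma_q \<sigma> G 2 \<longleftrightarrow>
      (\<forall>L H. maximal_in L (carrier G) \<longrightarrow> maximal_in H L \<longrightarrow> (\<exists>\<H>. complete_hall \<H> \<and> H \<in> permutable \<H>)) \<and>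
      (\<exists>M. maximal_in M (carrier G) \<and> \<not> (\<exists>\<H>. complete_hall \<H> \<and> M \<in> permutable \<H>))"
    unfolding has_m_sigma_q_def sigma_quasinormal_iff n_maximal_2 by (auto simp: n_maximal_1)
  have ssn_max: "sigma_subnormal \<sigma> G H \<longleftrightarrow> sigma_step\<^sup>*\<^sup>* H (carrier G)" if "maximal_in H L" for H L
    using sigma_subnormal_iff maximal_inD[OF that] by blast
  have s_iff: "has_m_sigma \<sigma> G 2 \<longleftrightarrow>
      (\<forall>L H. maximal_in L (carrier G) \<longrightarrow> maximal_in H L \<longrightarrow> sigma_step\<^sup>*\<^sup>* H (carrier G)) \<and>
      (\<exists>M. maximal_in M (carrier G) \<and> \<not> sigma_step\<^sup>*\<^sup>* M (carrier G))"
    unfolding has_m_sigma_def n_maximal_2 using ssn_max by (auto simp: n_maximal_1)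
  show ?thesis
  proof
    assume "has_m_sigma_q \<sigma> G 2"
    then obtain M where two: "\<And>L H. maximal_in L (carrier G) \<Longrightarrow> maximal_in H L \<Longrightarrow> \<exists>\<H>. complete_hall \<H> \<and> H \<in> permutable \<H>"
      and M: "maximal_in M (carrier G)" "\<And>\<H>. complete_hall \<H> \<Longrightarrow> M \<notin> permutable \<H>"
      unfolding q_iff by blast
    note MD = maximal_inD[OF M(1)]
    have n1: "carrier G \<subseteq> normalizer {\<one>\<^bsub>G\<^esub>}" using one_is_normal normal_normalizer by blast
    \<comment> \<open>A trivial \<open>M\<close> has no maximal subgroup from which to borrow a Hall
      set. But then \<open>G\<close> has prime order and is its own Hall subgroup, and the normal
      subgroup \<open>M\<close> would be permutable.\<close>
    have M1: "M \<noteq> {\<one>\<^bsub>G\<^esub>}"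
    proof
      assume e: "M = {\<one>\<^bsub>G\<^esub>}"
      have prG: "nat_prime (index (carrier G) {\<one>\<^bsub>G\<^esub>})" using normal_max_prime[OF M(1)] n1 e by simp
      have oc: "index (carrier G) {\<one>\<^bsub>G\<^esub>} = order G" by (rule index_eqI[OF triv_subgroup]) (simp add: order_def)
      have "\<exists>\<H>. complete_hall \<H>"
      proof (rule complete_hall_exI)
        fix S assume "S \<in> sigma_of_group \<sigma> G"
        then obtain r where r: "r \<in> S" "nat_prime r" "r dvd order G"
          unfolding sigma_of_group_def primes_of_group_def by blast
        have "r = order G" using r prG oc primes_dvd_imp_eq by simp
        hence "pi_number S (card (carrier G))" using r pi_number_prime[of r S] by (simp add: order_def)
        hence "hall_for S (carrier G)" unfolding hall_for_def using subgroup_self index_self by (simp add: pi_number_def)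
        thus "\<exists>A. hall_for S A" by blast
      qed
      then obtain \<H> where h: "complete_hall \<H>" by blast
      thus False using permutable_normal[OF h MD(1)] n1 e M(2)[OF h] by simp
    qed
    have "supersoluble G" using M(1) M1 M(2) two by (rule supersoluble_of_two_maximal_permutable)
    \<comment> \<open>\<open>M\<close> could fail to be \<sigma>-quasinormal merely because no
      complete Hall set exists; a maximal subgroup of \<open>M\<close>, available since
      \<open>M\<close> is nontrivial, provides one.\<close>
    moreover have "\<not> sigma_step\<^sup>*\<^sup>* M (carrier G)"
    proof
      assume st: "sigma_step\<^sup>*\<^sup>* M (carrier G)"
      have "{\<one>\<^bsub>G\<^esub>} \<subset> M" using M1 MD(1) subgroup.one_closed by auto
      then obtain T where "maximal_in T M" using maximal_in_over[OF triv_subgroup MD(1)] by blast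
      then obtain \<H> where h: "complete_hall \<H>" using two M(1) by blast
      show False using maximal_sigma_subnormal_permutable[OF M(1) st h] M(2)[OF h] by simp
    qed
    ultimately show "supersoluble G \<and> has_m_sigma \<sigma> G 2"
      unfolding s_iff using two permutable_imp_sigma_subnormal M(1) by blast
  next
    assume a: "supersoluble G \<and> has_m_sigma \<sigma> G 2"
    then obtain M where two: "\<And>L H. maximal_in L (carrier G) \<Longrightarrow> maximal_in H L \<Longrightarrow> sigma_step\<^sup>*\<^sup>* H (carrier G)"
      and Mx: "maximal_in M (carrier G)" "\<not> sigma_step\<^sup>*\<^sup>* M (carrier G)"
      unfolding s_iff by blast
    interpret ssn_critical G \<sigma> M
      using supersoluble_prime_index a Mx two by unfold_locales blast+
    show "has_m_sigma_q \<sigma> G 2" unfolding q_iff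
      using two_maximal_permutable permutable_imp_sigma_subnormal Mx by blast
  qed
qed

end

theorem corollary1p8:
  fixes G :: "('a, 'b) monoid_scheme" and \<sigma> :: "nat set set"
  assumes "partition_on {p. Factorial_Ring.prime p} \<sigma>"
    and "group G" and "finite (carrier G)"
  shows "has_m_sigma_q \<sigma> G 2 \<longleftrightarrow> supersoluble G \<and> has_m_sigma \<sigma> G 2"
proof -
  interpret sigma_group G \<sigma>
    using assms unfolding sigma_group_def fin_group_def fin_group_axioms_def sigma_group_axioms_def by blast
  show ?thesis by (rule has_m_sigma_q_2_iff)
qed

end
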